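(* Let $(\Omega,\Sigma,\mu)$ be a complete $\sigma$-finite measure space and let $p:\Omega\to[1,+\infty]$ be a measurable function with $p_+<+\infty$. Let $X$ be a reflexive subspace of $L^{p(\cdot)}(\Omega)$, endowed with the Luxemburg norm. Then $X$ satisfies the fixed point property (FPP).
   Context: Variable Lebesgue space: for a measurable $p:\Omega\to[1,+\infty]$ put $\Omega_f=\{t: p(t)<+\infty\}$ and, for measurable $g:\Omega\to\mathbb{R}$ (functions equal a.e. are identified), define the modular $\rho(g)=\int_{\Omega_f}|g(t)|^{p(t)}\,d\mu+\operatorname{ess\,sup}_{t\in p^{-1}(\{+\infty\})}|g(t)|$ (the last term is $0$ if $p^{-1}(\{+\infty\})$ is null). $L^{p(\cdot)}(\Omega)$ is the space of those $g$ with $\rho(g/\lambda)<\infty$ for some $\lambda>0$, with the Luxemburg norm $\|g\|=\inf\{\alpha>0:\rho(g/\alpha)\le 1\}$; it is a real Banach space. Here $p_+=\operatorname{ess\,sup}_{t\in\Omega}p(t)$. A Banach space $X$ has the FPP if for every nonempty closed convex bounded $C\subset X$, every nonexpansive $T:C\to C$ (i.e. $\|Tx-Ty\|\le\|x-y\|$ for all $x,y\in C$) has a fixed point. *)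

theory Defs
  imports "HOL-Probability.Essential_Supremum" "HOL-Library.FuncSet"
begin

section \<open>Real normed spaces with explicit carrier\<close>

text \<open>
  Variable Lebesgue spaces depend on a measure and on an exponent function, so they cannot be
  types. Vectors outside the carrier \<open>vecs\<close> are irrelevant; all notions below only look at \<open>vecs\<close>.
\<close>

record 'v normed_sp =
  vecs :: "'v set"
  vadd :: "'v \<Rightarrow> 'v \<Rightarrow> 'v"
  vscale :: "real \<Rightarrow> 'v \<Rightarrow> 'v"
  vnorm :: "'v \<Rightarrow> real"

definition vdist :: "'v normed_sp \<Rightarrow> 'v \<Rightarrow> 'v \<Rightarrow> real" where
  "vdist X x y = vnorm X (vadd X x (vscale X (-1) y))"

definition linear_subspace :: "'v set \<Rightarrow> 'v normed_sp \<Rightarrow> bool" where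
  "linear_subspace S X \<longleftrightarrow> S \<subseteq> vecs X \<and> S \<noteq> {} \<and>
     (\<forall>x\<in>S. \<forall>y\<in>S. vadd X x y \<in> S) \<and> (\<forall>c. \<forall>x\<in>S. vscale X c x \<in> S)"

definition subspace_sp :: "'v normed_sp \<Rightarrow> 'v set \<Rightarrow> 'v normed_sp" where
  "subspace_sp X S = X\<lparr>vecs := S\<rparr>"

definition bounded_functional :: "'v normed_sp \<Rightarrow> ('v \<Rightarrow> real) \<Rightarrow> bool" where
  "bounded_functional X \<phi> \<longleftrightarrow>
     (\<forall>x\<in>vecs X. \<forall>y\<in>vecs X. \<phi> (vadd X x y) = \<phi> x + \<phi> y) \<and>
     (\<forall>c. \<forall>x\<in>vecs X. \<phi> (vscale X c x) = c * \<phi> x) \<and>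
     (\<exists>K. \<forall>x\<in>vecs X. \<bar>\<phi> x\<bar> \<le> K * vnorm X x)"

text \<open>Functionals are kept extensional so that equality of functionals is equality on the carrier.\<close>

definition dual_sp :: "'v normed_sp \<Rightarrow> ('v \<Rightarrow> real) normed_sp" where
  "dual_sp X =
     \<lparr>vecs = {\<phi> \<in> extensional (vecs X). bounded_functional X \<phi>},
      vadd = (\<lambda>\<phi> \<psi>. \<lambda>x\<in>vecs X. \<phi> x + \<psi> x),
      vscale = (\<lambda>c \<phi>. \<lambda>x\<in>vecs X. c * \<phi> x),
      vnorm = (\<lambda>\<phi>. SUP x\<in>{x\<in>vecs X. vnorm X x \<le> 1}. \<bar>\<phi> x\<bar>)\<rparr>"

definition canonical_embedding :: "'v normed_sp \<Rightarrow> 'v \<Rightarrow> (('v \<Rightarrow> real) \<Rightarrow> real)" where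
  "canonical_embedding X x = (\<lambda>\<phi>\<in>vecs (dual_sp X). \<phi> x)"

definition reflexive_sp :: "'v normed_sp \<Rightarrow> bool" where
  "reflexive_sp X \<longleftrightarrow> canonical_embedding X ` vecs X = vecs (dual_sp (dual_sp X))"

definition convex_in :: "'v normed_sp \<Rightarrow> 'v set \<Rightarrow> bool" where
  "convex_in X C \<longleftrightarrow>
     (\<forall>x\<in>C. \<forall>y\<in>C. \<forall>t. 0 \<le> t \<and> t \<le> 1 \<longrightarrow> vadd X (vscale X (1 - t) x) (vscale X t y) \<in> C)"

definition bounded_in :: "'v normed_sp \<Rightarrow> 'v set \<Rightarrow> bool" where
  "bounded_in X C \<longleftrightarrow> (\<exists>B. \<forall>x\<in>C. vnorm X x \<le> B)"

definition closed_in :: "'v normed_sp \<Rightarrow> 'v set \<Rightarrow> bool" where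
  "closed_in X C \<longleftrightarrow>
     (\<forall>s. \<forall>x\<in>vecs X. (\<forall>n::nat. s n \<in> C) \<and> (\<lambda>n. vdist X (s n) x) \<longlonglongrightarrow> 0 \<longrightarrow> x \<in> C)"

definition nonexpansive_on :: "'v normed_sp \<Rightarrow> 'v set \<Rightarrow> ('v \<Rightarrow> 'v) \<Rightarrow> bool" where
  "nonexpansive_on X C T \<longleftrightarrow> (\<forall>x\<in>C. \<forall>y\<in>C. vdist X (T x) (T y) \<le> vdist X x y)"

definition has_FPP :: "'v normed_sp \<Rightarrow> bool" where
  "has_FPP X \<longleftrightarrow>
     (\<forall>C T. C \<subseteq> vecs X \<and> C \<noteq> {} \<and> closed_in X C \<and> convex_in X C \<and> bounded_in X C \<and>
        T \<in> C \<rightarrow> C \<and> nonexpansive_on X C T \<longrightarrow> (\<exists>x\<in>C. T x = x))"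


section \<open>Variable Lebesgue spaces\<close>

text \<open>
  In \<open>ennreal\<close> the essential supremum over a null set is \<open>bot = 0\<close>, which is the convention
  for the second summand.
\<close>

definition modular :: "'a measure \<Rightarrow> ('a \<Rightarrow> ennreal) \<Rightarrow> ('a \<Rightarrow> real) \<Rightarrow> ennreal" where
  "modular M p g =
     (\<integral>\<^sup>+t\<in>{t\<in>space M. p t < \<infinity>}. ennreal (\<bar>g t\<bar> powr enn2real (p t)) \<partial>M) +
     esssup (restrict_space M {t\<in>space M. p t = \<infinity>}) (\<lambda>t. ennreal \<bar>g t\<bar>)"

definition luxemburg_norm :: "'a measure \<Rightarrow> ('a \<Rightarrow> ennreal) \<Rightarrow> ('a \<Rightarrow> real) \<Rightarrow> real" where
  "luxemburg_norm M p g = Inf {\<alpha>. \<alpha> > 0 \<and> modular M p (\<lambda>t. g t / \<alpha>) \<le> 1}"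

definition ae_class :: "'a measure \<Rightarrow> ('a \<Rightarrow> real) \<Rightarrow> ('a \<Rightarrow> real) set" where
  "ae_class M g = {h \<in> borel_measurable M. AE t in M. h t = g t}"

text \<open>
  The vectors are the a.e.-classes of measurable functions. The norm is evaluated on an arbitrary
  representative, since the modular does not change under modification on a null set.
\<close>

definition variable_Lp :: "'a measure \<Rightarrow> ('a \<Rightarrow> ennreal) \<Rightarrow> ('a \<Rightarrow> real) set normed_sp" where
  "variable_Lp M p =
     \<lparr>vecs = {ae_class M g | g.
        g \<in> borel_measurable M \<and> (\<exists>l>0. modular M p (\<lambda>t. g t / l) < \<infinity>)},
      vadd = (\<lambda>F G. {h \<in> borel_measurable M. \<exists>f\<in>F. \<exists>g\<in>G. AE t in M. h t = f t + g t}),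
      vscale = (\<lambda>c F. {h \<in> borel_measurable M. \<exists>f\<in>F. AE t in M. h t = c * f t}),
      vnorm = (\<lambda>F. luxemburg_norm M p (SOME f. f \<in> F))\<rparr>"

end

theory Submission
  imports Defs "HOL-Library.Function_Algebras"
begin

text \<open>Put \<open>q\<close> for the norm. Suppose a nonexpansive \<open>T\<close> on a closed convex bounded set has no fixed point.
Reflexivity makes nested families of closed convex bounded sets intersect
(\<open>directed_Inter_nonempty\<close>), so there is a minimal closed convex invariant set \<open>D\<close>, of diameter \<open>d > 0\<close>.
By Goebel and Karlovitz (\<open>approx_fixed_far\<close>), almost fixed points of \<open>T\<close> are almost at distance \<open>d\<close> from
every given point of \<open>D\<close>. The proof exploits this extremal position in three steps.

First, let \<open>w, w'\<close> be in \<open>D\<close> and let \<open>z\<close> be an almost fixed point. Then \<open>z\<close> is at distance at most \<open>d\<close>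
from \<open>w\<close> and from \<open>w'\<close>, and almost at distance \<open>d\<close> from their midpoint, so the convexity defect of the
modular is small. On the set where the exponent exceeds \<open>1\<close> this forces \<open>w = w'\<close>
(\<open>asymptotically_flat_agree\<close>). Hence differences of points of \<open>D\<close> live where the exponent is \<open>1\<close>, and
there the norm is the norm of \<open>L\<^sup>1\<close>. What remains is Maurey's theorem on reflexive subspaces of \<open>L\<^sup>1\<close>.

Secondly, the same defect in \<open>L\<^sup>1\<close> says that \<open>z(t)\<close> almost never lies strictly between \<open>w(t)\<close> and \<open>w'(t)\<close>
(\<open>approx_fixed_not_between\<close>). If triples of almost fixed points took three separated values on sets of
measure bounded below, then in a long sequence of such triples, each chosen late enough for the preceding
ones, the hull of the values would have to grow by a fixed amount again and again, which boundedness forbids.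
So any three good enough almost fixed points take at most two values up to a small error
(\<open>approx_fixed_two_valued\<close>). Now join two almost fixed points at distance about \<open>d\<close> by a chain
of \<open>n\<close> almost fixed points with steps of norm about \<open>d / n\<close> (\<open>approx_fixed_joined\<close>). In \<open>L\<^sup>1\<close> such a
chain is pointwise almost monotone; having two values, it makes its whole jump at one index, so the
steps have almost disjoint supports. One of the \<open>n\<close> supports is small, which shows that differences
of points of \<open>D\<close> can be concentrated on arbitrarily small sets (\<open>concentrated_difference\<close>).

Thirdly, this is impossible in a reflexive space: concentrated functions would yield an almost disjoint
sequence and hence bounded functionals that separate it from every possible weak limit
(\<open>uniformly_integrable\<close>).

No quotient or ultraproduct is formed. Vectors are functions, the norm is a seminorm on functions, and
fixed points are found up to seminorm \<open>0\<close>, that is, almost everywhere.\<close>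

section \<open>Sublinear functionals and the Hahn--Banach theorem\<close>

text \<open>Functions form a real vector space under pointwise operations, so that subspaces, convex sets and
  linear maps of the library apply to spaces of functions and to spaces of functionals.\<close>

instantiation "fun" :: (type, real_vector) real_vector
begin
definition scaleR_fun :: "real \<Rightarrow> ('a \<Rightarrow> 'b) \<Rightarrow> 'a \<Rightarrow> 'b"
  where "scaleR_fun c f = (\<lambda>x. c *\<^sub>R f x)"
instance
  by standard (auto simp: scaleR_fun_def fun_eq_iff scaleR_add_right scaleR_add_left)
end

lemma scaleR_fun_apply [simp]: "(c *\<^sub>R f) x = c *\<^sub>R f x"
  by (simp add: scaleR_fun_def)

definition sublinear :: "('v::real_vector \<Rightarrow> real) \<Rightarrow> bool" where
  "sublinear p \<longleftrightarrow> (\<forall>x y. p (x + y) \<le> p x + p y) \<and> (\<forall>c x. 0 \<le> c \<longrightarrow> p (c *\<^sub>R x) = c * p x)"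

lemma sublinear_add: "sublinear p \<Longrightarrow> p (x + y) \<le> p x + p y"
  and sublinear_scale: "sublinear p \<Longrightarrow> 0 \<le> c \<Longrightarrow> p (c *\<^sub>R x) = c * p x"
  by (auto simp: sublinear_def)

lemma sublinear_0: "sublinear p \<Longrightarrow> p 0 = 0"
  using sublinear_scale[of p 0 0] by simp

lemma sublinear_minus: "sublinear p \<Longrightarrow> - p (- x) \<le> p x"
  using sublinear_add[of p x "- x"] sublinear_0[of p] by simp

text \<open>An infimum of expressions over a set of parameters is sublinear as soon as parameters can be
  added and rescaled; the infima in the proofs below are all of this kind.\<close>

lemma sublinear_infimum:
  fixes p :: "'v::real_vector \<Rightarrow> 'i \<Rightarrow> real"
  assumes ne: "I \<noteq> {}"
    and bdd: "\<And>x. bdd_below (p x ` I)"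
    and add: "\<And>x y i j. i \<in> I \<Longrightarrow> j \<in> I \<Longrightarrow> \<exists>k\<in>I. p (x + y) k \<le> p x i + p y j"
    and scale: "\<And>c x i. 0 < c \<Longrightarrow> i \<in> I \<Longrightarrow> \<exists>k\<in>I. p (c *\<^sub>R x) k \<le> c * p x i"
    and zero: "(INF i\<in>I. p 0 i) = 0"
  shows "sublinear (\<lambda>x. INF i\<in>I. p x i)"
proof -
  let ?q = "\<lambda>x. INF i\<in>I. p x i"
  have sub: "?q (x + y) \<le> ?q x + ?q y" for x y
  proof -
    have "?q (x + y) - p x i \<le> ?q y" if i: "i \<in> I" for i
    proof (rule cINF_greatest[OF ne])
      fix j assume "j \<in> I"
      with add[OF i this, of x y] obtain k where "k \<in> I" "p (x + y) k \<le> p x i + p y j" by blast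
      with cINF_lower[OF bdd this(1)] show "?q (x + y) - p x i \<le> p y j" by (simp add: algebra_simps)
        (meson order_trans)
    qed
    then have "?q (x + y) - ?q y \<le> ?q x"
      by (intro cINF_greatest[OF ne]) (auto simp: algebra_simps)
    then show ?thesis by simp
  qed
  have le: "?q (c *\<^sub>R x) \<le> c * ?q x" if c: "0 < c" for c x
  proof -
    have "?q (c *\<^sub>R x) / c \<le> ?q x"
    proof (rule cINF_greatest[OF ne])
      fix i assume "i \<in> I"
      with scale[OF c this, of x] obtain k where "k \<in> I" "p (c *\<^sub>R x) k \<le> c * p x i" by blast
      with cINF_lower[OF bdd this(1)] have "?q (c *\<^sub>R x) \<le> c * p x i" by (meson order_trans)
      then show "?q (c *\<^sub>R x) / c \<le> p x i" using c by (simp add: field_simps)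
    qed
    then show ?thesis using c by (simp add: field_simps)
  qed
  have "?q (c *\<^sub>R x) = c * ?q x" if c: "0 \<le> c" for c x
  proof (cases "c = 0")
    case False
    with c have c: "0 < c" by simp
    have "?q x \<le> (1 / c) * ?q (c *\<^sub>R x)"
      using le[of "1 / c" "c *\<^sub>R x"] c by simp
    then have "c * ?q x \<le> ?q (c *\<^sub>R x)" using c by (simp add: field_simps)
    with le[OF c, of x] show ?thesis by simp
  qed (simp add: zero)
  with sub show ?thesis by (auto simp: sublinear_def)
qed

text \<open>A minimal sublinear functional is linear: lowering \<open>q\<close> along a direction \<open>x\<^sub>0\<close> to
  \<open>y \<mapsto> inf\<^sub>t (q (y + t x\<^sub>0) - t q x\<^sub>0)\<close> must not change it, and \<open>t = 1\<close> gives superadditivity.\<close>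

lemma minimal_sublinear_linear:
  assumes q: "sublinear q"
    and minimal: "\<And>r. sublinear r \<Longrightarrow> (\<forall>x. r x \<le> q x) \<Longrightarrow> r = q"
  shows "linear q"
proof -
  have superadd: "q y + q a \<le> q (y + a)" for y a
  proof -
    let ?I = "{0::real..}" and ?p = "\<lambda>y t. q (y + t *\<^sub>R a) - t * q a"
    have lower: "- q (- y) \<le> ?p y t" if "t \<in> ?I" for y t
      using sublinear_add[OF q, of "y + t *\<^sub>R a" "- y"] sublinear_scale[OF q, of t a] that
      by (simp add: algebra_simps)
    then have bdd: "bdd_below (?p y ` ?I)" for y by (meson bdd_belowI2)
    have sub: "sublinear (\<lambda>y. INF t\<in>?I. ?p y t)"
    proof (rule sublinear_infimum)
      fix x y s t assume "s \<in> ?I" "t \<in> ?I"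
      then show "\<exists>k\<in>?I. ?p (x + y) k \<le> ?p x s + ?p y t"
        using sublinear_add[OF q, of "x + s *\<^sub>R a" "y + t *\<^sub>R a"]
        by (intro bexI[of _ "s + t"]) (auto simp: algebra_simps)
    next
      fix c x t assume "0 < (c::real)" "t \<in> ?I"
      then show "\<exists>k\<in>?I. ?p (c *\<^sub>R x) k \<le> c * ?p x t"
        using sublinear_scale[OF q, of c "x + t *\<^sub>R a"]
        by (intro bexI[of _ "c * t"]) (auto simp: algebra_simps)
    next
      have "?p 0 t = 0" if "t \<in> ?I" for t using that sublinear_scale[OF q, of t a] by simp
      then have "?p 0 ` ?I = {0}" by force
      then show "(INF t\<in>?I. ?p 0 t) = 0" by simp
    qed (use bdd in auto)
    moreover have "(INF t\<in>?I. ?p y t) \<le> q y" for y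
      using cINF_lower[OF bdd, of 0 y] by simp
    ultimately have eq: "(\<lambda>y. INF t\<in>?I. ?p y t) = q" using minimal by blast
    have "q y = (INF t\<in>?I. ?p y t)" by (rule fun_cong[OF eq, symmetric])
    also have "\<dots> \<le> q (y + a) - q a" using cINF_lower[OF bdd, of 1 y] by simp
    finally show ?thesis by simp
  qed
  have add: "q (x + y) = q x + q y" for x y
    using superadd[of x y] sublinear_add[OF q, of x y] by simp
  have neg: "q (- x) = - q x" for x
    using add[of x "- x"] sublinear_0[OF q] by simp
  have "q (c *\<^sub>R x) = c * q x" for c x
    using sublinear_scale[OF q, of c x] sublinear_scale[OF q, of "- c" "- x"] neg[of x]
    by (cases "0 \<le> c") auto
  with add show ?thesis by (auto intro!: linearI)
qed

text \<open>Infima of chains of sublinear functionals are sublinear, so there is a minimal one below \<open>p\<close>. No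
  functional has to be extended from a subspace: constraints are encoded into \<open>p\<close>.\<close>

lemma Hahn_Banach_sublinear:
  fixes p :: "'v::real_vector \<Rightarrow> real"
  assumes p: "sublinear p"
  obtains f where "linear f" "\<And>x. f x \<le> p x"
proof -
  define A where "A = {q. sublinear q \<and> (\<forall>x. q x \<le> p x)}"
  define P where "P = (\<lambda>q r :: 'v \<Rightarrow> real. \<forall>x. r x \<le> q x)"
  have "\<exists>m\<in>A. \<forall>a\<in>A. P m a \<longrightarrow> a = m"
  proof (rule predicate_Zorn)
    show "partial_order_on A (relation_of P A)"
      by (rule partial_order_on_relation_ofI) (auto simp: P_def fun_eq_iff intro: order_trans antisym)
  next
    fix C assume C: "C \<in> Chains (relation_of P A)"
    show "\<exists>u\<in>A. \<forall>a\<in>C. P a u"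
    proof (cases "C = {}")
      case True
      then show ?thesis using p by (auto simp: A_def)
    next
      case False
      have CA: "\<And>q. q \<in> C \<Longrightarrow> q \<in> A" and chain: "\<And>q r. q \<in> C \<Longrightarrow> r \<in> C \<Longrightarrow> P q r \<or> P r q"
        using C by (auto simp: Chains_def relation_of_def)
      have sl: "sublinear q" and le: "q x \<le> p x" if "q \<in> C" for q x
        using CA[OF that] by (auto simp: A_def)
      have "- p (- x) \<le> q x" if "q \<in> C" for q x
        using sublinear_minus[OF sl[OF that], of x] le[OF that, of "- x"] by simp
      then have bdd: "bdd_below ((\<lambda>q. q x) ` C)" for x by (meson bdd_belowI2)
      have sub: "sublinear (\<lambda>x. INF q\<in>C. q x)"
      proof (rule sublinear_infimum[OF False bdd])
        fix x y q r assume qr: "q \<in> C" "r \<in> C"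
        from chain[OF this] show "\<exists>k\<in>C. k (x + y) \<le> q x + r y"
        proof
          assume "P q r"
          then show ?thesis using sublinear_add[OF sl[OF qr(2)], of x y] qr
            by (intro bexI[of _ r]) (auto simp: P_def intro: order_trans add_right_mono)
        next
          assume "P r q"
          then show ?thesis using sublinear_add[OF sl[OF qr(1)], of x y] qr
            by (intro bexI[of _ q]) (auto simp: P_def intro: order_trans add_left_mono)
        qed
      next
        fix c x q assume "0 < (c::real)" "q \<in> C"
        then show "\<exists>k\<in>C. k (c *\<^sub>R x) \<le> c * q x"
          using sublinear_scale[OF sl] by (intro bexI[of _ q]) auto
      next
        have "(\<lambda>q. q 0) ` C = {0}" using False sublinear_0[OF sl] by force
        then show "(INF q\<in>C. q 0) = 0" by simp
      qed
      obtain q0 where "q0 \<in> C" using False by blast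
      then have "(INF q\<in>C. q x) \<le> p x" for x
        using cINF_lower[OF bdd, of q0 x] le[of q0 x] by simp
      with sub have "(\<lambda>x. INF q\<in>C. q x) \<in> A" by (auto simp: A_def)
      moreover have "\<forall>a\<in>C. P a (\<lambda>x. INF q\<in>C. q x)"
        using cINF_lower[OF bdd] by (auto simp: P_def)
      ultimately show ?thesis by blast
    qed
  qed
  then obtain m where m: "m \<in> A" and min: "\<And>a. a \<in> A \<Longrightarrow> P m a \<Longrightarrow> a = m" by blast
  have "linear m"
  proof (rule minimal_sublinear_linear)
    show "sublinear m" using m by (simp add: A_def)
    fix r assume "sublinear r" "\<forall>x. r x \<le> m x"
    moreover from this m have "r \<in> A" by (auto simp: A_def intro: order_trans)
    ultimately show "r = m" using min by (auto simp: P_def)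
  qed
  with m that show thesis by (auto simp: A_def)
qed

lemma subspace_projection:
  fixes S :: "'v::real_vector set"
  assumes "subspace S"
  obtains P where "linear P" "\<And>x. P x \<in> S" "\<And>x. x \<in> S \<Longrightarrow> P x = x"
proof -
  have "linear (\<lambda>x::'v. x)" by (simp add: linear_iff)
  from linear_exists_left_inverse_on[OF this assms]
  obtain P where "range P \<subseteq> S" "linear P" "\<forall>v\<in>S. P v = v"
    by auto
  then show thesis using that by blast
qed

section \<open>Separation and weak compactness in reflexive spaces\<close>

text \<open>The seminorm is defined on the whole type, but closedness and completeness are only meant inside the
  subspace \<open>S\<close>: a seminorm given on \<open>S\<close> extends to the type by composition with a linear projection.\<close>

locale seminormed =
  fixes q :: "'v::real_vector \<Rightarrow> real" and S :: "'v set"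
  assumes subspace: "subspace S"
    and q_triangle: "q (x + y) \<le> q x + q y"
    and q_scale: "q (c *\<^sub>R x) = \<bar>c\<bar> * q x"
begin

lemma q_zero [simp]: "q 0 = 0"
  using q_scale[of 0 0] by simp

lemma q_minus [simp]: "q (- x) = q x"
  using q_scale[of "-1" x] by simp

lemma q_nonneg [simp]: "0 \<le> q x"
  using q_triangle[of x "- x"] by simp

lemma q_commute: "q (x - y) = q (y - x)"
  using q_minus[of "x - y"] by simp

lemma q_triangle_sub: "q (x - z) \<le> q (x - y) + q (y - z)"
  using q_triangle[of "x - y" "y - z"] by simp

lemma q_combination:
  assumes "0 \<le> u" "0 \<le> v" "u + v = 1" "q (x - a) \<le> r" "q (y - b) \<le> s"
  shows "q ((u *\<^sub>R x + v *\<^sub>R y) - (u *\<^sub>R a + v *\<^sub>R b)) \<le> u * r + v * s"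
proof -
  have "q ((u *\<^sub>R x + v *\<^sub>R y) - (u *\<^sub>R a + v *\<^sub>R b)) = q (u *\<^sub>R (x - a) + v *\<^sub>R (y - b))"
    by (simp add: algebra_simps)
  also have "\<dots> \<le> u * q (x - a) + v * q (y - b)"
    using q_triangle[of "u *\<^sub>R (x - a)" "v *\<^sub>R (y - b)"] assms(1,2) by (simp add: q_scale)
  also have "\<dots> \<le> u * r + v * s"
    using assms by (intro add_mono mult_left_mono) auto
  finally show ?thesis .
qed

lemma convex_q_ball: "convex {x. q (x - y) \<le> r}"
proof (rule convexI)
  fix x z and u v :: real
  assume *: "x \<in> {x. q (x - y) \<le> r}" "z \<in> {x. q (x - y) \<le> r}" "0 \<le> u" "0 \<le> v" "u + v = 1"
  have "u *\<^sub>R y + v *\<^sub>R y = y" "u * r + v * r = r"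
    using *(5) by (metis scaleR_add_left scaleR_one, metis distrib_right mult_1)
  then show "u *\<^sub>R x + v *\<^sub>R z \<in> {x. q (x - y) \<le> r}"
    using q_combination[of u v x y r z y r] * by simp
qed

definition q_closed :: "'v set \<Rightarrow> bool" where
  "q_closed K \<longleftrightarrow> K \<subseteq> S \<and> (\<forall>x\<in>S. (\<forall>e>0. \<exists>k\<in>K. q (x - k) < e) \<longrightarrow> x \<in> K)"

lemma q_closedD: "q_closed K \<Longrightarrow> x \<in> S \<Longrightarrow> (\<And>e. 0 < e \<Longrightarrow> \<exists>k\<in>K. q (x - k) < e) \<Longrightarrow> x \<in> K"
  unfolding q_closed_def by blast

lemma q_closed_Inter: "F \<noteq> {} \<Longrightarrow> (\<And>K. K \<in> F \<Longrightarrow> q_closed K) \<Longrightarrow> q_closed (\<Inter>F)"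
  unfolding q_closed_def by (meson InterE InterI Inter_lower subset_trans equals0I)

lemma q_closed_ball:
  assumes "q_closed K" shows "q_closed {x \<in> K. q (x - y) \<le> r}"
  unfolding q_closed_def
proof (intro conjI ballI impI)
  show "{x \<in> K. q (x - y) \<le> r} \<subseteq> S" using assms by (auto simp: q_closed_def)
  fix x assume x: "x \<in> S" and *: "\<forall>e>0. \<exists>k\<in>{x \<in> K. q (x - y) \<le> r}. q (x - k) < e"
  have "x \<in> K" using assms x by (rule q_closedD) (use * in blast)
  moreover have "q (x - y) \<le> r"
  proof (rule field_le_epsilon)
    fix e :: real assume "0 < e"
    with * obtain k where "q (k - y) \<le> r" "q (x - k) < e" by blast
    then show "q (x - y) \<le> r + e" using q_triangle_sub[of x y k] by simp
  qed
  ultimately show "x \<in> {x \<in> K. q (x - y) \<le> r}" by simp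
qed

text \<open>The functional comes from the largest sublinear minorant of \<open>q\<close> that takes values at most
  \<open>-d\<close> on \<open>K - x\<close>.\<close>

lemma convex_separation:
  assumes K: "convex K" "K \<noteq> {}" and d: "0 \<le> d" and dist: "\<And>k. k \<in> K \<Longrightarrow> d \<le> q (k - x)"
  obtains \<phi> where "linear \<phi>" "\<And>v. \<phi> v \<le> q v" "\<And>k. k \<in> K \<Longrightarrow> \<phi> k + d \<le> \<phi> x"
proof -
  obtain k0 where k0: "k0 \<in> K" using K(2) by blast
  define I where "I = {0::real..} \<times> K"
  define p where "p = (\<lambda>v (t, k). q (v - t *\<^sub>R (k - x)) - t * d)"
  have lower: "- q v \<le> p v i" if "i \<in> I" for v i
  proof -
    obtain t k where i: "i = (t, k)" "0 \<le> t" "k \<in> K"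
      using \<open>i \<in> I\<close> by (cases i) (auto simp: I_def)
    have "t * d \<le> q (t *\<^sub>R (k - x))" using dist[OF i(3)] i(2) by (simp add: q_scale mult_left_mono)
    also have "\<dots> \<le> q v + q (v - t *\<^sub>R (k - x))"
      using q_triangle[of v "t *\<^sub>R (k - x) - v"] q_commute[of v "t *\<^sub>R (k - x)"] by simp
    finally show ?thesis by (simp add: p_def i)
  qed
  then have bdd: "bdd_below (p v ` I)" for v by (meson bdd_belowI2)
  have sub: "sublinear (\<lambda>v. INF i\<in>I. p v i)"
  proof (rule sublinear_infimum)
    show "I \<noteq> {}" using k0 by (auto simp: I_def)
    show "bdd_below (p v ` I)" for v by (rule bdd)
  next
    fix v w i j assume "i \<in> I" "j \<in> I"
    then obtain t k s l where ij: "i = (t, k)" "j = (s, l)" "0 \<le> t" "0 \<le> s" "k \<in> K" "l \<in> K"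
      by (auto simp: I_def)
    show "\<exists>m\<in>I. p (v + w) m \<le> p v i + p w j"
    proof (cases "t + s = 0")
      case True
      then have "t = 0" "s = 0" using ij by auto
      then show ?thesis using q_triangle[of v w] ij by (intro bexI[of _ "(0, k)"]) (auto simp: p_def I_def)
    next
      case False
      then have pos: "0 < t + s" using ij by simp
      define m where "m = (t / (t + s)) *\<^sub>R k + (s / (t + s)) *\<^sub>R l"
      have "m \<in> K" unfolding m_def
        using K(1) ij pos by (intro convexD) (auto simp: add_divide_distrib[symmetric])
      moreover have m: "(t + s) *\<^sub>R m = t *\<^sub>R k + s *\<^sub>R l"
        using pos by (simp add: m_def scaleR_add_right)
      have "(v + w) - (t + s) *\<^sub>R (m - x) = (v - t *\<^sub>R (k - x)) + (w - s *\<^sub>R (l - x))"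
        unfolding scaleR_diff_right m by (simp add: algebra_simps)
      then have "p (v + w) (t + s, m) \<le> p v i + p w j"
        using q_triangle[of "v - t *\<^sub>R (k - x)" "w - s *\<^sub>R (l - x)"] ij
        by (simp add: p_def algebra_simps)
      ultimately show ?thesis using pos by (intro bexI[of _ "(t + s, m)"]) (auto simp: I_def)
    qed
  next
    fix c v i assume "0 < (c::real)" "i \<in> I"
    then obtain t k where i: "i = (t, k)" "0 \<le> t" "k \<in> K" by (auto simp: I_def)
    have "c *\<^sub>R v - (c * t) *\<^sub>R (k - x) = c *\<^sub>R (v - t *\<^sub>R (k - x))" by (simp add: algebra_simps)
    then have "q (c *\<^sub>R v - (c * t) *\<^sub>R (k - x)) = c * q (v - t *\<^sub>R (k - x))"
      using \<open>0 < c\<close> by (simp add: q_scale)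
    then have "p (c *\<^sub>R v) (c * t, k) = c * p v i"
      by (simp add: p_def i right_diff_distrib)
    then show "\<exists>m\<in>I. p (c *\<^sub>R v) m \<le> c * p v i"
      using \<open>0 < c\<close> i by (intro bexI[of _ "(c * t, k)"]) (auto simp: I_def)
  next
    have "p 0 (0, k0) = 0" by (simp add: p_def)
    moreover have "(0, k0) \<in> I" using k0 by (simp add: I_def)
    ultimately have "(INF i\<in>I. p 0 i) \<le> 0" using cINF_lower[OF bdd, of "(0, k0)" 0] by simp
    moreover have "0 \<le> (INF i\<in>I. p 0 i)"
      using \<open>(0, k0) \<in> I\<close> lower[of _ 0] by (intro cINF_greatest) auto
    ultimately show "(INF i\<in>I. p 0 i) = 0" by simp
  qed
  obtain \<phi> where \<phi>: "linear \<phi>" "\<And>v. \<phi> v \<le> (INF i\<in>I. p v i)"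
    using Hahn_Banach_sublinear[OF sub] by blast
  have le: "\<phi> v \<le> p v i" if "i \<in> I" for v i
    using \<phi>(2)[of v] cINF_lower[OF bdd that, of v] by simp
  show thesis
  proof
    show "linear \<phi>" by fact
    show "\<phi> v \<le> q v" for v using le[of "(0, k0)" v] k0 by (simp add: I_def p_def)
    show "\<phi> k + d \<le> \<phi> x" if "k \<in> K" for k
      using le[of "(1, k)" "k - x"] that by (simp add: I_def p_def linear_diff[OF \<phi>(1)])
  qed
qed

definition dual :: "('v \<Rightarrow> real) set" where
  "dual = {\<phi>. linear \<phi> \<and> (\<exists>c\<ge>0. \<forall>x. \<bar>\<phi> x\<bar> \<le> c * q x)}"

lemma subspace_dual: "real_vector.subspace dual"
  unfolding subspace_def
proof (intro conjI ballI allI)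
  show "0 \<in> dual" by (auto simp: dual_def linear_iff)
next
  fix \<phi> \<psi> assume "\<phi> \<in> dual" "\<psi> \<in> dual"
  then obtain a b where ab: "linear \<phi>" "linear \<psi>" "0 \<le> a" "0 \<le> b"
      "\<And>x. \<bar>\<phi> x\<bar> \<le> a * q x" "\<And>x. \<bar>\<psi> x\<bar> \<le> b * q x" by (auto simp: dual_def)
  have "\<bar>(\<phi> + \<psi>) x\<bar> \<le> (a + b) * q x" for x
    using ab(5,6)[of x] by (simp add: distrib_right)
  moreover have "linear (\<phi> + \<psi>)"
    using ab(1,2) by (simp add: linear_iff distrib_left)
  ultimately show "\<phi> + \<psi> \<in> dual" unfolding dual_def using ab(3,4) add_nonneg_nonneg by blast
next
  fix c \<phi> assume "\<phi> \<in> dual"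
  then obtain a where ab: "linear \<phi>" "0 \<le> a" "\<And>x. \<bar>\<phi> x\<bar> \<le> a * q x" by (auto simp: dual_def)
  have "\<bar>(c *\<^sub>R \<phi>) x\<bar> \<le> (\<bar>c\<bar> * a) * q x" for x
    using mult_left_mono[OF ab(3)[of x], of "\<bar>c\<bar>"] by (simp add: abs_mult mult.assoc)
  moreover have "linear (c *\<^sub>R \<phi>)"
    using ab(1) by (simp add: linear_iff distrib_left)
  moreover have "0 \<le> \<bar>c\<bar> * a" using ab(2) by simp
  ultimately show "c *\<^sub>R \<phi> \<in> dual" unfolding dual_def by blast
qed

end

text \<open>Reflexivity: a functional on the dual with \<open>|\<Phi> \<phi>| \<le> r c\<close> whenever \<open>|\<phi>| \<le> c q\<close> is an evaluation. The
  bound is stated through all admissible constants \<open>c\<close> in order to avoid a norm on the dual.\<close>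

locale reflexive_seminormed = seminormed +
  assumes reflexive: "\<lbrakk>\<And>\<phi> \<psi>. \<phi> \<in> dual \<Longrightarrow> \<psi> \<in> dual \<Longrightarrow> \<Phi> (\<phi> + \<psi>) = \<Phi> \<phi> + \<Phi> \<psi>;
      \<And>c \<phi>. \<phi> \<in> dual \<Longrightarrow> \<Phi> (c *\<^sub>R \<phi>) = c * \<Phi> \<phi>;
      \<And>\<phi> c. \<phi> \<in> dual \<Longrightarrow> 0 \<le> c \<Longrightarrow> (\<And>x. \<bar>\<phi> x\<bar> \<le> c * q x) \<Longrightarrow> \<bar>\<Phi> \<phi>\<bar> \<le> r * c\<rbrakk>
      \<Longrightarrow> \<exists>x\<in>S. \<forall>\<phi>\<in>dual. \<Phi> \<phi> = \<phi> x"
begin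

text \<open>The functional \<open>\<phi> \<mapsto> inf\<^sub>K sup\<^sub>K \<phi>\<close> on the dual is sublinear because the family is directed.
  A linear functional below it belongs to the bidual, so it is the evaluation at a point, and by
  separation that point lies in every member of the family.\<close>

lemma directed_Inter_nonempty:
  assumes ne: "F \<noteq> {}"
    and members: "\<And>K. K \<in> F \<Longrightarrow> K \<noteq> {} \<and> convex K \<and> q_closed K"
    and bounded: "\<And>K x. K \<in> F \<Longrightarrow> x \<in> K \<Longrightarrow> q x \<le> r"
    and directed: "\<And>K L. K \<in> F \<Longrightarrow> L \<in> F \<Longrightarrow> \<exists>J\<in>F. J \<subseteq> K \<inter> L"
  shows "S \<inter> \<Inter>F \<noteq> {}"
proof -
  obtain P where P: "linear P" "\<And>\<phi>. P \<phi> \<in> dual" "\<And>\<phi>. \<phi> \<in> dual \<Longrightarrow> P \<phi> = \<phi>"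
    using subspace_projection[OF subspace_dual] by blast
  define p where "p = (\<lambda>\<phi> K. SUP x\<in>K. P \<phi> x)"
  have bound: "\<bar>\<phi> x\<bar> \<le> r * c" if "K \<in> F" "x \<in> K" "0 \<le> c" "\<And>x. \<bar>\<phi> x\<bar> \<le> c * q x" for K x c and \<phi> :: "'a \<Rightarrow> real"
    using that(4)[of x] mult_left_mono[OF bounded[OF that(1,2)] that(3)] by (simp add: mult.commute)
  have bdd_above: "bdd_above (P \<phi> ` K)" if K: "K \<in> F" for \<phi> K
  proof -
    obtain c where c: "0 \<le> c" "\<And>x. \<bar>P \<phi> x\<bar> \<le> c * q x" using P(2)[of \<phi>] by (auto simp: dual_def)
    have "\<bar>P \<phi> x\<bar> \<le> r * c" if "x \<in> K" for x using bound[OF K that c] .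
    then show ?thesis by (intro bdd_aboveI2[of _ _ "r * c"]) (meson abs_le_D1)
  qed
  have upper: "P \<phi> x \<le> p \<phi> K" if "K \<in> F" "x \<in> K" for \<phi> K x
    unfolding p_def by (rule cSUP_upper[OF that(2) bdd_above[OF that(1)]])
  have least: "p \<phi> K \<le> c" if "K \<in> F" "\<And>x. x \<in> K \<Longrightarrow> P \<phi> x \<le> c" for \<phi> K c
    unfolding p_def using members[OF that(1)] that(2) by (intro cSUP_least) auto
  have lower: "- (r * c) \<le> p \<phi> K" if K: "K \<in> F" and c: "0 \<le> c" "\<And>x. \<bar>P \<phi> x\<bar> \<le> c * q x" for \<phi> K c
  proof -
    obtain x where "x \<in> K" using members[OF K] by blast
    from upper[OF K this, of \<phi>] bound[OF K this c] show ?thesis by simp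
  qed
  have bdd: "bdd_below (p \<phi> ` F)" for \<phi>
  proof -
    obtain c where "0 \<le> c" "\<And>x. \<bar>P \<phi> x\<bar> \<le> c * q x" using P(2)[of \<phi>] by (auto simp: dual_def)
    from lower[OF _ this] show ?thesis by (meson bdd_belowI2)
  qed
  \<comment> \<open>The projection \<open>P\<close> onto the dual only serves to make the functional total.\<close>
  have sub: "sublinear (\<lambda>\<phi>. INF K\<in>F. p \<phi> K)"
  proof (rule sublinear_infimum[OF ne bdd])
    fix \<phi> \<psi> K L assume KL: "K \<in> F" "L \<in> F"
    with directed obtain J where J: "J \<in> F" "J \<subseteq> K \<inter> L" by blast
    have "P (\<phi> + \<psi>) x \<le> p \<phi> K + p \<psi> L" if "x \<in> J" for x
      using upper[OF KL(1), of x \<phi>] upper[OF KL(2), of x \<psi>] that J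
      by (simp add: linear_add[OF P(1)] subset_iff)
    from least[OF J(1) this] J(1) show "\<exists>J\<in>F. p (\<phi> + \<psi>) J \<le> p \<phi> K + p \<psi> L" by blast
  next
    fix c \<phi> K assume "0 < (c::real)" "K \<in> F"
    then have "p (c *\<^sub>R \<phi>) K \<le> c * p \<phi> K"
      using upper by (intro least) (auto simp: linear_scale[OF P(1)])
    with \<open>K \<in> F\<close> show "\<exists>J\<in>F. p (c *\<^sub>R \<phi>) J \<le> c * p \<phi> K" by blast
  next
    have "p 0 K = 0" if "K \<in> F" for K
      using members[OF that] by (auto simp: p_def linear_0[OF P(1)])
    then have "p 0 ` F = {0}" using ne by force
    then show "(INF K\<in>F. p 0 K) = 0" by simp
  qed
  obtain \<Phi> where \<Phi>: "linear \<Phi>" "\<And>\<phi>. \<Phi> \<phi> \<le> (INF K\<in>F. p \<phi> K)"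
    using Hahn_Banach_sublinear[OF sub] by blast
  have le: "\<Phi> \<phi> \<le> p \<phi> K" if "K \<in> F" for \<phi> K
    using \<Phi>(2)[of \<phi>] cINF_lower[OF bdd that, of \<phi>] by simp
  have "\<exists>x\<in>S. \<forall>\<phi>\<in>dual. \<Phi> \<phi> = \<phi> x"
  proof (rule reflexive)
    show "\<Phi> (\<phi> + \<psi>) = \<Phi> \<phi> + \<Phi> \<psi>" for \<phi> \<psi> by (rule linear_add[OF \<Phi>(1)])
    show "\<Phi> (c *\<^sub>R \<phi>) = c * \<Phi> \<phi>" for c \<phi> using linear_scale[OF \<Phi>(1)] by simp
    fix \<phi> c assume \<phi>: "\<phi> \<in> dual" "0 \<le> c" "\<And>x. \<bar>\<phi> x\<bar> \<le> c * q x"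
    obtain K where K: "K \<in> F" using ne by blast
    have *: "\<Phi> \<psi> \<le> r * c" if "\<psi> \<in> dual" "\<And>x. \<bar>\<psi> x\<bar> \<le> c * q x" for \<psi>
    proof -
      have "\<bar>P \<psi> x\<bar> \<le> r * c" if "x \<in> K" for x
        using bound[OF K \<open>x \<in> K\<close> \<phi>(2), of \<psi>] \<open>\<And>x. \<bar>\<psi> x\<bar> \<le> c * q x\<close> P(3)[OF \<open>\<psi> \<in> dual\<close>] by simp
      then have "p \<psi> K \<le> r * c" by (intro least[OF K]) (meson abs_le_D1)
      with le[OF K, of \<psi>] show ?thesis by simp
    qed
    have "- \<phi> \<in> dual" using subspace_neg[OF subspace_dual \<phi>(1)] .
    with *[OF \<phi>(1,3)] *[of "- \<phi>"] \<phi>(3) linear_neg[OF \<Phi>(1), of \<phi>] show "\<bar>\<Phi> \<phi>\<bar> \<le> r * c"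
      by (simp add: abs_le_iff)
  qed
  then obtain x where x: "x \<in> S" "\<And>\<phi>. \<phi> \<in> dual \<Longrightarrow> \<Phi> \<phi> = \<phi> x" by blast
  have "x \<in> K" if K: "K \<in> F" for K
  proof (rule ccontr)
    assume "x \<notin> K"
    then have "\<not> (\<forall>e>0. \<exists>k\<in>K. q (x - k) < e)"
      using q_closedD[of K x] members[OF K] x(1) by blast
    then obtain e where e: "0 < e" "\<And>k. k \<in> K \<Longrightarrow> e \<le> q (x - k)"
      by (meson not_less)
    obtain \<phi> where \<phi>: "linear \<phi>" "\<And>v. \<phi> v \<le> q v" "\<And>k. k \<in> K \<Longrightarrow> \<phi> k + e \<le> \<phi> x"
    proof (rule convex_separation[of K e x])
      show "e \<le> q (k - x)" if "k \<in> K" for k using e(2)[OF that] by (simp add: q_commute)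
    qed (use members[OF K] e(1) in auto)
    have "\<bar>\<phi> v\<bar> \<le> 1 * q v" for v
      using \<phi>(2)[of v] \<phi>(2)[of "- v"] linear_neg[OF \<phi>(1), of v] by simp
    then have dual: "\<phi> \<in> dual" unfolding dual_def using \<phi>(1) zero_le_one by blast
    have "P \<phi> k \<le> \<phi> x - e" if "k \<in> K" for k
      using \<phi>(3)[OF that] P(3)[OF dual] by simp
    then have "p \<phi> K \<le> \<phi> x - e" by (rule least[OF K])
    with le[OF K, of \<phi>] x(2)[OF dual] e(1) show False by simp
  qed
  with x(1) show ?thesis by blast
qed

end

section \<open>Minimal invariant sets and almost fixed points\<close>

context reflexive_seminormed
begin

text \<open>Zorn's lemma; chains have nonempty intersections by weak compactness.\<close>

lemma minimal_invariant_set: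
  assumes C: "C \<noteq> {}" "convex C" "q_closed C" "\<And>x. x \<in> C \<Longrightarrow> T x \<in> C" and bounded: "\<And>x. x \<in> C \<Longrightarrow> q x \<le> r"
  obtains D where "D \<noteq> {}" "D \<subseteq> C" "convex D" "q_closed D" "\<And>x. x \<in> D \<Longrightarrow> T x \<in> D"
    "\<And>E. E \<subseteq> D \<Longrightarrow> E \<noteq> {} \<Longrightarrow> convex E \<Longrightarrow> q_closed E \<Longrightarrow> (\<And>x. x \<in> E \<Longrightarrow> T x \<in> E) \<Longrightarrow> E = D"
proof -
  define A where "A = {D. D \<noteq> {} \<and> D \<subseteq> C \<and> convex D \<and> q_closed D \<and> (\<forall>x\<in>D. T x \<in> D)}"
  define P where "P = (\<lambda>D E :: 'a set. E \<subseteq> D)"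
  have "\<exists>m\<in>A. \<forall>a\<in>A. P m a \<longrightarrow> a = m"
  proof (rule predicate_Zorn)
    show "partial_order_on A (relation_of P A)"
      by (rule partial_order_on_relation_ofI) (auto simp: P_def)
  next
    fix F assume F: "F \<in> Chains (relation_of P A)"
    have FA: "\<And>K. K \<in> F \<Longrightarrow> K \<in> A" and chain: "\<And>K L. K \<in> F \<Longrightarrow> L \<in> F \<Longrightarrow> P K L \<or> P L K"
      using F by (auto simp: Chains_def relation_of_def)
    show "\<exists>u\<in>A. \<forall>a\<in>F. P a u"
    proof (cases "F = {}")
      case True
      then show ?thesis using C by (auto simp: A_def)
    next
      case False
      have *: "K \<noteq> {} \<and> convex K \<and> q_closed K" if "K \<in> F" for K
        using FA[OF that] by (simp add: A_def)
      have "S \<inter> \<Inter>F \<noteq> {}"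
      proof (rule directed_Inter_nonempty[OF False *])
        show "q x \<le> r" if "K \<in> F" "x \<in> K" for K x
          using FA[OF that(1)] that(2) bounded by (auto simp: A_def)
        show "\<exists>J\<in>F. J \<subseteq> K \<inter> L" if "K \<in> F" "L \<in> F" for K L
          using chain[OF that] that by (auto simp: P_def)
      qed
      then have "\<Inter>F \<noteq> {}" by blast
      moreover have "\<Inter>F \<subseteq> C" using False FA by (auto simp: A_def)
      moreover have "convex (\<Inter>F)" using * by (intro convex_Inter) blast
      moreover have "q_closed (\<Inter>F)" using * False by (intro q_closed_Inter) blast+
      moreover have "\<forall>x\<in>\<Inter>F. T x \<in> \<Inter>F" using FA by (auto simp: A_def)
      ultimately have "\<Inter>F \<in> A" by (simp add: A_def)
      then show ?thesis by (intro bexI[of _ "\<Inter>F"]) (auto simp: P_def)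
    qed
  qed
  then obtain D where D: "D \<in> A" and min: "\<And>E. E \<in> A \<Longrightarrow> E \<subseteq> D \<Longrightarrow> E = D"
    unfolding P_def by blast
  show thesis
  proof (rule that[of D])
    fix E assume "E \<subseteq> D" "E \<noteq> {}" "convex E" "q_closed E" "\<And>x. x \<in> E \<Longrightarrow> T x \<in> E"
    then show "E = D" using D by (intro min) (auto simp: A_def)
  qed (use D in \<open>auto simp: A_def\<close>)
qed

end

locale minimal_invariant = reflexive_seminormed +
  fixes T :: "'a \<Rightarrow> 'a" and D :: "'a set" and d :: real
  assumes D_nonempty: "D \<noteq> {}" and D_convex: "convex D" and D_closed: "q_closed D"
    and T_D: "x \<in> D \<Longrightarrow> T x \<in> D"
    and nonexpansive: "x \<in> D \<Longrightarrow> y \<in> D \<Longrightarrow> q (T x - T y) \<le> q (x - y)"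
    and minimal: "E \<subseteq> D \<Longrightarrow> E \<noteq> {} \<Longrightarrow> convex E \<Longrightarrow> q_closed E \<Longrightarrow> (\<And>x. x \<in> E \<Longrightarrow> T x \<in> E) \<Longrightarrow> E = D"
    and diameter_le: "x \<in> D \<Longrightarrow> y \<in> D \<Longrightarrow> q (x - y) \<le> d"
    and diameter_least: "r < d \<Longrightarrow> \<exists>x\<in>D. \<exists>y\<in>D. r < q (x - y)"
    and diameter_pos: "0 < d"
begin

lemma D_sub_S: "D \<subseteq> S"
  using D_closed by (simp add: q_closed_def)

lemma D_bounded: obtains r where "\<And>x. x \<in> D \<Longrightarrow> q x \<le> r"
proof -
  obtain a where "a \<in> D" using D_nonempty by blast
  then have "q x \<le> d + q a" if "x \<in> D" for x
    using diameter_le[OF that] q_triangle[of "x - a" a] by fastforce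
  with that show thesis by blast
qed

lemma D_combination: "x \<in> D \<Longrightarrow> y \<in> D \<Longrightarrow> 0 \<le> u \<Longrightarrow> 0 \<le> v \<Longrightarrow> u + v = 1 \<Longrightarrow> u *\<^sub>R x + v *\<^sub>R y \<in> D"
  using D_convex by (rule convexD)

text \<open>The closed convex hull of \<open>T D\<close> is invariant, hence all of \<open>D\<close>.\<close>

lemma dense_image_hull:
  assumes x: "x \<in> D" and e: "0 < e"
  shows "\<exists>k\<in>convex hull (T ` D). q (x - k) < e"
proof -
  let ?H = "convex hull (T ` D)"
  define E where "E = {x \<in> S. \<forall>e>0. \<exists>k\<in>?H. q (x - k) < e}"
  have HD: "?H \<subseteq> D" using T_D by (intro hull_minimal D_convex) auto
  have HE: "?H \<subseteq> E" using HD D_sub_S by (auto simp: E_def intro!: bexI)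
  have "E = D"
  proof (rule minimal)
    show ED: "E \<subseteq> D"
    proof
      fix x assume "x \<in> E"
      then show "x \<in> D" using HD by (intro q_closedD[OF D_closed]) (auto simp: E_def, meson subsetD)
    qed
    show "E \<noteq> {}" using HE D_nonempty by auto
    show "T x \<in> E" if "x \<in> E" for x using that ED HE by (auto intro!: hull_inc)
    show "convex E"
    proof (rule convexI)
      fix x y and u v :: real assume *: "x \<in> E" "y \<in> E" "0 \<le> u" "0 \<le> v" "u + v = 1"
      have "u *\<^sub>R x + v *\<^sub>R y \<in> S"
        using * subspace by (auto simp: E_def intro!: subspace_add subspace_scale)
      moreover have "\<exists>k\<in>?H. q (u *\<^sub>R x + v *\<^sub>R y - k) < e" if "0 < e" for e
      proof -
        have "\<exists>k\<in>?H. q (x - k) < e / 2" "\<exists>l\<in>?H. q (y - l) < e / 2"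
          using *(1,2) half_gt_zero[OF \<open>0 < e\<close>] unfolding E_def by blast+
        then obtain k l where kl: "k \<in> ?H" "l \<in> ?H" "q (x - k) < e / 2" "q (y - l) < e / 2"
          by blast
        have "q (u *\<^sub>R x + v *\<^sub>R y - (u *\<^sub>R k + v *\<^sub>R l)) \<le> u * (e / 2) + v * (e / 2)"
          using kl * by (intro q_combination) auto
        also have "\<dots> = e / 2" using *(5) by (metis distrib_right mult_1)
        also have "\<dots> < e" using \<open>0 < e\<close> by simp
        finally show ?thesis
          using convexD[OF convex_convex_hull kl(1,2) *(3-5)] by blast
      qed
      ultimately show "u *\<^sub>R x + v *\<^sub>R y \<in> E" by (simp add: E_def)
    qed
    show "q_closed E"
      unfolding q_closed_def
    proof (intro conjI ballI impI)
      show "E \<subseteq> S" by (auto simp: E_def)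
      fix x assume x: "x \<in> S" "\<forall>e>0. \<exists>k\<in>E. q (x - k) < e"
      have "\<exists>k\<in>?H. q (x - k) < e" if "0 < e" for e
      proof -
        obtain y where y: "y \<in> E" "q (x - y) < e / 2" using x(2) \<open>0 < e\<close> half_gt_zero by blast
        moreover have "\<exists>k\<in>?H. q (y - k) < e / 2"
          using y(1) half_gt_zero[OF \<open>0 < e\<close>] unfolding E_def by blast
        ultimately obtain k where "k \<in> ?H" "q (y - k) < e / 2" by blast
        then show ?thesis using y q_triangle_sub[of x k y] by (intro bexI[of _ k]) auto
      qed
      with x(1) show "x \<in> E" by (simp add: E_def)
    qed
  qed
  with x e show ?thesis by (auto simp: E_def)
qed

text \<open>The points of \<open>D\<close> within distance \<open>r\<close> of all of \<open>D\<close> form a closed convex set. It is invariant because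
  the convex hull of \<open>T D\<close> is dense in \<open>D\<close>.\<close>

lemma diametral:
  assumes z: "z \<in> D" "\<And>y. y \<in> D \<Longrightarrow> q (z - y) \<le> r"
  shows "d \<le> r"
proof -
  define E where "E = {z \<in> D. \<forall>y\<in>D. q (z - y) \<le> r}"
  have "E = D"
  proof (rule minimal)
    show "E \<subseteq> D" by (auto simp: E_def)
    show "E \<noteq> {}" using z by (auto simp: E_def)
    have E_Inter: "E = (\<Inter>y\<in>D. {z \<in> D. q (z - y) \<le> r})" using D_nonempty by (auto simp: E_def)
    have "{z \<in> D. q (z - y) \<le> r} = D \<inter> {z. q (z - y) \<le> r}" for y by auto
    then show "convex E" unfolding E_Inter
      using D_convex convex_q_ball by (auto intro!: convex_INT convex_Int)
    show "q_closed E" unfolding E_Inter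
      using D_nonempty by (intro q_closed_Inter) (auto intro: q_closed_ball[OF D_closed])
    fix x assume x: "x \<in> E"
    have hull: "convex hull (T ` D) \<subseteq> {k. q (k - T x) \<le> r}"
    proof (rule hull_minimal)
      show "convex {k. q (k - T x) \<le> r}" by (rule convex_q_ball)
      show "T ` D \<subseteq> {k. q (k - T x) \<le> r}"
      proof clarify
        fix y assume "y \<in> D"
        then show "q (T y - T x) \<le> r" using x nonexpansive[of y x] q_commute[of x y] by (auto simp: E_def)
      qed
    qed
    have "q (T x - y) \<le> r" if y: "y \<in> D" for y
    proof (rule field_le_epsilon)
      fix e :: real assume "0 < e"
      then obtain k where k: "k \<in> convex hull (T ` D)" "q (y - k) < e" using dense_image_hull[OF y] by blast
      with hull have "q (k - T x) \<le> r" by blast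
      with k(2) show "q (T x - y) \<le> r + e"
        using q_triangle_sub[of y "T x" k] q_commute[of y "T x"] by simp
    qed
    then show "T x \<in> E" using x T_D by (simp add: E_def)
  qed
  show ?thesis
  proof (rule ccontr)
    assume "\<not> d \<le> r"
    then obtain x y where "x \<in> D" "y \<in> D" "r < q (x - y)" using diameter_least[of r] by auto
    moreover have "x \<in> E" using \<open>E = D\<close> \<open>x \<in> D\<close> by simp
    ultimately show False by (auto simp: E_def)
  qed
qed

definition approx_fixed :: "real \<Rightarrow> 'a set" where
  "approx_fixed \<delta> = {z \<in> D. q (z - T z) < \<delta>}"

lemma approx_fixed_mono: "\<delta> \<le> \<delta>' \<Longrightarrow> approx_fixed \<delta> \<subseteq> approx_fixed \<delta>'"
  by (auto simp: approx_fixed_def)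

lemma approx_fixed_D: "z \<in> approx_fixed \<delta> \<Longrightarrow> z \<in> D"
  by (simp add: approx_fixed_def)

text \<open>The lemma of Goebel and Karlovitz. If almost fixed points \<open>z n\<close> stayed within \<open>r < d\<close> of one
  point of \<open>D\<close>, then by minimality they would do so, up to any \<open>\<epsilon> > 0\<close> and for large \<open>n\<close>, for every
  point of \<open>D\<close>. A common point of the closed convex sets of those \<open>z\<close> which are \<open>r + \<epsilon>\<close>-close to finitely
  many given points would then fail to be diametral.\<close>

lemma approx_fixed_far:
  assumes w: "w \<in> D" and r: "r < d"
  shows "\<exists>\<delta>>0. \<forall>z\<in>approx_fixed \<delta>. r < q (z - w)"
proof (rule ccontr)
  assume "\<not> ?thesis"
  then have "\<exists>z. z \<in> approx_fixed (1 / Suc n) \<and> q (z - w) \<le> r" for n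
    by (metis not_less of_nat_0_less_iff zero_less_Suc zero_less_divide_1_iff)
  then obtain z where z: "\<And>n. z n \<in> approx_fixed (1 / Suc n)" "\<And>n. q (z n - w) \<le> r" by metis
  have zD: "z n \<in> D" for n using z(1) by (rule approx_fixed_D)
  define E where "E = {x \<in> D. \<forall>e>0. \<forall>\<^sub>F n in sequentially. q (z n - x) \<le> r + e}"
  have "E = D"
  proof (rule minimal)
    show "E \<subseteq> D" by (auto simp: E_def)
    have "w \<in> E" using w z(2) by (auto simp: E_def intro!: always_eventually add_increasing2)
    then show "E \<noteq> {}" by blast
    show "convex E"
    proof (rule convexI)
      fix x y and u v :: real assume *: "x \<in> E" "y \<in> E" "0 \<le> u" "0 \<le> v" "u + v = 1"
      have "\<forall>\<^sub>F n in sequentially. q (z n - (u *\<^sub>R x + v *\<^sub>R y)) \<le> r + e" if e: "0 < e" for e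
      proof -
        have "\<forall>\<^sub>F n in sequentially. q (z n - x) \<le> r + e" "\<forall>\<^sub>F n in sequentially. q (z n - y) \<le> r + e"
          using *(1,2) e by (auto simp: E_def)
        then show ?thesis
        proof eventually_elim
          case (elim n)
          have "u *\<^sub>R z n + v *\<^sub>R z n = z n" "u * (r + e) + v * (r + e) = r + e"
            using *(5) by (metis scaleR_add_left scaleR_one, metis distrib_right mult_1)
          then show ?case using q_combination[OF *(3-5) elim] by simp
        qed
      qed
      then show "u *\<^sub>R x + v *\<^sub>R y \<in> E" using * D_combination by (simp add: E_def)
    qed
    show "q_closed E"
      unfolding q_closed_def
    proof (intro conjI ballI impI)
      show "E \<subseteq> S" using D_sub_S by (auto simp: E_def)
      fix x assume x: "x \<in> S" "\<forall>e>0. \<exists>k\<in>E. q (x - k) < e"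
      have "x \<in> D" using x(2) by (intro q_closedD[OF D_closed x(1)]) (auto simp: E_def)
      moreover have "\<forall>\<^sub>F n in sequentially. q (z n - x) \<le> r + e" if e: "0 < e" for e
      proof -
        obtain k where k: "k \<in> E" "q (x - k) < e / 2" using x(2) half_gt_zero[OF e] by blast
        then have "\<forall>\<^sub>F n in sequentially. q (z n - k) \<le> r + e / 2"
          using half_gt_zero[OF e] by (auto simp: E_def)
        then show ?thesis
        proof eventually_elim
          case (elim n)
          then show ?case using k(2) q_triangle_sub[of "z n" x k] q_commute[of x k] by simp
        qed
      qed
      ultimately show "x \<in> E" by (simp add: E_def)
    qed
    fix x assume x: "x \<in> E"
    then have xD: "x \<in> D" by (simp add: E_def)
    have "\<forall>\<^sub>F n in sequentially. q (z n - T x) \<le> r + e" if e: "0 < e" for e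
    proof -
      have "\<forall>\<^sub>F n in sequentially. q (z n - x) \<le> r + e / 2"
        using x half_gt_zero[OF e] by (auto simp: E_def)
      moreover have "\<forall>\<^sub>F n in sequentially. 1 / real (Suc n) < e / 2"
        using half_gt_zero[OF e] LIMSEQ_inverse_real_of_nat order_tendstoD(2) by (fastforce simp: inverse_eq_divide)
      ultimately show ?thesis
      proof eventually_elim
        case (elim n)
        have "q (z n - T (z n)) < 1 / Suc n" using z(1)[of n] by (simp add: approx_fixed_def)
        then show ?case
          using elim nonexpansive[OF zD[of n] xD] q_triangle_sub[of "z n" "T x" "T (z n)"] by simp
      qed
    qed
    then show "T x \<in> E" using T_D[OF xD] by (simp add: E_def)
  qed
  define e where "e = (d - r) / 2"
  have e: "0 < e" using r by (simp add: e_def)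
  define K where "K = (\<lambda>Y. {x \<in> D. \<forall>y\<in>Y. q (x - y) \<le> r + e})"
  obtain R where R: "\<And>x. x \<in> D \<Longrightarrow> q x \<le> R" using D_bounded by blast
  let ?F = "K ` {Y. finite Y \<and> Y \<noteq> {} \<and> Y \<subseteq> D}"
  have "S \<inter> \<Inter>?F \<noteq> {}"
  proof (rule directed_Inter_nonempty[of ?F R])
    obtain a where "a \<in> D" using D_nonempty by blast
    then have "K {a} \<in> ?F" by (intro imageI) simp
    then show "?F \<noteq> {}" by blast
  next
    fix L assume "L \<in> ?F"
    then obtain Y where Y: "L = K Y" "finite Y" "Y \<noteq> {}" "Y \<subseteq> D" by auto
    have "\<forall>\<^sub>F n in sequentially. \<forall>y\<in>Y. q (z n - y) \<le> r + e"
      using Y \<open>E = D\<close> e by (subst eventually_ball_finite_distrib) (auto simp: E_def)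
    then obtain n where "\<forall>y\<in>Y. q (z n - y) \<le> r + e" unfolding eventually_sequentially by blast
    then have "L \<noteq> {}" using zD Y(1) by (auto simp: K_def)
    moreover have L: "L = (\<Inter>y\<in>Y. {x \<in> D. q (x - y) \<le> r + e})" using Y by (auto simp: K_def)
    have "{x \<in> D. q (x - y) \<le> r + e} = D \<inter> {x. q (x - y) \<le> r + e}" for y by auto
    then have "convex L" unfolding L
      using D_convex convex_q_ball by (auto intro!: convex_INT convex_Int)
    moreover have "q_closed L" unfolding L
      using Y(3) by (intro q_closed_Inter) (auto intro: q_closed_ball[OF D_closed])
    ultimately show "L \<noteq> {} \<and> convex L \<and> q_closed L" by blast
  next
    show "q x \<le> R" if "L \<in> ?F" "x \<in> L" for L x using that R by (auto simp: K_def)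
  next
    fix L M assume "L \<in> ?F" "M \<in> ?F"
    then obtain Y Z where YZ: "L = K Y" "M = K Z" "finite Y" "finite Z" "Y \<noteq> {}" "Y \<subseteq> D" "Z \<subseteq> D" by auto
    then have "K (Y \<union> Z) \<in> ?F" "K (Y \<union> Z) \<subseteq> L \<inter> M" by (auto simp: K_def)
    then show "\<exists>J\<in>?F. J \<subseteq> L \<inter> M" by blast
  qed
  then obtain x where x: "x \<in> \<Inter>?F" by blast
  have xK: "x \<in> K {y}" if "y \<in> D" for y
  proof -
    have "K {y} \<in> ?F" using that by (intro imageI) simp
    with x show ?thesis by (rule InterD)
  qed
  have "d \<le> r + e"
  proof (rule diametral)
    show "x \<in> D" using D_nonempty xK by (auto simp: K_def)
    show "q (x - y) \<le> r + e" if "y \<in> D" for y using xK[OF that] by (simp add: K_def)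
  qed
  then show False using r by (simp add: e_def field_simps)
qed

text \<open>The point is an almost fixed point of the contraction \<open>z \<mapsto> (1 - \<lambda>) T z + \<lambda> m\<close>, where \<open>m\<close>
  divides the segment from \<open>x\<close> to \<open>y\<close> in the ratio \<open>s : 1 - s\<close>.\<close>

lemma intermediate_point:
  assumes xy: "x \<in> D" "y \<in> D" "q (x - T x) \<le> \<delta>" "q (y - T y) \<le> \<delta>"
    and l: "0 < l" "l \<le> 1" and t: "0 < t" and s: "0 \<le> s" "s \<le> 1"
  obtains z where "z \<in> D" "q (z - T z) \<le> l * d + t"
    "q (z - x) \<le> s * q (x - y) + (\<delta> + t) / l" "q (z - y) \<le> (1 - s) * q (x - y) + (\<delta> + t) / l"
proof -
  define m where "m = (1 - s) *\<^sub>R x + s *\<^sub>R y"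
  define U where "U = (\<lambda>z. (1 - l) *\<^sub>R T z + l *\<^sub>R m)"
  define u where "u = (\<lambda>n. (U ^^ n) m)"
  have mD: "m \<in> D" unfolding m_def using xy s by (intro D_combination) auto
  have UD: "U z \<in> D" if "z \<in> D" for z
    unfolding U_def using that l mD by (intro D_combination T_D) auto
  have uD: "u n \<in> D" for n unfolding u_def by (induction n) (auto simp: mD UD)
  have step: "q (u n - U (u n)) \<le> (1 - l) ^ n * d" for n
  proof (induction n)
    case 0
    then show ?case using diameter_le[OF mD UD[OF mD]] by (simp add: u_def)
  next
    case (Suc n)
    have "u (Suc n) = U (u n)" by (simp add: u_def)
    moreover have "U (u n) - U (U (u n)) = (1 - l) *\<^sub>R (T (u n) - T (U (u n)))"
      by (simp add: U_def algebra_simps)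
    ultimately have "q (u (Suc n) - U (u (Suc n))) = (1 - l) * q (T (u n) - T (U (u n)))"
      using l by (simp add: q_scale)
    also have "\<dots> \<le> (1 - l) * q (u n - U (u n))"
      using l nonexpansive[OF uD UD[OF uD]] by (intro mult_left_mono) auto
    also have "\<dots> \<le> (1 - l) * ((1 - l) ^ n * d)"
      using l Suc by (intro mult_left_mono) auto
    finally show ?case by simp
  qed
  have "(\<lambda>n. (1 - l) ^ n * d) \<longlonglongrightarrow> 0 * d"
    using l by (intro tendsto_mult LIMSEQ_realpow_zero) auto
  then have "\<forall>\<^sub>F n in sequentially. (1 - l) ^ n * d < t"
    using t by (intro order_tendstoD(2)) auto
  then obtain n where n: "(1 - l) ^ n * d < t" unfolding eventually_sequentially by blast
  define z where "z = u n"
  have z: "z \<in> D" "q (z - U z) \<le> t" using uD step[of n] n by (auto simp: z_def)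
  \<comment> \<open>The contraction pulls \<open>z\<close> towards \<open>m\<close>, while \<open>T\<close> moves it away from an almost fixed point by at most \<open>\<delta>\<close>.\<close>
  have near: "q (z - w) \<le> q (m - w) + (\<delta> + t) / l" if w: "w \<in> D" "q (w - T w) \<le> \<delta>" for w
  proof -
    have "U z - w = (1 - l) *\<^sub>R (T z - w) + l *\<^sub>R (m - w)" by (simp add: U_def algebra_simps)
    then have "q (U z - w) \<le> (1 - l) * q (T z - w) + l * q (m - w)"
      using q_triangle[of "(1 - l) *\<^sub>R (T z - w)" "l *\<^sub>R (m - w)"] l by (simp add: q_scale)
    moreover have "q (T z - w) \<le> q (z - w) + \<delta>"
      using q_triangle_sub[of "T z" w "T w"] nonexpansive[OF z(1) w(1)] w(2) q_commute[of w "T w"] by simp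
    then have "(1 - l) * q (T z - w) \<le> (1 - l) * (q (z - w) + \<delta>)"
      using l by (intro mult_left_mono) auto
    moreover have "q (z - w) \<le> t + q (U z - w)" using z(2) q_triangle_sub[of z w "U z"] by simp
    moreover have "0 \<le> l * \<delta>" using w(2) l q_nonneg[of "w - T w"] by (intro mult_nonneg_nonneg) linarith+
    ultimately have "l * q (z - w) \<le> l * q (m - w) + (\<delta> + t)"
      by (simp add: algebra_simps)
    then show ?thesis using l by (simp add: field_simps)
  qed
  have "m - x = s *\<^sub>R (y - x)" "m - y = (1 - s) *\<^sub>R (x - y)" by (simp_all add: m_def algebra_simps)
  then have m: "q (m - x) = s * q (x - y)" "q (m - y) = (1 - s) * q (x - y)"
    using s q_commute[of y x] by (simp_all add: q_scale)
  have "U z - T z = l *\<^sub>R (m - T z)" by (simp add: U_def algebra_simps)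
  then have "q (U z - T z) \<le> l * d"
    using l diameter_le[OF mD T_D[OF z(1)]] by (simp add: q_scale mult_left_mono)
  then have "q (z - T z) \<le> l * d + t" using z(2) q_triangle_sub[of z "T z" "U z"] by simp
  with z(1) near[OF xy(1,3)] near[OF xy(2,4)] m that show thesis by simp
qed

text \<open>With \<open>\<lambda>\<close> small against \<open>\<delta> / d\<close> and the other errors small against \<open>\<lambda> \<delta>\<close>, the previous point is as good
  an almost fixed point as desired, although its end points had to be better ones.\<close>

lemma approx_fixed_between:
  assumes \<delta>: "0 < \<delta>"
  obtains \<delta>' where "0 < \<delta>'"
    "\<And>x y s. x \<in> approx_fixed \<delta>' \<Longrightarrow> y \<in> approx_fixed \<delta>' \<Longrightarrow> 0 \<le> s \<Longrightarrow> s \<le> 1 \<Longrightarrow>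
      \<exists>z\<in>approx_fixed \<delta>. q (z - x) \<le> s * q (x - y) + \<delta> \<and> q (z - y) \<le> (1 - s) * q (x - y) + \<delta>"
proof -
  define l where "l = min 1 (\<delta> / (4 * d))"
  have l: "0 < l" "l \<le> 1" using \<delta> diameter_pos by (auto simp: l_def)
  have "l \<le> \<delta> / (4 * d)" by (simp add: l_def)
  then have ld: "l * d \<le> \<delta> / 4" using diameter_pos by (simp add: field_simps)
  define t where "t = l * \<delta> / 4"
  have t: "0 < t" using l \<delta> by (simp add: t_def)
  have "t \<le> \<delta> / 4" using l \<delta> by (simp add: t_def mult_left_le_one_le)
  have tl: "(t + t) / l = \<delta> / 2" using l by (simp add: t_def)
  show thesis
  proof (rule that[OF t])
    fix x y s assume xy: "x \<in> approx_fixed t" "y \<in> approx_fixed t" and s: "0 \<le> s" "s \<le> (1::real)"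
    have "x \<in> D" "y \<in> D" "q (x - T x) \<le> t" "q (y - T y) \<le> t" using xy by (auto simp: approx_fixed_def)
    from intermediate_point[OF this l t s]
    obtain z where "z \<in> D" "q (z - T z) \<le> l * d + t"
      "q (z - x) \<le> s * q (x - y) + (t + t) / l" "q (z - y) \<le> (1 - s) * q (x - y) + (t + t) / l" .
    then show "\<exists>z\<in>approx_fixed \<delta>. q (z - x) \<le> s * q (x - y) + \<delta> \<and> q (z - y) \<le> (1 - s) * q (x - y) + \<delta>"
      using ld \<open>t \<le> \<delta> / 4\<close> \<delta> tl by (intro bexI[of _ z]) (auto simp: approx_fixed_def)
  qed
qed

lemma approx_fixed_nonempty:
  assumes "0 < \<delta>" shows "approx_fixed \<delta> \<noteq> {}"
proof -
  obtain x where x: "x \<in> D" using D_nonempty by blast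
  define l where "l = min 1 (\<delta> / (4 * d))"
  have l: "0 < l" "l \<le> 1" using assms diameter_pos by (auto simp: l_def)
  have "l \<le> \<delta> / (4 * d)" by (simp add: l_def)
  then have ld: "l * d \<le> \<delta> / 4" using diameter_pos by (simp add: field_simps)
  obtain z where "z \<in> D" "q (z - T z) \<le> l * d + \<delta> / 2"
    using intermediate_point[of x x "q (x - T x)" l "\<delta> / 2" 0] x l assms by auto
  then have "z \<in> approx_fixed \<delta>" using ld assms by (simp add: approx_fixed_def)
  then show ?thesis by blast
qed

text \<open>\<open>joined n \<delta> x y\<close>: there is a chain of \<open>n\<close> steps from \<open>x\<close> to \<open>y\<close> through \<open>\<delta>\<close>-almost fixed points whose
  steps exceed the fair share \<open>q (x - y) / n\<close> by at most \<open>\<delta>\<close>.\<close>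

definition joined :: "nat \<Rightarrow> real \<Rightarrow> 'a \<Rightarrow> 'a \<Rightarrow> bool" where
  "joined n \<delta> x y \<longleftrightarrow> (\<exists>z::nat \<Rightarrow> 'a. z 0 = x \<and> z n = y \<and>
    (\<forall>i\<le>n. z i \<in> approx_fixed \<delta>) \<and> (\<forall>i<n. q (z i - z (Suc i)) \<le> q (x - y) / n + \<delta>))"

text \<open>By induction: cut off one step with the ratio \<open>1 : n\<close> and divide the rest into \<open>n\<close> steps.\<close>

lemma approx_fixed_joined:
  assumes n: "1 \<le> n" and \<delta>: "0 < \<delta>"
  shows "\<exists>\<delta>'>0. \<forall>x\<in>approx_fixed \<delta>'. \<forall>y\<in>approx_fixed \<delta>'. joined n \<delta> x y"
  using n \<delta>
proof (induction n arbitrary: \<delta> rule: nat_induct_at_least)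
  case base
  show ?case
  proof (intro exI[of _ \<delta>] conjI ballI)
    fix x y assume "x \<in> approx_fixed \<delta>" "y \<in> approx_fixed \<delta>"
    then show "joined 1 \<delta> x y"
      unfolding joined_def using base by (intro exI[of _ "\<lambda>i. if i = 0 then x else y"]) auto
  qed fact
next
  case (Suc n)
  have "0 < \<delta> / 2" using Suc.prems by simp
  from Suc.IH[OF this] obtain \<delta>1 where \<delta>1: "0 < \<delta>1"
    "\<And>x y. x \<in> approx_fixed \<delta>1 \<Longrightarrow> y \<in> approx_fixed \<delta>1 \<Longrightarrow> joined n (\<delta> / 2) x y" by blast
  define \<epsilon> where "\<epsilon> = min (\<delta> / 2) \<delta>1"
  have \<epsilon>: "0 < \<epsilon>" "\<epsilon> \<le> \<delta> / 2" "\<epsilon> \<le> \<delta>1" using \<delta>1 Suc.prems by (auto simp: \<epsilon>_def)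
  obtain \<delta>2 where \<delta>2: "0 < \<delta>2"
    "\<And>x y s. x \<in> approx_fixed \<delta>2 \<Longrightarrow> y \<in> approx_fixed \<delta>2 \<Longrightarrow> 0 \<le> s \<Longrightarrow> s \<le> 1 \<Longrightarrow>
      \<exists>z\<in>approx_fixed \<epsilon>. q (z - x) \<le> s * q (x - y) + \<epsilon> \<and> q (z - y) \<le> (1 - s) * q (x - y) + \<epsilon>"
    using approx_fixed_between[OF \<epsilon>(1)] by metis
  show ?case
  proof (intro exI[of _ "min \<epsilon> \<delta>2"] conjI ballI)
    show "0 < min \<epsilon> \<delta>2" using \<epsilon> \<delta>2 by simp
    fix x y assume "x \<in> approx_fixed (min \<epsilon> \<delta>2)" "y \<in> approx_fixed (min \<epsilon> \<delta>2)"
    then have xy: "x \<in> approx_fixed \<epsilon>" "y \<in> approx_fixed \<epsilon>" "x \<in> approx_fixed \<delta>2" "y \<in> approx_fixed \<delta>2"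
      by (auto simp: approx_fixed_def)
    define r where "r = q (x - y)"
    obtain w where w: "w \<in> approx_fixed \<epsilon>" "q (w - x) \<le> 1 / Suc n * r + \<epsilon>" "q (w - y) \<le> (1 - 1 / Suc n) * r + \<epsilon>"
      using \<delta>2(2)[OF xy(3,4), of "1 / Suc n"] by (auto simp: r_def)
    have "w \<in> approx_fixed \<delta>1" "y \<in> approx_fixed \<delta>1"
      using w(1) xy(2) approx_fixed_mono[OF \<epsilon>(3)] by auto
    from \<delta>1(2)[OF this] obtain z :: "nat \<Rightarrow> 'a" where z: "z 0 = w" "z n = y"
      "\<And>i. i \<le> n \<Longrightarrow> z i \<in> approx_fixed (\<delta> / 2)" "\<And>i. i < n \<Longrightarrow> q (z i - z (Suc i)) \<le> q (w - y) / n + \<delta> / 2"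
      unfolding joined_def by blast
    have "q (w - y) / n \<le> ((1 - 1 / Suc n) * r + \<epsilon>) / n" using w(3) by (intro divide_right_mono) auto
    also have "1 - 1 / real (Suc n) = real n / real (Suc n)" by (simp add: field_simps)
    also have "(real n / real (Suc n) * r + \<epsilon>) / n = r / Suc n + \<epsilon> / n"
      using Suc.hyps by (simp add: add_divide_distrib)
    also have "\<dots> \<le> r / Suc n + \<epsilon>"
      using Suc.hyps \<epsilon>(1) divide_left_mono[of 1 "real n" \<epsilon>] by simp
    finally have wy: "q (w - y) / n \<le> r / Suc n + \<delta> / 2" using \<epsilon> by simp
    have sub: "approx_fixed (\<delta> / 2) \<subseteq> approx_fixed \<delta>" "approx_fixed \<epsilon> \<subseteq> approx_fixed \<delta>"
      using \<epsilon> Suc.prems by (auto intro!: approx_fixed_mono)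
    define z' where "z' = (\<lambda>i. case i of 0 \<Rightarrow> x | Suc j \<Rightarrow> z j)"
    have "z' i \<in> approx_fixed \<delta>" if "i \<le> Suc n" for i
      using that z(3) sub xy(1) by (cases i) (auto simp: z'_def)
    moreover have "q (z' i - z' (Suc i)) \<le> r / Suc n + \<delta>" if "i < Suc n" for i
    proof (cases i)
      case 0
      then show ?thesis using w(2) z(1) q_commute[of w x] \<epsilon> Suc.prems by (simp add: z'_def)
    next
      case (Suc j)
      then show ?thesis using z(4)[of j] that wy by (simp add: z'_def)
    qed
    ultimately show "joined (Suc n) \<delta> x y"
      unfolding joined_def using z(2) by (intro exI[of _ z']) (auto simp: z'_def r_def)
  qed
qed

end

section \<open>Almost fixed points in spaces of integrable functions\<close>

text \<open>If the middle value \<open>v i\<close> of each triple \<open>u i < v i < w i\<close> lies outside, or close to the ends of, the hull of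
  the earlier triples, then \<open>u i\<close> or \<open>w i\<close> leaves this hull by at least \<open>b\<close>.\<close>

lemma hull_growth:
  fixes u v w :: "'i::linorder \<Rightarrow> real" and b :: real
  assumes "finite I" "I \<noteq> {}" and b: "0 < b"
    and gap: "\<And>i. i \<in> I \<Longrightarrow> u i + 2 * b < v i \<and> v i + 2 * b < w i"
    and outside: "\<And>i j l. i \<in> I \<Longrightarrow> j \<in> I \<Longrightarrow> l \<in> I \<Longrightarrow> j < i \<Longrightarrow> l < i \<Longrightarrow> \<not> (u j + b < v i \<and> v i + b < w l)"
  shows "card I * b \<le> Max (w ` I) - Min (u ` I)"
  using assms(1,2) gap outside
proof (induction I rule: finite_linorder_max_induct)
  case empty
  then show ?case by simp
next
  case (insert i A)
  show ?case
  proof (cases "A = {}")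
    case True
    then show ?thesis using insert.prems(2)[of i] b by simp
  next
    case False
    have IH: "card A * b \<le> Max (w ` A) - Min (u ` A)"
      using False insert.prems by (intro insert.IH) auto
    have "Min (u ` A) \<in> u ` A" "Max (w ` A) \<in> w ` A" using False insert.hyps(1) by auto
    then obtain j l where jl: "j \<in> A" "l \<in> A" "Min (u ` A) = u j" "Max (w ` A) = w l" by auto
    have "\<not> (u j + b < v i \<and> v i + b < w l)"
      using insert.hyps(2) jl(1,2) by (intro insert.prems(3)) auto
    moreover have "u i + 2 * b < v i" "v i + 2 * b < w i" using insert.prems(2)[of i] by auto
    moreover have "card A * b \<le> w l - u j" using IH jl by simp
    moreover have "i \<notin> A" using insert.hyps(2) by auto
    then have "card (insert i A) * b = card A * b + b"
      using insert.hyps(1) by (simp add: algebra_simps)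
    moreover have "Max (w ` insert i A) = max (w i) (w l)" "Min (u ` insert i A) = min (u i) (u j)"
      using False insert.hyps(1) jl by auto
    ultimately show ?thesis by linarith
  qed
qed

text \<open>The excess of the variation of a finite sequence over the distance of its end points bounds the same
  excess for any four-point subsequence.\<close>

lemma variation_split:
  fixes z :: "nat \<Rightarrow> real"
  assumes "i < j" "j < n"
  shows "\<bar>z i - z (Suc i)\<bar> + \<bar>z (Suc i) - z j\<bar> + \<bar>z j - z (Suc j)\<bar> - \<bar>z i - z (Suc j)\<bar>
    \<le> (\<Sum>k<n. \<bar>z k - z (Suc k)\<bar>) - \<bar>z 0 - z n\<bar>"
proof -
  let ?V = "\<lambda>k. \<bar>z k - z (Suc k)\<bar>"
  have var: "\<bar>z a - z b\<bar> \<le> sum ?V {a..<b}" if "a \<le> b" for a b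
    using that by (induction b rule: dec_induct) auto
  have "(\<Sum>k<n. ?V k) = sum ?V {0..<i} + sum ?V {i..<n}"
    using assms by (simp add: sum.atLeastLessThan_concat lessThan_atLeast0)
  moreover have "sum ?V {i..<n} = ?V i + sum ?V {Suc i..<n}"
    using assms by (simp add: sum.atLeast_Suc_lessThan)
  moreover have "sum ?V {Suc i..<n} = sum ?V {Suc i..<j} + sum ?V {j..<n}"
    using assms by (simp add: sum.atLeastLessThan_concat)
  moreover have "sum ?V {j..<n} = ?V j + sum ?V {Suc j..<n}"
    using assms by (simp add: sum.atLeast_Suc_lessThan)
  moreover have "\<bar>z 0 - z i\<bar> \<le> sum ?V {0..<i}" "\<bar>z (Suc j) - z n\<bar> \<le> sum ?V {Suc j..<n}"
    "\<bar>z (Suc i) - z j\<bar> \<le> sum ?V {Suc i..<j}"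
    using assms by (intro var; simp)+
  ultimately show ?thesis by linarith
qed

text \<open>With little excess the two large steps have the same direction, so three separated values occur.\<close>

lemma two_large_steps:
  fixes a b e f c :: real
  assumes "c < \<bar>a - b\<bar>" "c < \<bar>e - f\<bar>" "0 < c" "\<bar>a - b\<bar> + \<bar>b - e\<bar> + \<bar>e - f\<bar> - \<bar>a - f\<bar> \<le> c / 2"
  shows "(a + c / 2 < b \<and> b + c / 2 < f) \<or> (f + c / 2 < b \<and> b + c / 2 < a)"
  using assms by linarith

text \<open>A positive integrable weight \<open>h\<close> replaces a possibly infinite measure by the finite measure \<open>\<nu>\<close> with
  density \<open>h\<close>. Values are compared on the scale \<open>h\<close>, which amounts to dividing all functions by \<open>h\<close>.\<close>

locale weighted_L1 =
  fixes M :: "'a measure" and h :: "'a \<Rightarrow> real"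
  assumes h_integrable: "integrable M h" and h_pos: "\<And>t. t \<in> space M \<Longrightarrow> 0 < h t"
begin

lemma h_measurable [measurable]: "h \<in> borel_measurable M"
  using h_integrable by auto

definition \<nu> :: "'a measure" where "\<nu> = density M (\<lambda>t. ennreal (h t))"

lemma sets_\<nu> [simp, measurable_cong]: "sets \<nu> = sets M"
  and space_\<nu> [simp]: "space \<nu> = space M"
  by (simp_all add: \<nu>_def)

abbreviation mass :: "'a set \<Rightarrow> ('a \<Rightarrow> real) \<Rightarrow> real" where
  "mass A g \<equiv> \<integral>t. indicator A t * \<bar>g t\<bar> \<partial>M"

abbreviation dist1 :: "('a \<Rightarrow> real) \<Rightarrow> ('a \<Rightarrow> real) \<Rightarrow> real" where
  "dist1 x y \<equiv> \<integral>t. \<bar>x t - y t\<bar> \<partial>M"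

lemma finite_\<nu>: "finite_measure \<nu>"
proof
  have "emeasure \<nu> (space \<nu>) = (\<integral>\<^sup>+t. ennreal (h t) \<partial>M)"
    by (auto simp: \<nu>_def emeasure_density intro!: nn_integral_cong)
  also have "\<dots> = ennreal (\<integral>t. h t \<partial>M)"
    using h_integrable h_pos by (intro nn_integral_eq_integral AE_I2) (auto intro: less_imp_le)
  finally show "emeasure \<nu> (space \<nu>) \<noteq> \<infinity>" by simp
qed

sublocale finite_measure \<nu> by (rule finite_\<nu>)

lemma measure_\<nu>:
  assumes [measurable]: "A \<in> sets M"
  shows "measure \<nu> A = (\<integral>t. indicator A t * h t \<partial>M)"
proof -
  have "measure \<nu> A = (\<integral>t. indicator A t \<partial>\<nu>)"
    using assms sets.sets_into_space by (simp add: Int_absorb2)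
  also have "\<dots> = (\<integral>t. h t * indicator A t \<partial>M)"
    unfolding \<nu>_def by (subst integral_real_density) (auto intro!: AE_I2 h_pos less_imp_le)
  finally show ?thesis by (simp add: mult.commute)
qed

lemma markov_\<nu>:
  assumes g: "integrable M g" and A [measurable]: "A \<in> sets M"
    and nonneg: "\<And>t. t \<in> space M \<Longrightarrow> 0 \<le> g t" and large: "\<And>t. t \<in> A \<Longrightarrow> c * h t \<le> g t"
  shows "c * measure \<nu> A \<le> (\<integral>t. g t \<partial>M)"
proof -
  have "integrable M (\<lambda>t. indicator A t * h t)"
    using integrable_mult_indicator[OF A h_integrable] by simp
  then have "(\<integral>t. c * (indicator A t * h t) \<partial>M) \<le> (\<integral>t. g t \<partial>M)"
    using g nonneg large by (intro integral_mono) (auto split: split_indicator)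
  then show ?thesis by (simp add: measure_\<nu>[OF A])
qed

end

text \<open>What is needed of the almost fixed points \<open>Q \<delta>\<close> in a set \<open>D\<close> of diameter \<open>d\<close>; the map itself has
  disappeared.\<close>

locale L1_approx_fixed = weighted_L1 M h for M :: "'a measure" and h +
  fixes D :: "('a \<Rightarrow> real) set" and Q :: "real \<Rightarrow> ('a \<Rightarrow> real) set" and d :: real
  assumes D_integrable: "x \<in> D \<Longrightarrow> integrable M x"
    and midpoint: "x \<in> D \<Longrightarrow> y \<in> D \<Longrightarrow> (\<lambda>t. (x t + y t) / 2) \<in> D"
    and diameter: "x \<in> D \<Longrightarrow> y \<in> D \<Longrightarrow> dist1 x y \<le> d"
    and d_pos: "0 < d"
    and Q_D: "Q \<delta> \<subseteq> D"
    and Q_mono: "\<delta> \<le> \<delta>' \<Longrightarrow> Q \<delta> \<subseteq> Q \<delta>'"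
    and Q_nonempty: "0 < \<delta> \<Longrightarrow> Q \<delta> \<noteq> {}"
    and far: "w \<in> D \<Longrightarrow> r < d \<Longrightarrow> \<exists>\<delta>>0. \<forall>z\<in>Q \<delta>. r < dist1 z w"
    and chain: "1 \<le> n \<Longrightarrow> 0 < \<delta> \<Longrightarrow> \<exists>\<delta>'>0. \<forall>x\<in>Q \<delta>'. \<forall>y\<in>Q \<delta>'. \<exists>z::nat \<Rightarrow> 'a \<Rightarrow> real.
      z 0 = x \<and> z n = y \<and> (\<forall>i\<le>n. z i \<in> Q \<delta>) \<and>
      (\<forall>i<n. dist1 (z i) (z (Suc i)) \<le> dist1 x y / n + \<delta>)"
begin

lemma D_measurable: "x \<in> D \<Longrightarrow> x \<in> borel_measurable M"
  using D_integrable by auto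

definition between :: "real \<Rightarrow> ('a \<Rightarrow> real) \<Rightarrow> ('a \<Rightarrow> real) \<Rightarrow> ('a \<Rightarrow> real) \<Rightarrow> 'a set" where
  "between c u v w = {t \<in> space M. u t + c * h t < v t \<and> v t + c * h t < w t}"

lemma between_sets:
  assumes "u \<in> D" "v \<in> D" "w \<in> D" shows "between c u v w \<in> sets M"
proof -
  note [measurable] = assms[THEN D_measurable]
  show ?thesis unfolding between_def by measurable
qed

text \<open>In \<open>L\<^sup>1\<close> the convexity defect \<open>(|z - w| + |z - w'|) / 2 - |z - (w + w') / 2|\<close> is the smaller one of
  \<open>|z - w|\<close> and \<open>|z - w'|\<close> wherever \<open>z\<close> lies between \<open>w\<close> and \<open>w'\<close>. Its integral is small, because \<open>z\<close> is far
  from the midpoint.\<close>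

lemma approx_fixed_not_between:
  assumes w: "w \<in> D" "w' \<in> D" and c: "0 < c" and \<kappa>: "0 < \<kappa>"
  obtains \<delta> where "0 < \<delta>" "\<And>z. z \<in> Q \<delta> \<Longrightarrow> measure \<nu> (between c w z w') \<le> \<kappa>"
proof -
  let ?m = "\<lambda>t. (w t + w' t) / 2"
  have "d - c * \<kappa> < d" using c \<kappa> by simp
  from far[OF midpoint[OF w] this] obtain \<delta> where \<delta>: "0 < \<delta>"
    "\<And>z. z \<in> Q \<delta> \<Longrightarrow> d - c * \<kappa> < (\<integral>t. \<bar>z t - ?m t\<bar> \<partial>M)" by blast
  have "measure \<nu> (between c w z w') \<le> \<kappa>" if z: "z \<in> Q \<delta>" for z
  proof -
    have zD: "z \<in> D" using z Q_D by blast
    note [simp] = D_integrable[OF zD] D_integrable[OF w(1)] D_integrable[OF w(2)]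
    let ?g = "\<lambda>t. (\<bar>z t - w t\<bar> + \<bar>z t - w' t\<bar>) / 2 - \<bar>z t - ?m t\<bar>"
    have "c * measure \<nu> (between c w z w') \<le> (\<integral>t. ?g t \<partial>M)"
    proof (rule markov_\<nu>)
      show "integrable M ?g" by simp
      show "between c w z w' \<in> sets M" using w zD by (intro between_sets)
      show "0 \<le> ?g t" for t by (simp add: field_simps abs_if)
      show "c * h t \<le> ?g t" if "t \<in> between c w z w'" for t
      proof -
        have "t \<in> space M" "w t + c * h t < z t" "z t + c * h t < w' t" using that by (auto simp: between_def)
        moreover from this have "0 < c * h t" using c h_pos by simp
        ultimately show ?thesis by (simp add: field_simps abs_if)
      qed
    qed
    also have "\<dots> = (dist1 z w + dist1 z w') / 2 - (\<integral>t. \<bar>z t - ?m t\<bar> \<partial>M)"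
      by simp
    also have "\<dots> \<le> c * \<kappa>"
      using diameter[OF zD w(1)] diameter[OF zD w(2)] \<delta>(2)[OF z] by argo
    finally show ?thesis using c by simp
  qed
  with \<delta>(1) that show thesis by blast
qed

lemma approx_fixed_not_between_finite:
  assumes "finite P" and "P \<subseteq> D \<times> D" and c: "0 < c" and \<kappa>: "0 < \<kappa>"
  shows "\<exists>\<delta>>0. \<forall>z\<in>Q \<delta>. \<forall>(w, w')\<in>P. measure \<nu> (between c w z w') \<le> \<kappa>"
  using assms(1,2)
proof induction
  case empty
  then show ?case by (auto intro: exI[of _ 1])
next
  case (insert p P)
  then obtain \<delta>1 where \<delta>1: "0 < \<delta>1" "\<forall>z\<in>Q \<delta>1. \<forall>(w, w')\<in>P. measure \<nu> (between c w z w') \<le> \<kappa>" by auto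
  obtain w w' where p: "p = (w, w')" by (cases p)
  obtain \<delta>2 where \<delta>2: "0 < \<delta>2" "\<And>z. z \<in> Q \<delta>2 \<Longrightarrow> measure \<nu> (between c w z w') \<le> \<kappa>"
    using approx_fixed_not_between[of w w' c \<kappa>] insert.prems c \<kappa> p by auto
  have "Q (min \<delta>1 \<delta>2) \<subseteq> Q \<delta>1 \<inter> Q \<delta>2" using Q_mono by (metis Int_greatest min.cobounded1 min.cobounded2)
  with \<delta>1 \<delta>2 p show ?case by (intro exI[of _ "min \<delta>1 \<delta>2"]) auto
qed

text \<open>Otherwise there is a sequence of triples, each separated on a set of measure at least \<open>\<kappa>\<close> and each avoiding
  the intervals spanned by all earlier triples. After removal of small sets, the values are bounded by \<open>R h\<close>
  and \<open>hull_growth\<close> lets a point belong to at most \<open>4 R / c\<close> of the sets \<open>G i\<close>, which have measure at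
  least \<open>\<kappa> / 2\<close> each. Integrating the number of these sets bounds the length of the sequence.\<close>

lemma approx_fixed_two_valued:
  assumes c: "0 < c" and \<kappa>: "0 < \<kappa>"
  shows "\<exists>\<delta>>0. \<forall>u\<in>Q \<delta>. \<forall>v\<in>Q \<delta>. \<forall>w\<in>Q \<delta>. measure \<nu> (between c u v w) < \<kappa>"
proof (rule ccontr)
  assume *: "\<not> ?thesis"
  have triple: "\<exists>u v w. u \<in> Q \<delta> \<and> v \<in> Q \<delta> \<and> w \<in> Q \<delta> \<and> \<kappa> \<le> measure \<nu> (between c u v w)" if "0 < \<delta>" for \<delta>
  proof (rule ccontr)
    assume "\<not> ?thesis"
    then have "\<forall>u\<in>Q \<delta>. \<forall>v\<in>Q \<delta>. \<forall>w\<in>Q \<delta>. measure \<nu> (between c u v w) < \<kappa>"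
      by (auto simp: not_le)
    with * that show False by blast
  qed
  define good where "good = (\<lambda>u v w :: nat \<Rightarrow> 'a \<Rightarrow> real. \<lambda>i. u i \<in> D \<and> v i \<in> D \<and> w i \<in> D \<and>
    \<kappa> \<le> measure \<nu> (between c (u i) (v i) (w i)) \<and>
    (\<forall>j<i. \<forall>l<i. measure \<nu> (between (c / 2) (u j) (v i) (w l)) \<le> \<kappa> / (4 * (real i * real i + 1))))"
  have sequences: "\<exists>u v w. \<forall>i<N. good u v w i" for N
  proof (induction N)
    case (Suc N)
    then obtain u v w where good: "\<And>i. i < N \<Longrightarrow> good u v w i" by blast
    let ?P = "(u ` {..<N}) \<times> (w ` {..<N})"
    have "finite ?P" "?P \<subseteq> D \<times> D" using good by (auto simp: good_def)
    moreover have "0 < c / 2" "0 < \<kappa> / (4 * (real N * real N + 1))"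
      using c \<kappa> by (auto intro!: divide_pos_pos add_nonneg_pos)
    ultimately obtain \<delta> where \<delta>: "0 < \<delta>"
      "\<forall>z\<in>Q \<delta>. \<forall>(a, b)\<in>?P. measure \<nu> (between (c / 2) a z b) \<le> \<kappa> / (4 * (real N * real N + 1))"
      using approx_fixed_not_between_finite by meson
    obtain a b e where abe: "a \<in> Q \<delta>" "b \<in> Q \<delta>" "e \<in> Q \<delta>" "\<kappa> \<le> measure \<nu> (between c a b e)"
      using triple[OF \<delta>(1)] by blast
    have "good (u(N := a)) (v(N := b)) (w(N := e)) i" if "i < Suc N" for i
    proof (cases "i = N")
      case True
      then show ?thesis
        using abe \<delta>(2) Q_D[THEN subsetD, OF abe(1)] Q_D[THEN subsetD, OF abe(2)] Q_D[THEN subsetD, OF abe(3)]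
        by (auto simp: good_def)
    next
      case False
      then have "i < N" using that by simp
      with good[OF this] show ?thesis by (simp add: good_def)
    qed
    then show ?case by blast
  qed simp
  obtain x0 where x0: "x0 \<in> D" using Q_nonempty[of 1] Q_D by auto
  define B where "B = d + (\<integral>t. \<bar>x0 t\<bar> \<partial>M)"
  have B: "0 < B" using d_pos by (auto simp: B_def intro: add_pos_nonneg)
  have norm_B: "(\<integral>t. \<bar>x t\<bar> \<partial>M) \<le> B" if x: "x \<in> D" for x
  proof -
    note [simp] = D_integrable[OF x] D_integrable[OF x0]
    have "(\<integral>t. \<bar>x t\<bar> \<partial>M) \<le> (\<integral>t. \<bar>x t - x0 t\<bar> + \<bar>x0 t\<bar> \<partial>M)"
      by (intro integral_mono) auto
    with diameter[OF x x0] show ?thesis by (simp add: B_def)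
  qed
  \<comment> \<open>Markov's inequality with this bound loses at most \<open>\<kappa> / 8\<close> for each of \<open>u i\<close> and \<open>w i\<close>.\<close>
  define R where "R = 8 * B / \<kappa>"
  have R: "0 < R" using B \<kappa> by (simp add: R_def)
  define large where "large = (\<lambda>x :: 'a \<Rightarrow> real. {t \<in> space M. R * h t < \<bar>x t\<bar>})"
  have large_sets: "large x \<in> sets M" if "x \<in> D" for x
  proof -
    note [measurable] = D_measurable[OF that]
    show ?thesis unfolding large_def by measurable
  qed
  have large: "measure \<nu> (large x) \<le> \<kappa> / 8" if x: "x \<in> D" for x
  proof -
    have "R * measure \<nu> (large x) \<le> (\<integral>t. \<bar>x t\<bar> \<partial>M)"
      using D_integrable[OF x] large_sets[OF x] by (intro markov_\<nu>) (auto simp: large_def)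
    with norm_B[OF x] R have "measure \<nu> (large x) \<le> B / R" by (simp add: field_simps)
    then show ?thesis using B by (simp add: R_def)
  qed
  obtain N :: nat where N: "8 * R / c * measure \<nu> (space M) / \<kappa> < N" using reals_Archimedean2 by blast
  obtain u v w where good: "\<And>i. i < N \<Longrightarrow> good u v w i" using sequences[of N] by blast
  have D: "u i \<in> D" "v i \<in> D" "w i \<in> D" if "i < N" for i using good[OF that] by (auto simp: good_def)
  \<comment> \<open>The exceptional set where \<open>v i\<close> lies between earlier values; it has measure at most \<open>\<kappa> / 4\<close>.\<close>
  define E where "E = (\<lambda>i. \<Union>(j, l)\<in>{..<i} \<times> {..<i}. between (c / 2) (u j) (v i) (w l))"
  define G where "G = (\<lambda>i. between c (u i) (v i) (w i) - (large (u i) \<union> large (w i) \<union> E i))"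
  have betw: "between (c / 2) (u j) (v i) (w l) \<in> sets M" if "i < N" "j < i" "l < i" for i j l
    using that D by (intro between_sets) auto
  have E_sets: "E i \<in> sets M" if "i < N" for i
    unfolding E_def using betw that by (intro sets.finite_UN) auto
  have G_sets: "G i \<in> sets M" if "i < N" for i
    unfolding G_def using that D by (intro sets.Diff sets.Un between_sets large_sets E_sets) auto
  have G: "\<kappa> / 2 \<le> measure \<nu> (G i)" if i: "i < N" for i
  proof -
    have "measure \<nu> (E i) \<le> (\<Sum>p\<in>{..<i} \<times> {..<i}. measure \<nu> (case p of (j, l) \<Rightarrow> between (c / 2) (u j) (v i) (w l)))"
      unfolding E_def using betw i by (intro measure_UNION_le) auto
    also have "\<dots> \<le> (\<Sum>p\<in>{..<i} \<times> {..<i}. \<kappa> / (4 * (real i * real i + 1)))"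
      using good[OF i] by (intro sum_mono) (auto simp: good_def)
    also have "\<dots> = (real i * real i) * (\<kappa> / (4 * (real i * real i + 1)))" by simp
    also have "\<dots> \<le> (real i * real i + 1) * (\<kappa> / (4 * (real i * real i + 1)))"
      using \<kappa> by (intro mult_right_mono) auto
    also have "\<dots> = \<kappa> / 4"
    proof -
      have "real i * real i + 1 \<noteq> 0" by (metis add_nonneg_pos less_irrefl of_nat_0_le_iff of_nat_mult zero_less_one)
      then show ?thesis by (simp add: field_simps)
    qed
    finally have Ei: "measure \<nu> (E i) \<le> \<kappa> / 4" .
    let ?B = "large (u i) \<union> large (w i) \<union> E i"
    have sets: "large (u i) \<in> sets \<nu>" "large (w i) \<in> sets \<nu>" "E i \<in> sets \<nu>" "G i \<in> sets \<nu>"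
      using D[OF i] i large_sets E_sets G_sets by auto
    have "measure \<nu> ?B \<le> measure \<nu> (large (u i)) + measure \<nu> (large (w i)) + measure \<nu> (E i)"
      using measure_Un_le[OF sets.Un[OF sets(1,2)] sets(3)] measure_Un_le[OF sets(1,2)] by simp
    then have "measure \<nu> ?B \<le> \<kappa> / 2" using large[OF D(1)[OF i]] large[OF D(3)[OF i]] Ei by simp
    moreover have "measure \<nu> (between c (u i) (v i) (w i)) \<le> measure \<nu> (G i \<union> ?B)"
      using sets by (intro finite_measure_mono sets.Un) (auto simp: G_def)
    moreover have "measure \<nu> (G i \<union> ?B) \<le> measure \<nu> (G i) + measure \<nu> ?B"
      using sets by (intro measure_Un_le sets.Un) auto
    moreover have "\<kappa> \<le> measure \<nu> (between c (u i) (v i) (w i))" using good[OF i] by (simp add: good_def)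
    ultimately show ?thesis by simp
  qed
  have count: "(\<Sum>i<N. indicator (G i) t) \<le> 4 * R / c" if t: "t \<in> space M" for t
  proof -
    define I where "I = {i \<in> {..<N}. t \<in> G i}"
    have sum: "(\<Sum>i<N. indicator (G i) t) = real (card I)"
      by (simp add: I_def indicator_def of_bool_def sum.If_cases Int_def)
    show ?thesis
    proof (cases "I = {}")
      case True
      then show ?thesis using sum R c by simp
    next
      case False
      have fin: "finite I" by (simp add: I_def)
      have ht: "0 < h t" by (rule h_pos[OF t])
      define b where "b = c * h t / 2"
      have b: "0 < b" using c ht by (simp add: b_def)
      have "real (card I) * b \<le> Max ((\<lambda>i. w i t) ` I) - Min ((\<lambda>i. u i t) ` I)"
      proof (rule hull_growth[OF fin False b, where v = "\<lambda>i. v i t"])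
        show "u i t + 2 * b < v i t \<and> v i t + 2 * b < w i t" if "i \<in> I" for i
          using that by (auto simp: I_def G_def between_def b_def)
        show "\<not> (u j t + b < v i t \<and> v i t + b < w l t)" if "i \<in> I" "j \<in> I" "l \<in> I" "j < i" "l < i" for i j l
        proof -
          have "t \<notin> E i" using that(1) by (simp add: I_def G_def)
          with that(4,5) t show ?thesis by (auto simp: E_def between_def b_def)
        qed
      qed
      moreover have "Max ((\<lambda>i. w i t) ` I) \<le> R * h t"
        using fin False t by (subst Max_le_iff) (auto simp: I_def G_def large_def not_less abs_le_iff)
      moreover have "- (R * h t) \<le> Min ((\<lambda>i. u i t) ` I)"
        using fin False t by (subst Min_ge_iff) (auto simp: I_def G_def large_def not_less abs_le_iff minus_le_iff)
      ultimately have "real (card I) * b \<le> 2 * R * h t" by simp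
      then show ?thesis unfolding sum using ht c by (simp add: b_def field_simps)
    qed
  qed
  have "N * (\<kappa> / 2) \<le> (\<Sum>i<N. measure \<nu> (G i))"
    using sum_mono[of "{..<N}" "\<lambda>_. \<kappa> / 2" "\<lambda>i. measure \<nu> (G i)"] G by simp
  also have "\<dots> = (\<Sum>i<N. \<integral>t. indicator (G i) t \<partial>\<nu>)"
    using G_sets sets.sets_into_space by (intro sum.cong) (auto simp: Int_absorb2)
  also have "\<dots> = (\<integral>t. (\<Sum>i<N. indicator (G i) t) \<partial>\<nu>)"
    using G_sets by (intro Bochner_Integration.integral_sum[symmetric] integrable_real_indicator) (auto simp: less_top[symmetric])
  also have "\<dots> \<le> (\<integral>t. 4 * R / c \<partial>\<nu>)"
    using G_sets count by (intro integral_mono Bochner_Integration.integrable_sum integrable_real_indicator) (auto simp: less_top[symmetric])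
  also have "\<dots> = 4 * R / c * measure \<nu> (space M)" by simp
  finally have "real N * \<kappa> \<le> 8 * R / c * measure \<nu> (space M)" by simp
  then have "real N \<le> 8 * R / c * measure \<nu> (space M) / \<kappa>" by (rule mult_imp_le_div_pos[OF \<kappa>])
  with N show False by simp
qed

text \<open>Along a chain of \<open>n\<close> short steps, let \<open>A i\<close> be the set where the \<open>i\<close>-th step exceeds \<open>c h\<close>. Where two of
  these steps are large, either the variation of the chain exceeds the distance of its ends noticeably or
  three separated values occur; both happen only on the small set \<open>W\<close>. Thus the \<open>n\<close> sets \<open>A i\<close> are
  disjoint outside \<open>W\<close> and one of them is small. The part of its step outside \<open>A i\<close> has norm at most \<open>c H\<close>,
  which is small against the length \<open>d / n\<close> of the step.\<close>

lemma concentrated_difference: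
  assumes \<delta>0: "0 < \<delta>\<^sub>0"
  obtains x y A where "x \<in> D" "y \<in> D" "A \<in> sets M" "measure \<nu> A \<le> \<delta>\<^sub>0"
    "3 / 4 * dist1 x y < (\<integral>t. indicator A t * \<bar>x t - y t\<bar> \<partial>M)"
proof -
  define H where "H = measure \<nu> (space M)"
  have H: "0 \<le> H" by (simp add: H_def)
  obtain n :: nat where n0: "2 * H / \<delta>\<^sub>0 < n" using reals_Archimedean2 by blast
  then have "0 < real n" using H \<delta>0 by (meson divide_nonneg_pos le_less_trans mult_nonneg_nonneg zero_le_numeral)
  then have n: "1 \<le> n" and n_pos: "0 < real n" by auto
  have Hn: "H / n \<le> \<delta>\<^sub>0 / 2" using n0 n_pos \<delta>0 by (simp add: field_simps)
  define c where "c = d / (16 * n * (H + 1))"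
  have c: "0 < c" using d_pos n_pos H by (simp add: c_def)
  have "c * H \<le> c * (H + 1)" using c by simp
  also have "\<dots> = d / (16 * n)" using H by (simp add: c_def)
  finally have cH: "c * H \<le> d / (16 * n)" .
  define \<eta> where "\<eta> = min (d / (8 * n)) (c * \<delta>\<^sub>0 / 16)"
  have \<eta>: "0 < \<eta>" "\<eta> \<le> d / (8 * n)" "\<eta> \<le> c * \<delta>\<^sub>0 / 16" using d_pos n_pos c \<delta>0 by (auto simp: \<eta>_def)
  \<comment> \<open>Small enough for the union over all triples of the \<open>n + 1\<close> points of the chain.\<close>
  define \<kappa> where "\<kappa> = \<delta>\<^sub>0 / (4 * real (Suc n) ^ 3)"
  have \<kappa>: "0 < \<kappa>" using \<delta>0 by (simp add: \<kappa>_def)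
  obtain \<delta>1 where \<delta>1: "0 < \<delta>1"
    "\<And>u v w. u \<in> Q \<delta>1 \<Longrightarrow> v \<in> Q \<delta>1 \<Longrightarrow> w \<in> Q \<delta>1 \<Longrightarrow> measure \<nu> (between (c / 2) u v w) < \<kappa>"
    using approx_fixed_two_valued[of "c / 2" \<kappa>] c \<kappa> by auto
  define \<delta> where "\<delta> = min \<delta>1 (\<eta> / n)"
  have \<delta>: "0 < \<delta>" "\<delta> \<le> \<delta>1" "\<delta> \<le> \<eta> / n" using \<delta>1 \<eta> n_pos by (auto simp: \<delta>_def)
  have n\<delta>: "n * \<delta> \<le> \<eta>" using \<delta>(3) n_pos by (simp add: field_simps)
  obtain \<delta>2 where \<delta>2: "0 < \<delta>2" "\<forall>x\<in>Q \<delta>2. \<forall>y\<in>Q \<delta>2. \<exists>z::nat \<Rightarrow> 'a \<Rightarrow> real.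
      z 0 = x \<and> z n = y \<and> (\<forall>i\<le>n. z i \<in> Q \<delta>) \<and>
      (\<forall>i<n. dist1 (z i) (z (Suc i)) \<le> dist1 x y / n + \<delta>)"
    using chain[OF n \<delta>(1)] by (elim exE conjE)
  obtain x where x: "x \<in> Q \<delta>2" using Q_nonempty[OF \<delta>2(1)] by blast
  have "x \<in> D" using x Q_D by blast
  then obtain \<delta>3 where \<delta>3: "0 < \<delta>3" "\<And>y. y \<in> Q \<delta>3 \<Longrightarrow> d - \<eta> < dist1 y x"
    using far[of x "d - \<eta>"] \<eta>(1) by auto
  obtain y where "y \<in> Q (min \<delta>2 \<delta>3)" using Q_nonempty[of "min \<delta>2 \<delta>3"] \<delta>2(1) \<delta>3(1) by auto
  then have y: "y \<in> Q \<delta>2" "y \<in> Q \<delta>3"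
    using Q_mono[of "min \<delta>2 \<delta>3" \<delta>2] Q_mono[of "min \<delta>2 \<delta>3" \<delta>3] by auto
  define L where "L = dist1 x y"
  have L: "d - \<eta> < L" using \<delta>3(2)[OF y(2)] by (simp add: L_def abs_minus_commute)
  from \<delta>2(2)[rule_format, OF x y(1)] obtain z where z: "z 0 = x" "z n = y" "\<And>i. i \<le> n \<Longrightarrow> z i \<in> Q \<delta>"
    "\<And>i. i < n \<Longrightarrow> dist1 (z i) (z (Suc i)) \<le> L / n + \<delta>"
    by (auto simp: L_def)
  have zD: "z i \<in> D" if "i \<le> n" for i using z(3)[OF that] Q_D by blast
  have int: "integrable M (\<lambda>t. \<bar>z i t - z j t\<bar>)" if "i \<le> n" "j \<le> n" for i j
    using D_integrable[OF zD[OF that(1)]] D_integrable[OF zD[OF that(2)]] by simp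
  define A where "A = (\<lambda>i. {t \<in> space M. c * h t < \<bar>z i t - z (Suc i) t\<bar>})"
  have A: "A i \<in> sets M" if "i < n" for i
  proof -
    have [measurable]: "z i \<in> borel_measurable M" "z (Suc i) \<in> borel_measurable M"
      using that zD by (auto intro: D_measurable)
    show ?thesis unfolding A_def by measurable
  qed
  define ex where "ex = (\<lambda>t. (\<Sum>k<n. \<bar>z k t - z (Suc k) t\<bar>) - \<bar>z 0 t - z n t\<bar>)"
  have ex_int: "integrable M ex" unfolding ex_def by (intro Bochner_Integration.integrable_diff Bochner_Integration.integrable_sum int) auto
  have ex_nonneg: "0 \<le> ex t" for t
  proof -
    have "\<bar>z 0 t - z m t\<bar> \<le> (\<Sum>k<m. \<bar>z k t - z (Suc k) t\<bar>)" for m by (induction m) auto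
    then show ?thesis by (simp add: ex_def)
  qed
  have sum_int: "(\<integral>t. (\<Sum>k<n. \<bar>z k t - z (Suc k) t\<bar>) \<partial>M) = (\<Sum>k<n. \<integral>t. \<bar>z k t - z (Suc k) t\<bar> \<partial>M)"
    by (intro Bochner_Integration.integral_sum int) auto
  have "(\<integral>t. ex t \<partial>M) = (\<Sum>k<n. \<integral>t. \<bar>z k t - z (Suc k) t\<bar> \<partial>M) - L"
    unfolding ex_def L_def sum_int[symmetric] z(1,2)[symmetric]
    by (intro Bochner_Integration.integral_diff Bochner_Integration.integrable_sum int) auto
  also have "\<dots> \<le> (\<Sum>k<n. L / n + \<delta>) - L" using z(4) by (intro diff_right_mono sum_mono) auto
  also have "\<dots> = n * \<delta>" using n_pos by (simp add: field_simps)
  finally have ex_small: "(\<integral>t. ex t \<partial>M) \<le> \<eta>" using n\<delta> by simp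
  define X where "X = {t \<in> space M. c / 2 * h t < ex t}"
  have X: "X \<in> sets M"
  proof -
    have [measurable]: "ex \<in> borel_measurable M" using ex_int by auto
    show ?thesis unfolding X_def by measurable
  qed
  have "c / 2 * measure \<nu> X \<le> (\<integral>t. ex t \<partial>M)"
    using ex_nonneg by (intro markov_\<nu> ex_int X) (auto simp: X_def)
  also have "\<dots> \<le> c * \<delta>\<^sub>0 / 16" using ex_small \<eta>(3) by simp
  finally have X_small: "measure \<nu> X \<le> \<delta>\<^sub>0 / 4" using c \<delta>0 by (simp add: field_simps)
  define I where "I = {..n} \<times> {..n} \<times> {..n}"
  define Y where "Y = (\<lambda>(i, j, l). between (c / 2) (z i) (z j) (z l))"
  have Y_sets: "Y p \<in> sets \<nu>" if "p \<in> I" for p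
    using that zD by (cases p) (auto simp: Y_def I_def intro!: between_sets)
  have Y_small: "measure \<nu> (Y p) \<le> \<kappa>" if "p \<in> I" for p
  proof -
    have "z i \<in> Q \<delta>1" if "i \<le> n" for i using z(3)[OF that] Q_mono[OF \<delta>(2)] by blast
    then show ?thesis
      using that by (cases p) (auto simp: Y_def I_def intro!: less_imp_le[OF \<delta>1(2)])
  qed
  have "measure \<nu> (\<Union>p\<in>I. Y p) \<le> (\<Sum>p\<in>I. measure \<nu> (Y p))"
    using Y_sets by (intro measure_UNION_le) (auto simp: I_def)
  also have "\<dots> \<le> (\<Sum>p\<in>I. \<kappa>)" using Y_small by (rule sum_mono)
  also have "\<dots> = real (Suc n) ^ 3 * \<kappa>"
    by (simp add: I_def card_cartesian_product power3_eq_cube algebra_simps)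
  also have "\<dots> = \<delta>\<^sub>0 / 4" unfolding \<kappa>_def by (simp add: field_simps del: of_nat_Suc)
  finally have UY: "measure \<nu> (\<Union>p\<in>I. Y p) \<le> \<delta>\<^sub>0 / 4" .
  define W where "W = X \<union> (\<Union>p\<in>I. Y p)"
  have UY_sets: "(\<Union>p\<in>I. Y p) \<in> sets \<nu>" using Y_sets by (intro sets.finite_UN) (auto simp: I_def)
  have W_sets: "W \<in> sets \<nu>" unfolding W_def using UY_sets X by (intro sets.Un) auto
  have W: "measure \<nu> W \<le> \<delta>\<^sub>0 / 2"
    unfolding W_def using measure_Un_le[OF _ UY_sets, of X] X X_small UY by simp
  have overlap: "t \<in> W" if ij: "i < j" "j < n" and t: "t \<in> A i" "t \<in> A j" for i j t
  proof (rule ccontr)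
    assume "t \<notin> W"
    then have notX: "ex t \<le> c / 2 * h t" and notY: "t \<notin> Y p" if "p \<in> I" for p
      using t(1) that by (auto simp: W_def X_def A_def)
    have tM: "t \<in> space M" using t(1) by (simp add: A_def)
    have excess: "\<bar>z i t - z (Suc i) t\<bar> + \<bar>z (Suc i) t - z j t\<bar> + \<bar>z j t - z (Suc j) t\<bar> - \<bar>z i t - z (Suc j) t\<bar> \<le> ex t"
      unfolding ex_def by (rule variation_split[OF ij, of "\<lambda>k. z k t"])
    have "(0, 0, 0) \<in> I" by (simp add: I_def)
    from notX[OF this] excess
    have "(z i t + (c * h t) / 2 < z (Suc i) t \<and> z (Suc i) t + (c * h t) / 2 < z (Suc j) t) \<or>
        (z (Suc j) t + (c * h t) / 2 < z (Suc i) t \<and> z (Suc i) t + (c * h t) / 2 < z i t)"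
      using t c h_pos[OF tM] by (intro two_large_steps) (auto simp: A_def)
    moreover have "(i, Suc i, Suc j) \<in> I" "(Suc j, Suc i, i) \<in> I" using ij by (auto simp: I_def)
    ultimately show False using notY tM by (auto simp: Y_def between_def)
  qed
  \<comment> \<open>Pigeonhole principle for disjoint sets of total measure at most \<open>H\<close>.\<close>
  have "\<exists>i<n. measure \<nu> (A i - W) \<le> H / n"
  proof (rule ccontr)
    assume "\<not> ?thesis"
    then have "(\<Sum>i<n. H / n) < (\<Sum>i<n. measure \<nu> (A i - W))"
      using n by (intro sum_strict_mono) (auto simp: not_le lessThan_empty_iff)
    also have "\<dots> = measure \<nu> (\<Union>i<n. A i - W)"
    proof (rule finite_measure_finite_Union[symmetric])
      show "(\<lambda>i. A i - W) ` {..<n} \<subseteq> sets \<nu>" using A W_sets by auto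
      show "disjoint_family_on (\<lambda>i. A i - W) {..<n}"
        unfolding disjoint_family_on_def
      proof (intro ballI impI)
        fix i j assume "i \<in> {..<n}" "j \<in> {..<n}" "i \<noteq> j"
        then show "(A i - W) \<inter> (A j - W) = {}"
          using overlap[of i j] overlap[of j i] by (cases i j rule: linorder_cases) auto
      qed
    qed simp
    also have "\<dots> \<le> H" unfolding H_def using bounded_measure by simp
    finally show False using n_pos by simp
  qed
  then obtain i where i: "i < n" "measure \<nu> (A i - W) \<le> H / n" by blast
  have "measure \<nu> (A i) \<le> measure \<nu> ((A i - W) \<union> W)"
    using A[OF i(1)] W_sets by (intro finite_measure_mono) auto
  also have "\<dots> \<le> measure \<nu> (A i - W) + measure \<nu> W"
    using A[OF i(1)] W_sets by (intro measure_Un_le) auto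
  finally have Ai: "measure \<nu> (A i) \<le> \<delta>\<^sub>0" using i(2) Hn W by argo
  define f where "f = (\<lambda>t. \<bar>z i t - z (Suc i) t\<bar>)"
  have f: "integrable M f" unfolding f_def using i(1) by (intro int) auto
  have Af: "integrable M (\<lambda>t. indicator (A i) t * f t)"
    using integrable_mult_indicator[OF A[OF i(1)] f] by simp
  have "L \<le> (\<Sum>k<n. \<integral>t. \<bar>z k t - z (Suc k) t\<bar> \<partial>M)"
    using integral_nonneg_AE[of ex M] ex_nonneg
      \<open>(\<integral>t. ex t \<partial>M) = (\<Sum>k<n. \<integral>t. \<bar>z k t - z (Suc k) t\<bar> \<partial>M) - L\<close> by simp
  also have "\<dots> = (\<integral>t. f t \<partial>M) + (\<Sum>k\<in>{..<n} - {i}. \<integral>t. \<bar>z k t - z (Suc k) t\<bar> \<partial>M)"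
    unfolding f_def using i(1) by (intro sum.remove) auto
  also have "\<dots> \<le> (\<integral>t. f t \<partial>M) + (\<Sum>k\<in>{..<n} - {i}. L / n + \<delta>)"
    using z(4) by (intro add_left_mono sum_mono) auto
  also have "\<dots> = (\<integral>t. f t \<partial>M) + (n - 1) * (L / n + \<delta>)" using i(1) by simp
  finally have "L - (n - 1) * (L / n + \<delta>) \<le> (\<integral>t. f t \<partial>M)" by simp
  moreover have "L - (n - 1) * (L / n + \<delta>) = L / n - n * \<delta> + \<delta>"
    using n_pos n by (simp add: of_nat_diff field_simps)
  moreover have "(d - \<eta>) / n \<le> L / n" using L n_pos by (intro divide_right_mono) auto
  moreover have "(d - \<eta>) / n \<ge> d / n - \<eta>"
    using divide_left_mono[of 1 "real n" \<eta>] \<eta>(1) n n_pos by (simp add: diff_divide_distrib)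
  moreover have "d / (8 * n) = d / n / 8" "d / (16 * n) = d / n / 16" "0 < d / n"
    using d_pos n_pos by simp_all
  ultimately have "4 * (d / (16 * n)) < (\<integral>t. f t \<partial>M)"
    using n\<delta> \<delta>(1) \<eta>(1,2) by linarith
  have "(\<integral>t. f t - indicator (A i) t * f t \<partial>M) \<le> (\<integral>t. c * h t \<partial>M)"
  proof (rule integral_mono)
    show "f t - indicator (A i) t * f t \<le> c * h t" if "t \<in> space M" for t
      using that c h_pos[OF that] by (auto simp: A_def f_def indicator_def)
  qed (use f Af h_integrable in auto)
  moreover have "H = (\<integral>t. h t \<partial>M)"
    unfolding H_def measure_\<nu>[OF sets.top] by (intro Bochner_Integration.integral_cong) auto
  ultimately have "(\<integral>t. f t \<partial>M) - (\<integral>t. indicator (A i) t * f t \<partial>M) \<le> c * H"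
    using f Af by simp
  then have "3 / 4 * (\<integral>t. f t \<partial>M) < (\<integral>t. indicator (A i) t * f t \<partial>M)"
    using cH \<open>4 * (d / (16 * n)) < (\<integral>t. f t \<partial>M)\<close> by linarith
  with Ai A[OF i(1)] zD[of i] zD[of "Suc i"] i(1) that[of "z i" "z (Suc i)" "A i"] show thesis
    by (simp add: f_def)
qed

end

section \<open>Uniform integrability in reflexive spaces\<close>

context weighted_L1
begin

text \<open>The part of \<open>|g|\<close> above \<open>n h\<close> has small integral for large \<open>n\<close>, and the part below is controlled by \<open>\<nu>\<close>.\<close>

lemma absolutely_continuous_integral:
  fixes g :: "'a \<Rightarrow> real"
  assumes g: "integrable M g" and \<epsilon>: "0 < \<epsilon>"
  obtains \<delta> where "0 < \<delta>" "\<And>A. A \<in> sets M \<Longrightarrow> measure \<nu> A \<le> \<delta> \<Longrightarrow> mass A g \<le> \<epsilon>"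
proof -
  have [measurable]: "g \<in> borel_measurable M" using g by auto
  define B where "B = (\<lambda>n. {t \<in> space M. real n * h t < \<bar>g t\<bar>})"
  have B [measurable]: "B n \<in> sets M" for n unfolding B_def by measurable
  have "(\<lambda>n. \<integral>t. indicator (B n) t * \<bar>g t\<bar> \<partial>M) \<longlonglongrightarrow> (\<integral>t. 0 \<partial>M)"
  proof (rule integral_dominated_convergence[where w = "\<lambda>t. \<bar>g t\<bar>"])
    show "AE t in M. (\<lambda>n. indicator (B n) t * \<bar>g t\<bar>) \<longlonglongrightarrow> 0"
    proof (rule AE_I2)
      fix t assume t: "t \<in> space M"
      obtain N :: nat where N: "\<bar>g t\<bar> / h t < N" using reals_Archimedean2 by blast
      have "indicator (B n) t * \<bar>g t\<bar> = 0" if "N \<le> n" for n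
      proof -
        have "\<bar>g t\<bar> < N * h t" using N h_pos[OF t] by (simp add: field_simps)
        also have "\<dots> \<le> n * h t" using that h_pos[OF t] by simp
        finally show ?thesis by (simp add: B_def)
      qed
      then show "(\<lambda>n. indicator (B n) t * \<bar>g t\<bar>) \<longlonglongrightarrow> 0"
        by (intro tendsto_eventually) (auto simp: eventually_sequentially)
    qed
  qed (use g in \<open>auto simp: indicator_def\<close>)
  then have "\<forall>\<^sub>F n in sequentially. mass (B n) g < \<epsilon> / 2"
    using \<epsilon> by (intro order_tendstoD(2)) auto
  then obtain n where n: "mass (B n) g < \<epsilon> / 2"
    unfolding eventually_sequentially by blast
  show thesis
  proof (rule that)
    show "0 < \<epsilon> / (2 * (real n + 1))" using \<epsilon> by simp
    fix A assume A [measurable]: "A \<in> sets M" and small: "measure \<nu> A \<le> \<epsilon> / (2 * (real n + 1))"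
    have int: "integrable M (\<lambda>t. indicator E t * \<bar>g t\<bar>)" "integrable M (\<lambda>t. indicator E t * h t)" if "E \<in> sets M" for E
      using integrable_mult_indicator[OF that h_integrable] integrable_mult_indicator[OF that integrable_abs[OF g]]
      by simp_all
    have "mass A g \<le> (\<integral>t. real n * (indicator A t * h t) + indicator (B n) t * \<bar>g t\<bar> \<partial>M)"
    proof (rule integral_mono)
      fix t assume "t \<in> space M"
      then show "indicator A t * \<bar>g t\<bar> \<le> real n * (indicator A t * h t) + indicator (B n) t * \<bar>g t\<bar>"
        using h_pos[of t] by (auto simp: indicator_def B_def not_less)
    qed (use int A B in auto)
    also have "\<dots> = real n * measure \<nu> A + mass (B n) g"
      using int A B by (simp add: measure_\<nu>)
    also have "real n * measure \<nu> A \<le> (real n + 1) * (\<epsilon> / (2 * (real n + 1)))"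
      using small by (intro mult_mono) auto
    also have "\<dots> = \<epsilon> / 2" by (simp add: field_simps)
    finally show "mass A g \<le> \<epsilon>" using n by simp
  qed
qed

end

text \<open>Only a seminorm that dominates the norm of \<open>L\<^sup>1\<close> is assumed, since the members of \<open>S\<close> may be large
  outside the underlying set of the measure.\<close>

locale reflexive_L1_bounded = reflexive_seminormed q S + weighted_L1 M h
  for q and S :: "('a \<Rightarrow> real) set" and M :: "'a measure" and h +
  assumes S_integrable: "f \<in> S \<Longrightarrow> integrable M f"
    and L1_le: "f \<in> S \<Longrightarrow> (\<integral>t. \<bar>f t\<bar> \<partial>M) \<le> q f"
begin

lemma indicator_integrable:
  assumes "f \<in> S" "A \<in> sets M" shows "integrable M (\<lambda>t. indicator A t * \<bar>f t\<bar>)"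
  using integrable_mult_indicator[OF assms(2), of "\<lambda>t. \<bar>f t\<bar>"] S_integrable[OF assms(1)] by auto

lemma indicator_le_q:
  assumes f: "f \<in> S" and A: "A \<in> sets M" shows "mass A f \<le> q f"
proof -
  have "mass A f \<le> (\<integral>t. \<bar>f t\<bar> \<partial>M)"
    using indicator_integrable[OF f A] S_integrable[OF f] by (intro integral_mono) (auto simp: indicator_def)
  with L1_le[OF f] show ?thesis by simp
qed

text \<open>Each new set is so small that the preceding functions, and by the decay of \<open>\<delta>\<close> all earlier ones, do not
  see it.\<close>

lemma bump_sequence:
  assumes bump: "\<forall>\<delta>>0. \<exists>f\<in>S. \<exists>A\<in>sets M. q f \<le> 1 \<and> measure \<nu> A \<le> \<delta> \<and> 3 / 4 < mass A f"
  shows "\<exists>g A \<delta>. \<forall>j::nat. g j \<in> S \<and> q (g j) \<le> 1 \<and> A j \<in> sets M \<and>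
    3 / 4 < mass (A j) (g j) \<and> 0 < \<delta> j \<and>
    (\<forall>B\<in>sets M. measure \<nu> B \<le> \<delta> j \<longrightarrow> mass B (g j) \<le> 1 / 8) \<and>
    measure \<nu> (A (Suc j)) \<le> \<delta> j / 2 \<and> \<delta> (Suc j) \<le> \<delta> j / 2"
proof -
  define good where "good = (\<lambda>(g, A, \<delta>). g \<in> S \<and> q g \<le> 1 \<and> A \<in> sets M \<and> 3 / 4 < mass A g \<and> 0 < \<delta> \<and>
    (\<forall>B\<in>sets M. measure \<nu> B \<le> \<delta> \<longrightarrow> mass B g \<le> 1 / 8))"
  have ex: "\<exists>g A \<delta>. good (g, A, \<delta>) \<and> measure \<nu> A \<le> \<epsilon> \<and> \<delta> \<le> \<epsilon>" if \<epsilon>: "0 < \<epsilon>" for \<epsilon>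
  proof -
    obtain g A where g: "g \<in> S" "A \<in> sets M" "q g \<le> 1" "measure \<nu> A \<le> \<epsilon>" "3 / 4 < mass A g"
      using bump \<epsilon> by blast
    obtain \<delta> where \<delta>: "0 < \<delta>" "\<And>B. B \<in> sets M \<Longrightarrow> measure \<nu> B \<le> \<delta> \<Longrightarrow> mass B g \<le> 1 / 8"
      using absolutely_continuous_integral[OF S_integrable[OF g(1)], of "1 / 8"] by auto
    have "good (g, A, min \<delta> \<epsilon>)" using g \<delta> \<epsilon> by (auto simp: good_def)
    moreover have "min \<delta> \<epsilon> \<le> \<epsilon>" by simp
    ultimately show ?thesis using g(4) by blast
  qed
  define step where "step = (\<lambda>(g :: 'a \<Rightarrow> real, A :: 'a set, \<delta>) (g' :: 'a \<Rightarrow> real, A', \<delta>').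
    measure \<nu> A' \<le> \<delta> / 2 \<and> \<delta>' \<le> \<delta> / 2)"
  have "\<exists>F. \<forall>n. good (F n) \<and> step (F n) (F (Suc n))"
  proof (rule dependent_nat_choice)
    show "\<exists>x. good x" using ex[of 1] by auto
    fix x and n :: nat assume "good x"
    moreover obtain g A \<delta> where x: "x = (g, A, \<delta>)" by (cases x)
    ultimately have "0 < \<delta> / 2" by (simp add: good_def)
    from ex[OF this] obtain g' A' \<delta>' where "good (g', A', \<delta>')" "measure \<nu> A' \<le> \<delta> / 2" "\<delta>' \<le> \<delta> / 2"
      by blast
    then show "\<exists>y. good y \<and> step x y" using x by (intro exI[of _ "(g', A', \<delta>')"]) (simp add: step_def)
  qed
  then obtain F where F: "\<And>n. good (F n)" "\<And>n. step (F n) (F (Suc n))" by blast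
  show ?thesis
  proof (intro exI allI)
    fix j
    show "fst (F j) \<in> S \<and> q (fst (F j)) \<le> 1 \<and> fst (snd (F j)) \<in> sets M \<and>
      3 / 4 < (\<integral>t. indicator (fst (snd (F j))) t * \<bar>fst (F j) t\<bar> \<partial>M) \<and> 0 < snd (snd (F j)) \<and>
      (\<forall>B\<in>sets M. measure \<nu> B \<le> snd (snd (F j)) \<longrightarrow> mass B (fst (F j)) \<le> 1 / 8) \<and>
      measure \<nu> (fst (snd (F (Suc j)))) \<le> snd (snd (F j)) / 2 \<and> snd (snd (F (Suc j))) \<le> snd (snd (F j)) / 2"
      using F(1)[of j] F(2)[of j] by (simp add: good_def step_def case_prod_unfold)
  qed
qed

text \<open>Failing this, there are \<open>g j\<close> in the unit ball that carry most of their mass on disjoint sets \<open>B j\<close>. Let \<open>s\<close>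
  be the sign of \<open>g j\<close> on each \<open>B j\<close> and let \<open>\<phi> n\<close> be integration against \<open>s\<close> over the union \<open>V n\<close> of the
  \<open>B j\<close> with \<open>j \<ge> n\<close>. Then \<open>\<phi> n (g j) \<ge> 1 / 4\<close> for \<open>j \<ge> n\<close>, and weak compactness yields one \<open>f\<close> with
  \<open>\<phi> n f \<ge> 1 / 4\<close> for all \<open>n\<close>. But \<open>V n\<close> shrinks to a null set, so \<open>\<phi> n f\<close> tends to \<open>0\<close>.\<close>

lemma uniformly_integrable:
  "\<exists>\<delta>>0. \<forall>f\<in>S. \<forall>A\<in>sets M. measure \<nu> A \<le> \<delta> \<longrightarrow> mass A f \<le> 3 / 4 * q f"
proof (rule ccontr)
  assume *: "\<not> ?thesis"
  have neg: "\<exists>f\<in>S. \<exists>A\<in>sets M. measure \<nu> A \<le> \<delta> \<and> 3 / 4 * q f < mass A f" if "0 < \<delta>" for \<delta>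
  proof (rule ccontr)
    assume "\<not> ?thesis"
    then have "\<forall>f\<in>S. \<forall>A\<in>sets M. measure \<nu> A \<le> \<delta> \<longrightarrow> mass A f \<le> 3 / 4 * q f"
      by (auto simp: not_less)
    with * that show False by blast
  qed
  have bump: "\<forall>\<delta>>0. \<exists>f\<in>S. \<exists>A\<in>sets M. q f \<le> 1 \<and> measure \<nu> A \<le> \<delta> \<and> 3 / 4 < mass A f"
  proof (intro allI impI)
    fix \<delta> :: real assume \<delta>: "0 < \<delta>"
    obtain f A where f: "f \<in> S" "A \<in> sets M" "measure \<nu> A \<le> \<delta>" "3 / 4 * q f < mass A f"
      using neg[OF \<delta>] by blast
    have "q f \<noteq> 0" using f(4) indicator_le_q[OF f(1,2)] by auto
    then have q0: "0 < q f" using q_nonneg[of f] by linarith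
    define g where "g = (1 / q f) *\<^sub>R f"
    have "g \<in> S" unfolding g_def by (rule subspace_scale[OF subspace f(1)])
    moreover have "q g \<le> 1" using q0 by (simp add: g_def q_scale)
    moreover have "mass A g = (\<integral>t. (1 / q f) * (indicator A t * \<bar>f t\<bar>) \<partial>M)"
      using q0 by (intro Bochner_Integration.integral_cong) (auto simp: g_def abs_mult)
    then have gf: "mass A g = mass A f / q f" by simp
    have "3 / 4 < mass A f / q f"
      using f(4) by (subst pos_less_divide_eq[OF q0])
    then have "3 / 4 < mass A g" unfolding gf .
    ultimately show "\<exists>f\<in>S. \<exists>A\<in>sets M. q f \<le> 1 \<and> measure \<nu> A \<le> \<delta> \<and> 3 / 4 < mass A f"
      using f(2,3) by blast
  qed
  obtain g A \<delta> where seq: "\<forall>j::nat. g j \<in> S \<and> q (g j) \<le> 1 \<and> A j \<in> sets M \<and>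
    3 / 4 < mass (A j) (g j) \<and> 0 < \<delta> j \<and>
    (\<forall>B\<in>sets M. measure \<nu> B \<le> \<delta> j \<longrightarrow> mass B (g j) \<le> 1 / 8) \<and>
    measure \<nu> (A (Suc j)) \<le> \<delta> j / 2 \<and> \<delta> (Suc j) \<le> \<delta> j / 2"
    using bump_sequence bump by blast
  have g: "g j \<in> S" "q (g j) \<le> 1" and A: "A j \<in> sets M"
    and gA: "3 / 4 < mass (A j) (g j)" and \<delta>: "0 < \<delta> j"
    and after: "measure \<nu> (A (Suc j)) \<le> \<delta> j / 2" "\<delta> (Suc j) \<le> \<delta> j / 2" for j
    using seq by simp_all
  have small: "mass B (g j) \<le> 1 / 8" if "B \<in> sets M" "measure \<nu> B \<le> \<delta> j" for j B
    using seq that by simp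
  have decay: "\<delta> (j + k) \<le> \<delta> j * (1 / 2) ^ k" for j k
  proof (induction k)
    case (Suc k)
    then show ?case using after(2)[of "j + k"] by simp
  qed simp
  define U where "U = (\<lambda>j. \<Union>k. A (j + Suc k))"
  have U: "U j \<in> sets M" for j using A by (auto simp: U_def)
  have U_small: "measure \<nu> (U j) \<le> \<delta> j" for j
  proof -
    have le: "measure \<nu> (A (j + Suc k)) \<le> \<delta> j * (1 / 2) ^ Suc k" for k
      using after(1)[of "j + k"] decay[of j k] by simp
    have sums: "(\<lambda>k. \<delta> j * (1 / 2) ^ Suc k) sums (\<delta> j * 1)" by (rule sums_mult[OF power_half_series])
    have summable: "summable (\<lambda>k. measure \<nu> (A (j + Suc k)))"
      using le by (intro summable_comparison_test[OF _ sums_summable[OF sums]]) auto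
    have "measure \<nu> (U j) \<le> (\<Sum>k. measure \<nu> (A (j + Suc k)))"
      unfolding U_def using A summable by (intro finite_measure_subadditive_countably) auto
    also have "\<dots> \<le> \<delta> j" using suminf_le[OF le summable sums_summable[OF sums]] sums_unique[OF sums] by simp
    finally show ?thesis .
  qed
  define B where "B = (\<lambda>j. A j - U j)"
  have B [measurable]: "B j \<in> sets M" for j using A U by (auto simp: B_def)
  have B_disjoint: "t \<notin> B i" if "t \<in> B j" "i \<noteq> j" for t i j
  proof -
    have "t \<notin> B i" if "i < j" "t \<in> B j" for i j
    proof -
      have "t \<in> A (i + Suc (j - i - 1))" using that by (simp add: B_def)
      then show ?thesis by (auto simp: B_def U_def)
    qed
    with that show ?thesis by (metis linorder_neqE_nat)
  qed
  have gB: "5 / 8 \<le> mass (B j) (g j)" for j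
  proof -
    have "mass (A j) (g j) \<le> (\<integral>t. indicator (B j) t * \<bar>g j t\<bar> + indicator (U j) t * \<bar>g j t\<bar> \<partial>M)"
      using A B U g by (intro integral_mono Bochner_Integration.integrable_add indicator_integrable)
        (auto simp: B_def indicator_def)
    also have "\<dots> = mass (B j) (g j) + mass (U j) (g j)"
      using B U g by (intro Bochner_Integration.integral_add indicator_integrable)
    finally show ?thesis using gA[of j] small[OF U U_small, of j] by simp
  qed
  define s where "s = (\<lambda>t. \<Sum>j. indicator (B j) t * sgn (g j t))"
  have s: "s t = sgn (g j t)" if "t \<in> B j" for j t
  proof -
    have "s t = (\<Sum>i\<in>{j}. indicator (B i) t * sgn (g i t))"
      unfolding s_def using B_disjoint[OF that] by (intro suminf_finite) auto
    then show ?thesis using that by simp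
  qed
  have s_bound: "\<bar>s t\<bar> \<le> 1" for t
  proof (cases "\<exists>j. t \<in> B j")
    case True
    then show ?thesis using s by (auto simp: abs_sgn_eq)
  next
    case False
    then show ?thesis by (simp add: s_def)
  qed
  have [measurable]: "g j \<in> borel_measurable M" for j using S_integrable[OF g(1)] by auto
  have [measurable]: "s \<in> borel_measurable M" unfolding s_def by measurable
  define V where "V = (\<lambda>n. \<Union>j\<in>{n..}. B j)"
  have V [measurable]: "V n \<in> sets M" for n unfolding V_def by (intro sets.countable_UN'') auto
  define \<phi> where "\<phi> = (\<lambda>n f. \<integral>t. f t * (indicator (V n) t * s t) \<partial>M)"
  have int: "integrable M (\<lambda>t. f t * (indicator (V n) t * s t))" if f: "f \<in> S" for f n
  proof (rule Bochner_Integration.integrable_bound[OF S_integrable[OF f]])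
    have [measurable]: "f \<in> borel_measurable M" using S_integrable[OF f] by auto
    show "(\<lambda>t. f t * (indicator (V n) t * s t)) \<in> borel_measurable M" by measurable
    show "AE t in M. norm (f t * (indicator (V n) t * s t)) \<le> norm (f t)"
      using s_bound by (intro AE_I2) (auto simp: abs_mult indicator_def mult_left_le)
  qed
  have \<phi>_le: "\<bar>\<phi> n f\<bar> \<le> mass (V n) f" if f: "f \<in> S" for n f
  proof -
    have "\<bar>\<phi> n f\<bar> \<le> (\<integral>t. \<bar>f t * (indicator (V n) t * s t)\<bar> \<partial>M)"
      unfolding \<phi>_def by (rule integral_abs_bound)
    also have "\<dots> \<le> mass (V n) f"
      using s_bound
      by (intro integral_mono[OF integrable_abs[OF int[OF f]] indicator_integrable[OF f V]])
        (auto simp: abs_mult indicator_def mult_left_le)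
    finally show ?thesis .
  qed
  have \<phi>_combination: "\<phi> n (u *\<^sub>R f + v *\<^sub>R k) = u * \<phi> n f + v * \<phi> n k" if "f \<in> S" "k \<in> S" for n f k u v
    unfolding \<phi>_def using int[OF that(1)] int[OF that(2)] by (simp add: distrib_right mult.assoc)
  have \<phi>_large: "1 / 4 \<le> \<phi> n (g j)" if "n \<le> j" for n j
  proof -
    have i: "integrable M (\<lambda>t. \<bar>g j t\<bar>)" "integrable M (\<lambda>t. indicator (B j) t * \<bar>g j t\<bar>)"
      using S_integrable[OF g(1)] indicator_integrable[OF g(1) B] by auto
    \<comment> \<open>At worst the sign is wrong on the whole complement of \<open>B j\<close>, whose mass is at most \<open>3 / 8\<close>.\<close>
    have "1 / 4 \<le> 2 * mass (B j) (g j) - (\<integral>t. \<bar>g j t\<bar> \<partial>M)"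
      using gB[of j] L1_le[OF g(1), of j] g(2)[of j] by simp
    also have "\<dots> = (\<integral>t. 2 * (indicator (B j) t * \<bar>g j t\<bar>) - \<bar>g j t\<bar> \<partial>M)"
      using i by simp
    also have "\<dots> \<le> \<phi> n (g j)"
      unfolding \<phi>_def
    proof (rule integral_mono)
      fix t
      show "2 * (indicator (B j) t * \<bar>g j t\<bar>) - \<bar>g j t\<bar> \<le> g j t * (indicator (V n) t * s t)"
      proof (cases "t \<in> B j")
        case True
        then have "t \<in> V n" using that by (auto simp: V_def)
        then show ?thesis using True s[OF True] by (simp add: abs_sgn mult.commute)
      next
        case False
        have "\<bar>g j t * (indicator (V n) t * s t)\<bar> \<le> \<bar>g j t\<bar>"
          using s_bound[of t] by (auto simp: abs_mult indicator_def mult_left_le)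
        then show ?thesis using False by simp
      qed
    qed (use i int[OF g(1)] in auto)
    finally show ?thesis .
  qed
  \<comment> \<open>All constraints up to \<open>n\<close> are imposed at once in order to have a decreasing family.\<close>
  define K where "K = (\<lambda>n. {f \<in> S. q f \<le> 1 \<and> (\<forall>m\<le>n. 1 / 4 \<le> \<phi> m f)})"
  have "S \<inter> \<Inter>(range K) \<noteq> {}"
  proof (rule directed_Inter_nonempty[of "range K" 1])
    fix H assume "H \<in> range K"
    then obtain n where n: "H = K n" by auto
    have "g n \<in> H" using g \<phi>_large by (auto simp: n K_def)
    moreover have "convex H"
    proof (rule convexI)
      fix x y and u v :: real assume *: "x \<in> H" "y \<in> H" "0 \<le> u" "0 \<le> v" "u + v = 1"
      have xy: "x \<in> S" "y \<in> S" "q x \<le> 1" "q y \<le> 1" using * by (auto simp: n K_def)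
      have "u *\<^sub>R x + v *\<^sub>R y \<in> S" using xy subspace by (intro subspace_add subspace_scale)
      moreover have "q (u *\<^sub>R x + v *\<^sub>R y) \<le> 1"
        using q_combination[OF *(3-5), of x 0 1 y 0 1] xy *(5) by simp
      moreover have "1 / 4 \<le> \<phi> m (u *\<^sub>R x + v *\<^sub>R y)" if "m \<le> n" for m
      proof -
        have "u * (1 / 4) + v * (1 / 4) \<le> u * \<phi> m x + v * \<phi> m y"
          using * that by (intro add_mono mult_left_mono) (auto simp: n K_def)
        moreover have "u * (1 / 4) + v * (1 / 4) = 1 / 4" using *(5) by simp
        ultimately show ?thesis using \<phi>_combination[OF xy(1,2)] by simp
      qed
      ultimately show "u *\<^sub>R x + v *\<^sub>R y \<in> H" by (simp add: n K_def)
    qed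
    moreover have "q_closed H"
      unfolding q_closed_def
    proof (intro conjI ballI impI)
      show "H \<subseteq> S" by (auto simp: n K_def)
      fix x assume x: "x \<in> S" "\<forall>e>0. \<exists>k\<in>H. q (x - k) < e"
      have "q x \<le> 1"
      proof (rule field_le_epsilon)
        fix e :: real assume "0 < e"
        then obtain k where "k \<in> H" "q (x - k) < e" using x(2) by blast
        then show "q x \<le> 1 + e" using q_triangle[of "x - k" k] by (simp add: n K_def)
      qed
      moreover have "1 / 4 \<le> \<phi> m x" if "m \<le> n" for m
      proof (rule field_le_epsilon)
        fix e :: real assume "0 < e"
        then obtain k where k: "k \<in> H" "q (x - k) < e" using x(2) by blast
        have kS: "k \<in> S" using k(1) by (simp add: n K_def)
        have xk: "x - k \<in> S" using x(1) kS by (rule subspace_diff[OF subspace])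
        have "\<phi> m k - \<phi> m x = - \<phi> m (x - k)"
          using \<phi>_combination[OF x(1) kS, of m 1 "-1"] by simp
        also have "\<dots> \<le> q (x - k)"
          using \<phi>_le[OF xk, of m] indicator_le_q[OF xk V, of m] by simp
        finally show "1 / 4 \<le> \<phi> m x + e" using k that by (auto simp: n K_def)
      qed
      ultimately show "x \<in> H" using x(1) by (simp add: n K_def)
    qed
    ultimately show "H \<noteq> {} \<and> convex H \<and> q_closed H" by blast
  next
    show "q x \<le> 1" if "H \<in> range K" "x \<in> H" for H x using that by (auto simp: K_def)
    show "\<exists>J\<in>range K. J \<subseteq> H \<inter> H'" if "H \<in> range K" "H' \<in> range K" for H H'
    proof -
      obtain m n where mn: "H = K m" "H' = K n" using \<open>H \<in> range K\<close> \<open>H' \<in> range K\<close> by auto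
      have "K (max m n) \<subseteq> H \<inter> H'" by (auto simp: mn K_def)
      then show ?thesis by blast
    qed
  qed auto
  then obtain f where "f \<in> S" "\<And>n. f \<in> K n" by blast
  then have f: "f \<in> S" "\<And>n. 1 / 4 \<le> \<phi> n f" by (auto simp: K_def)
  obtain \<epsilon> where \<epsilon>: "0 < \<epsilon>" "\<And>A. A \<in> sets M \<Longrightarrow> measure \<nu> A \<le> \<epsilon> \<Longrightarrow> mass A f \<le> 1 / 8"
    using absolutely_continuous_integral[OF S_integrable[OF f(1)], of "1 / 8"] by auto
  have "(\<lambda>n. \<delta> 0 * (1 / 2) ^ n) \<longlonglongrightarrow> \<delta> 0 * 0" by (intro tendsto_mult tendsto_const LIMSEQ_realpow_zero) auto
  then have "\<forall>\<^sub>F n in sequentially. \<delta> 0 * (1 / 2) ^ n < \<epsilon>" using \<epsilon>(1) by (intro order_tendstoD(2)) auto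
  then obtain n where n: "\<delta> 0 * (1 / 2) ^ n < \<epsilon>" unfolding eventually_sequentially by blast
  have "V (Suc n) \<subseteq> U n"
  proof
    fix t assume "t \<in> V (Suc n)"
    then obtain j where j: "Suc n \<le> j" "t \<in> A j" by (auto simp: V_def B_def)
    then have "t \<in> A (n + Suc (j - Suc n))" by simp
    then show "t \<in> U n" unfolding U_def by blast
  qed
  then have "measure \<nu> (V (Suc n)) \<le> measure \<nu> (U n)" using U by (intro finite_measure_mono) auto
  also have "\<dots> \<le> \<epsilon>" using U_small[of n] decay[of 0 n] n by simp
  finally have "\<bar>\<phi> (Suc n) f\<bar> \<le> 1 / 8" using \<phi>_le[OF f(1), of "Suc n"] \<epsilon>(2)[OF V] by force
  with f(2)[of "Suc n"] show False by simp
qed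

end


section \<open>Strict convexity of powers\<close>

lemma powr_le_self:
  fixes c e :: real
  assumes "0 \<le> c" "c \<le> 1" "1 \<le> e" shows "c powr e \<le> c"
  using assms powr_mono'[of 1 e c] by (cases "c = 0") auto

lemma powr_convex_nonneg:
  fixes x y u v e :: real
  assumes "0 \<le> x" "0 \<le> y" "0 \<le> u" "0 \<le> v" "u + v = 1" "1 \<le> e"
  shows "(u * x + v * y) powr e \<le> u * x powr e + v * y powr e"
proof -
  have *: "(v * y) powr e \<le> v * y powr e" if "0 \<le> y" "0 \<le> v" "v \<le> 1" for v y
    using that assms(6) powr_le_self[of v e] by (simp add: powr_mult mult_right_mono)
  consider "x = 0" | "y = 0" | "0 < x" "0 < y" using assms by linarith
  then show ?thesis
  proof cases
    case 3
    moreover have u: "u = 1 - v" using assms by simp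
    ultimately show ?thesis
      unfolding u using convex_onD[OF powr_convex[OF assms(6)], of v x y] assms by simp
  qed (use * assms in auto)
qed

lemma powr_abs_convex:
  fixes x y u v e :: real
  assumes "0 \<le> u" "0 \<le> v" "u + v = 1" "1 \<le> e"
  shows "\<bar>u * x + v * y\<bar> powr e \<le> u * \<bar>x\<bar> powr e + v * \<bar>y\<bar> powr e"
proof -
  have "\<bar>u * x + v * y\<bar> \<le> u * \<bar>x\<bar> + v * \<bar>y\<bar>"
    using assms abs_triangle_ineq[of "u * x" "v * y"] by (simp add: abs_mult)
  then have "\<bar>u * x + v * y\<bar> powr e \<le> (u * \<bar>x\<bar> + v * \<bar>y\<bar>) powr e"
    using assms by (intro powr_mono2) auto
  also have "\<dots> \<le> u * \<bar>x\<bar> powr e + v * \<bar>y\<bar> powr e"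
    using assms by (intro powr_convex_nonneg) auto
  finally show ?thesis .
qed

text \<open>The mean value theorem on both halves of the interval, with a strictly increasing derivative.\<close>

lemma powr_strictly_convex_nonneg:
  fixes x y e :: real
  assumes "0 \<le> x" "x < y" "1 < e"
  shows "((x + y) / 2) powr e < (x powr e + y powr e) / 2"
proof -
  define m where "m = (x + y) / 2"
  have m: "x < m" "m < y" "0 < m" using assms by (auto simp: m_def)
  have cont: "continuous_on {a..b} (\<lambda>x::real. x powr e)" if "0 \<le> a" for a b
    using that assms(3) by (intro continuous_on_powr' continuous_intros) auto
  have der: "((\<lambda>x. x powr e) has_real_derivative e * t powr (e - 1)) (at t)" if "0 < t" for t
    using that by (auto intro!: derivative_eq_intros)
  have mvt: "\<exists>t. a < t \<and> t < b \<and> b powr e - a powr e = (b - a) * (e * t powr (e - 1))" if "0 \<le> a" "a < b" for a b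
  proof -
    have "\<exists>l t. a < t \<and> t < b \<and> DERIV (\<lambda>x. x powr e) t :> l \<and> b powr e - a powr e = (b - a) * l"
      using that der by (intro MVT cont) (auto simp: real_differentiable_def intro!: exI der)
    then obtain l t where t: "a < t" "t < b" "DERIV (\<lambda>x. x powr e) t :> l" "b powr e - a powr e = (b - a) * l" by blast
    moreover have "l = e * t powr (e - 1)" using DERIV_unique[OF t(3) der] t(1) that by simp
    ultimately show ?thesis by blast
  qed
  obtain s where s: "x < s" "s < m" "m powr e - x powr e = (m - x) * (e * s powr (e - 1))"
    using mvt[OF assms(1) m(1)] by blast
  obtain t where t: "m < t" "t < y" "y powr e - m powr e = (y - m) * (e * t powr (e - 1))"
    using mvt[of m y] m by auto
  have "s powr (e - 1) < t powr (e - 1)" using s t assms by (intro powr_less_mono2) auto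
  then have "(m - x) * (e * s powr (e - 1)) < (m - x) * (e * t powr (e - 1))"
    using m assms(3) by simp
  moreover have "y - m = m - x" by (simp add: m_def field_simps)
  ultimately show ?thesis using s(3) t(3) unfolding m_def[symmetric] by simp
qed

lemma powr_abs_midpoint_eq:
  fixes a b e :: real
  assumes e: "1 < e" and eq: "(\<bar>a\<bar> powr e + \<bar>b\<bar> powr e) / 2 \<le> \<bar>(a + b) / 2\<bar> powr e"
  shows "a = b"
proof -
  have le: "\<bar>(a + b) / 2\<bar> powr e \<le> ((\<bar>a\<bar> + \<bar>b\<bar>) / 2) powr e"
    using e by (intro powr_mono2) auto
  have ab: "\<bar>a\<bar> = \<bar>b\<bar>"
  proof (rule ccontr)
    assume "\<bar>a\<bar> \<noteq> \<bar>b\<bar>"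
    then consider "\<bar>a\<bar> < \<bar>b\<bar>" | "\<bar>b\<bar> < \<bar>a\<bar>" by linarith
    then show False
      using powr_strictly_convex_nonneg[of "\<bar>a\<bar>" "\<bar>b\<bar>" e] powr_strictly_convex_nonneg[of "\<bar>b\<bar>" "\<bar>a\<bar>" e] e le eq
      by cases (auto simp: add.commute)
  qed
  show ?thesis
  proof (rule ccontr)
    assume "a \<noteq> b"
    with ab have "(a + b) / 2 = 0" "0 < \<bar>a\<bar>" by (auto simp: abs_eq_iff)
    then show False using eq ab e by simp
  qed
qed

text \<open>The bound makes a subsequence of \<open>a\<close> bounded and its convexity defects infinitesimal. A cluster point has
  defect \<open>0\<close>, and strict convexity applies.\<close>

lemma convexity_defect_limit:
  fixes a :: "nat \<Rightarrow> real" and s e K :: real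
  assumes e: "1 < e"
    and bound: "\<exists>\<^sub>F n in sequentially. \<bar>a n\<bar> powr e + real (Suc n) *
      ((\<bar>a n\<bar> powr e + \<bar>a n - s\<bar> powr e) / 2 - \<bar>(a n + (a n - s)) / 2\<bar> powr e) \<le> K"
  shows "s = 0"
proof -
  let ?\<Delta> = "\<lambda>x. (\<bar>x\<bar> powr e + \<bar>x - s\<bar> powr e) / 2 - \<bar>(x + (x - s)) / 2\<bar> powr e"
  have \<Delta>: "0 \<le> ?\<Delta> x" for x using powr_abs_convex[of "1/2" "1/2" e x "x - s"] e by (simp add: field_simps)
  let ?I = "{n. \<bar>a n\<bar> powr e + real (Suc n) * ?\<Delta> (a n) \<le> K}"
  have "infinite ?I"
    using bound by (simp add: frequently_cofinite flip: cofinite_eq_sequentially)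
  from infinite_enumerate[OF this] obtain r :: "nat \<Rightarrow> nat" where r: "strict_mono r" "\<forall>n. r n \<in> ?I" by blast
  have r2: "\<bar>a (r n)\<bar> powr e + real (Suc (r n)) * ?\<Delta> (a (r n)) \<le> K" for n
    using r(2)[rule_format, of n] unfolding mem_Collect_eq .
  have K: "\<bar>a (r n)\<bar> powr e \<le> K" "real (Suc (r n)) * ?\<Delta> (a (r n)) \<le> K" for n
    using r2[of n] mult_nonneg_nonneg[OF of_nat_0_le_iff[of "Suc (r n)"] \<Delta>[of "a (r n)"]] powr_ge_zero[of "\<bar>a (r n)\<bar>" e]
    by linarith+
  have K0: "0 \<le> K" using K(1)[of 0] powr_ge_zero order_trans by blast
  have "\<bar>a (r n)\<bar> \<le> K powr (1 / e)" for n
  proof -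
    have "\<bar>a (r n)\<bar> = (\<bar>a (r n)\<bar> powr e) powr (1 / e)" using e by (simp add: powr_powr)
    also have "\<dots> \<le> K powr (1 / e)" using K(1) e by (intro powr_mono2) auto
    finally show ?thesis .
  qed
  then have "bounded (range (a \<circ> r))" unfolding bounded_iff by (auto intro!: exI[of _ "K powr (1 / e)"])
  then obtain l r' where r': "strict_mono r'" "(a \<circ> r \<circ> r') \<longlonglongrightarrow> l"
    using bounded_imp_convergent_subsequence by blast
  define b where "b = (\<lambda>n. a (r (r' n)))"
  have b: "b \<longlonglongrightarrow> l" using r'(2) by (simp add: b_def comp_def)
  have "?\<Delta> (b n) \<le> K / real (Suc n)" for n
  proof -
    have "n \<le> r (r' n)" using strict_mono_o[OF r(1) r'(1)] by (metis comp_apply seq_suble)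
    have "?\<Delta> (b n) \<le> K / real (Suc (r (r' n)))"
      using K(2)[of "r' n"] unfolding b_def by (simp add: pos_le_divide_eq mult.commute del: of_nat_Suc)
    also have "\<dots> \<le> K / real (Suc n)" using \<open>n \<le> r (r' n)\<close> K0 by (intro divide_left_mono) auto
    finally show ?thesis .
  qed
  moreover have "(\<lambda>n. K / real (Suc n)) \<longlonglongrightarrow> 0"
    using LIMSEQ_Suc[OF lim_const_over_n[of K]] by simp
  moreover have "(\<lambda>n. ?\<Delta> (b n)) \<longlonglongrightarrow> ?\<Delta> l"
    using b e by (intro tendsto_intros tendsto_powr') auto
  ultimately have "?\<Delta> l \<le> 0" by (intro LIMSEQ_le) auto
  then have "l = l - s" using powr_abs_midpoint_eq[OF e, of l "l - s"] by simp
  then show ?thesis by simp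
qed

section \<open>The modular of a bounded exponent and its norm\<close>

text \<open>An exponent bounded everywhere; exceptional null sets are treated by changing the exponent there.\<close>

locale nakano =
  fixes M :: "'a measure" and e :: "'a \<Rightarrow> real" and P :: real
  assumes e_measurable [measurable]: "e \<in> borel_measurable M"
    and e_ge: "1 \<le> e t" and e_le: "e t \<le> P"
begin

definition \<rho> :: "('a \<Rightarrow> real) \<Rightarrow> ennreal" where
  "\<rho> g = (\<integral>\<^sup>+t. ennreal (\<bar>g t\<bar> powr e t) \<partial>M)"

definition L :: "('a \<Rightarrow> real) set" where
  "L = {g \<in> borel_measurable M. \<exists>l>0. \<rho> (\<lambda>t. g t / l) < \<infinity>}"

definition N :: "('a \<Rightarrow> real) \<Rightarrow> real" where
  "N g = Inf {\<alpha>. \<alpha> > 0 \<and> \<rho> (\<lambda>t. g t / \<alpha>) \<le> 1}"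

lemma L_measurable: "g \<in> L \<Longrightarrow> g \<in> borel_measurable M"
  by (simp add: L_def)

lemma \<rho>_mono: "(\<And>t. \<bar>f t\<bar> \<le> \<bar>g t\<bar>) \<Longrightarrow> \<rho> f \<le> \<rho> g"
  unfolding \<rho>_def using e_ge by (intro nn_integral_mono ennreal_leI powr_mono2) (auto intro: order_trans[of 0 1])

lemma \<rho>_cong_AE: "AE t in M. f t = g t \<Longrightarrow> \<rho> f = \<rho> g"
  unfolding \<rho>_def by (rule nn_integral_cong_AE) auto

lemma \<rho>_convex:
  assumes [measurable]: "f \<in> borel_measurable M" "g \<in> borel_measurable M"
    and uv: "0 \<le> u" "0 \<le> v" "u + v = 1"
  shows "\<rho> (\<lambda>t. u * f t + v * g t) \<le> ennreal u * \<rho> f + ennreal v * \<rho> g"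
proof -
  have "\<rho> (\<lambda>t. u * f t + v * g t) \<le> (\<integral>\<^sup>+t. ennreal u * ennreal (\<bar>f t\<bar> powr e t) + ennreal v * ennreal (\<bar>g t\<bar> powr e t) \<partial>M)"
    unfolding \<rho>_def
  proof (rule nn_integral_mono)
    fix t
    have "ennreal (\<bar>u * f t + v * g t\<bar> powr e t) \<le> ennreal (u * \<bar>f t\<bar> powr e t + v * \<bar>g t\<bar> powr e t)"
      using powr_abs_convex[OF uv e_ge] by (rule ennreal_leI)
    then show "ennreal (\<bar>u * f t + v * g t\<bar> powr e t) \<le> ennreal u * ennreal (\<bar>f t\<bar> powr e t) + ennreal v * ennreal (\<bar>g t\<bar> powr e t)"
      using uv by (simp add: ennreal_mult' ennreal_plus)
  qed
  also have "\<dots> = ennreal u * \<rho> f + ennreal v * \<rho> g"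
    unfolding \<rho>_def by (simp add: nn_integral_add nn_integral_cmult)
  finally show ?thesis .
qed

lemma \<rho>_contract:
  assumes "f \<in> borel_measurable M" "0 \<le> c" "c \<le> 1"
  shows "\<rho> (\<lambda>t. c * f t) \<le> ennreal c * \<rho> f"
proof -
  have "\<rho> (\<lambda>t. 0) = 0" by (simp add: \<rho>_def)
  then show ?thesis using \<rho>_convex[of f "\<lambda>t. 0" c "1 - c"] assms by simp
qed

lemma \<rho>_contract_lower:
  assumes [measurable]: "f \<in> borel_measurable M" and c: "0 < c" "c \<le> 1"
  shows "ennreal (c powr P) * \<rho> f \<le> \<rho> (\<lambda>t. c * f t)"
proof -
  have "ennreal (c powr P) * \<rho> f = (\<integral>\<^sup>+t. ennreal (c powr P) * ennreal (\<bar>f t\<bar> powr e t) \<partial>M)"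
    unfolding \<rho>_def by (simp add: nn_integral_cmult)
  also have "\<dots> \<le> \<rho> (\<lambda>t. c * f t)"
    unfolding \<rho>_def
  proof (rule nn_integral_mono)
    fix t
    have "c powr P \<le> c powr e t" using c e_le by (intro powr_mono') auto
    then show "ennreal (c powr P) * ennreal (\<bar>f t\<bar> powr e t) \<le> ennreal (\<bar>c * f t\<bar> powr e t)"
      using c by (simp add: abs_mult powr_mult mult_right_mono flip: ennreal_mult')
  qed
  finally show ?thesis .
qed

lemma N_le: "0 < a \<Longrightarrow> \<rho> (\<lambda>t. g t / a) \<le> 1 \<Longrightarrow> N g \<le> a"
  unfolding N_def by (rule cInf_lower) (auto intro!: bdd_belowI[of _ 0])

lemma admissible_nonempty:
  assumes g: "g \<in> L" shows "{\<alpha>. \<alpha> > 0 \<and> \<rho> (\<lambda>t. g t / \<alpha>) \<le> 1} \<noteq> {}"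
proof -
  obtain l where l: "0 < l" "\<rho> (\<lambda>t. g t / l) < \<infinity>" using g by (auto simp: L_def)
  then obtain r where r: "0 \<le> r" "\<rho> (\<lambda>t. g t / l) = ennreal r"
    by (cases "\<rho> (\<lambda>t. g t / l)") auto
  have "\<rho> (\<lambda>t. (1 / (r + 1)) * (g t / l)) \<le> ennreal (1 / (r + 1)) * \<rho> (\<lambda>t. g t / l)"
    using r L_measurable[OF g] by (intro \<rho>_contract) auto
  also have "\<dots> = ennreal (r / (r + 1))" unfolding r(2) using r(1) by (simp flip: ennreal_mult')
  also have "\<dots> \<le> 1" using r(1) by simp
  finally have "\<rho> (\<lambda>t. g t / (l * (r + 1))) \<le> 1" by (simp add: field_simps)
  moreover have "0 < l * (r + 1)" using l r by simp
  ultimately show ?thesis by blast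
qed

lemma \<rho>_le:
  assumes g: "g \<in> L" and a: "N g < a" shows "\<rho> (\<lambda>t. g t / a) \<le> 1"
proof -
  obtain b where b: "0 < b" "\<rho> (\<lambda>t. g t / b) \<le> 1" "b < a"
    using a cInf_lessD[OF admissible_nonempty[OF g], of a] by (auto simp: N_def)
  have "\<rho> (\<lambda>t. g t / a) \<le> \<rho> (\<lambda>t. g t / b)"
    using b by (intro \<rho>_mono) (auto intro!: divide_left_mono)
  with b(2) show ?thesis by simp
qed

lemma N_nonneg: "g \<in> L \<Longrightarrow> 0 \<le> N g"
  unfolding N_def by (intro cInf_greatest admissible_nonempty) auto

text \<open>The infimum in the norm is attained, because dilation by \<open>b > 1\<close> multiplies the modular by at most
  \<open>b\<^sup>P\<close>, which tends to \<open>1\<close>.\<close>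

lemma \<rho>_le_unit:
  assumes g: "g \<in> L" and a: "0 < a" "N g \<le> a" shows "\<rho> (\<lambda>t. g t / a) \<le> 1"
proof -
  have *: "\<rho> (\<lambda>t. g t / a) \<le> ennreal (b powr P)" if b: "1 < b" for b
  proof -
    have [measurable]: "g \<in> borel_measurable M" by (rule L_measurable[OF g])
    have "N g < a * b" using a b by (metis le_less_trans less_eq_real_def mult.right_neutral mult_less_cancel_left_pos)
    then have "\<rho> (\<lambda>t. g t / (a * b)) \<le> 1" by (rule \<rho>_le[OF g])
    have "ennreal ((1 / b) powr P) * \<rho> (\<lambda>t. g t / a) \<le> \<rho> (\<lambda>t. (1 / b) * (g t / a))"
      using b by (intro \<rho>_contract_lower) auto
    also have "(\<lambda>t. (1 / b) * (g t / a)) = (\<lambda>t. g t / (a * b))" by (simp add: field_simps)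
    also have "\<rho> \<dots> \<le> 1" by fact
    finally have "ennreal (b powr P) * (ennreal ((1 / b) powr P) * \<rho> (\<lambda>t. g t / a)) \<le> ennreal (b powr P) * 1"
      by (intro mult_left_mono) auto
    moreover have "b powr P * (1 / b) powr P = 1" using b by (simp flip: powr_mult)
    then have "ennreal (b powr P) * ennreal ((1 / b) powr P) = 1" by (simp flip: ennreal_mult')
    ultimately show ?thesis by (simp add: mult.assoc[symmetric])
  qed
  have "(\<lambda>n. ennreal ((1 + 1 / real (Suc n)) powr P)) \<longlonglongrightarrow> ennreal ((1 + 0) powr P)"
    using LIMSEQ_Suc[OF lim_const_over_n[of 1]]
    by (intro tendsto_ennrealI tendsto_powr tendsto_add tendsto_const) auto
  then show ?thesis
    by (intro LIMSEQ_le_const[where X = "\<lambda>n. ennreal ((1 + 1 / real (Suc n)) powr P)"]) (auto intro!: *)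
qed

lemma N_triangle:
  assumes f: "f \<in> L" and g: "g \<in> L" shows "N (\<lambda>t. f t + g t) \<le> N f + N g"
proof (rule field_le_epsilon)
  fix \<epsilon> :: real assume \<epsilon>: "0 < \<epsilon>"
  define a b where "a = N f + \<epsilon> / 2" "b = N g + \<epsilon> / 2"
  have ab: "N f < a" "N g < b" "0 < a" "0 < b" using \<epsilon> N_nonneg[OF f] N_nonneg[OF g] by (auto simp: a_b_def)
  have "\<rho> (\<lambda>t. (f t + g t) / (a + b)) = \<rho> (\<lambda>t. (a / (a + b)) * (f t / a) + (b / (a + b)) * (g t / b))"
    using ab by (simp add: add_divide_distrib)
  also have "\<dots> \<le> ennreal (a / (a + b)) * \<rho> (\<lambda>t. f t / a) + ennreal (b / (a + b)) * \<rho> (\<lambda>t. g t / b)"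
    using ab f g by (intro \<rho>_convex) (auto simp: L_def add_divide_distrib[symmetric])
  also have "\<dots> \<le> ennreal (a / (a + b)) * 1 + ennreal (b / (a + b)) * 1"
    using \<rho>_le[OF f ab(1)] \<rho>_le[OF g ab(2)] by (intro add_mono mult_left_mono) auto
  also have "\<dots> = 1" using ab by (simp add: add_divide_distrib[symmetric] flip: ennreal_plus)
  finally have "N (\<lambda>t. f t + g t) \<le> a + b" using ab by (intro N_le) auto
  then show "N (\<lambda>t. f t + g t) \<le> N f + N g + \<epsilon>" by (simp add: a_b_def)
qed

lemma N_zero: "N (\<lambda>t. 0) = 0"
proof -
  have "\<rho> (\<lambda>t. 0 / a) = 0" for a by (simp add: \<rho>_def)
  then have "N (\<lambda>t. 0) \<le> a" if "0 < a" for a using that N_le[of a "\<lambda>t. 0"] by simp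
  moreover have "(\<lambda>t. 0) \<in> L" by (auto simp: L_def \<rho>_def intro!: exI[of _ 1])
  ultimately show ?thesis by (intro antisym[OF dense_ge N_nonneg])
qed

lemma scale_in_L:
  assumes "f \<in> L" shows "(\<lambda>t. c * f t) \<in> L"
proof (cases "c = 0")
  case True
  then show ?thesis by (auto simp: L_def \<rho>_def intro!: exI[of _ 1])
next
  case False
  obtain l where l: "0 < l" "\<rho> (\<lambda>t. f t / l) < \<infinity>" using assms by (auto simp: L_def)
  have "\<rho> (\<lambda>t. c * f t / (\<bar>c\<bar> * l)) \<le> \<rho> (\<lambda>t. f t / l)"
    using False by (intro \<rho>_mono) (simp add: abs_mult)
  with l False assms show ?thesis
    by (auto simp: L_def intro!: exI[of _ "\<bar>c\<bar> * l"])
qed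

lemma N_scale:
  assumes f: "f \<in> L" shows "N (\<lambda>t. c * f t) = \<bar>c\<bar> * N f"
proof (cases "c = 0")
  case True
  then show ?thesis by (simp add: N_zero)
next
  case False
  have le: "N (\<lambda>t. c * f t) \<le> \<bar>c\<bar> * N f" if c: "c \<noteq> 0" and f: "f \<in> L" for c f
  proof -
    have "N (\<lambda>t. c * f t) / \<bar>c\<bar> \<le> a" if "N f < a" for a
    proof -
      have "\<rho> (\<lambda>t. c * f t / (\<bar>c\<bar> * a)) \<le> \<rho> (\<lambda>t. f t / a)"
        using c by (intro \<rho>_mono) (simp add: abs_mult)
      also have "\<dots> \<le> 1" by (rule \<rho>_le[OF f that])
      finally have "N (\<lambda>t. c * f t) \<le> \<bar>c\<bar> * a" using c that N_nonneg[OF f] by (intro N_le) auto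
      then show ?thesis using c by (simp add: field_simps)
    qed
    then have "N (\<lambda>t. c * f t) / \<bar>c\<bar> \<le> N f" by (rule dense_ge)
    then show ?thesis using c by (simp add: field_simps)
  qed
  have "N (\<lambda>t. (1 / c) * (c * f t)) \<le> \<bar>1 / c\<bar> * N (\<lambda>t. c * f t)"
    using False by (intro le scale_in_L f) auto
  then have "\<bar>c\<bar> * N f \<le> N (\<lambda>t. c * f t)" using False by (simp add: field_simps)
  with le[OF False f] show ?thesis by simp
qed

lemma N_cong_AE:
  assumes "AE t in M. f t = g t" shows "N f = N g"
proof -
  have "\<rho> (\<lambda>t. f t / \<alpha>) = \<rho> (\<lambda>t. g t / \<alpha>)" for \<alpha> using assms by (intro \<rho>_cong_AE) auto
  then show ?thesis by (simp add: N_def)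
qed

lemma N_eq_0:
  assumes f: "f \<in> L" and "N f = 0" shows "AE t in M. f t = 0"
proof -
  have [measurable]: "f \<in> borel_measurable M" by (rule L_measurable[OF f])
  have "\<rho> f \<le> ennreal a" if a: "0 < a" "a \<le> 1" for a
  proof -
    have "\<rho> (\<lambda>t. a * (f t / a)) \<le> ennreal a * \<rho> (\<lambda>t. f t / a)" using a by (intro \<rho>_contract) auto
    also have "\<dots> \<le> ennreal a * 1" using a assms by (intro mult_left_mono \<rho>_le) auto
    finally show ?thesis using a by simp
  qed
  then have "\<rho> f \<le> ennreal (1 / real (Suc n))" for n by simp
  moreover have "(\<lambda>n. ennreal (1 / real (Suc n))) \<longlonglongrightarrow> ennreal 0"
    using LIMSEQ_Suc[OF lim_const_over_n[of 1]] by (intro tendsto_ennrealI) simp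
  ultimately have "\<rho> f \<le> ennreal 0" by (intro LIMSEQ_le_const) auto
  then have "AE t in M. ennreal (\<bar>f t\<bar> powr e t) = 0"
    unfolding \<rho>_def by (subst (asm) ennreal_0) (simp add: nn_integral_0_iff_AE)
  then show ?thesis by eventually_elim simp
qed

definition \<Omega>\<^sub>1 :: "'a set" where "\<Omega>\<^sub>1 = {t \<in> space M. e t = 1}"

lemma \<Omega>\<^sub>1_sets [measurable]: "\<Omega>\<^sub>1 \<in> sets M"
  unfolding \<Omega>\<^sub>1_def by measurable

lemma L_integrable:
  assumes f: "f \<in> L"
  shows "integrable (restrict_space M \<Omega>\<^sub>1) f" "(\<integral>t. \<bar>f t\<bar> \<partial>restrict_space M \<Omega>\<^sub>1) \<le> N f"
proof -
  have [measurable]: "f \<in> borel_measurable M" by (rule L_measurable[OF f])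
  have *: "(\<integral>\<^sup>+t. ennreal \<bar>f t\<bar> \<partial>restrict_space M \<Omega>\<^sub>1) \<le> ennreal a" if a: "N f < a" for a
  proof -
    have a0: "0 < a" using a N_nonneg[OF f] by simp
    have "(\<integral>\<^sup>+t. ennreal \<bar>f t\<bar> \<partial>restrict_space M \<Omega>\<^sub>1) = (\<integral>\<^sup>+t. ennreal \<bar>f t\<bar> * indicator \<Omega>\<^sub>1 t \<partial>M)"
      by (simp add: nn_integral_restrict_space)
    also have "\<dots> \<le> (\<integral>\<^sup>+t. ennreal a * ennreal (\<bar>f t / a\<bar> powr e t) \<partial>M)"
      using a0 by (intro nn_integral_mono) (auto simp: \<Omega>\<^sub>1_def indicator_def simp flip: ennreal_mult')
    also have "\<dots> = ennreal a * \<rho> (\<lambda>t. f t / a)" unfolding \<rho>_def by (simp add: nn_integral_cmult)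
    also have "\<dots> \<le> ennreal a * 1" by (intro mult_left_mono \<rho>_le f a) auto
    finally show ?thesis by simp
  qed
  show int: "integrable (restrict_space M \<Omega>\<^sub>1) f"
    using *[of "N f + 1"] by (intro integrableI_bounded) (auto simp: measurable_restrict_space1 intro: le_less_trans)
  show "(\<integral>t. \<bar>f t\<bar> \<partial>restrict_space M \<Omega>\<^sub>1) \<le> N f"
  proof (rule dense_ge)
    fix a assume a: "N f < a"
    then have "0 \<le> a" using N_nonneg[OF f] by simp
    then show "(\<integral>t. \<bar>f t\<bar> \<partial>restrict_space M \<Omega>\<^sub>1) \<le> a"
      using *[OF a] int by (subst (asm) nn_integral_eq_integral) auto
  qed
qed

text \<open>Where the exponent is \<open>1\<close> the modular is homogeneous, and the infimum in the norm is explicit.\<close>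

lemma N_eq_L1_norm:
  assumes f: "f \<in> L" and supp: "AE t in M. e t > 1 \<longrightarrow> f t = 0"
  shows "N f = (\<integral>t. \<bar>f t\<bar> \<partial>restrict_space M \<Omega>\<^sub>1)"
proof (rule antisym[OF dense_ge L_integrable(2)[OF f]])
  have [measurable]: "f \<in> borel_measurable M" by (rule L_measurable[OF f])
  fix a assume a: "(\<integral>t. \<bar>f t\<bar> \<partial>restrict_space M \<Omega>\<^sub>1) < a"
  have "0 \<le> (\<integral>t. \<bar>f t\<bar> \<partial>restrict_space M \<Omega>\<^sub>1)" by simp
  with a have a0: "0 < a" by linarith
  have "ennreal a * \<rho> (\<lambda>t. f t / a) = (\<integral>\<^sup>+t. ennreal a * ennreal (\<bar>f t / a\<bar> powr e t) \<partial>M)"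
    unfolding \<rho>_def by (simp add: nn_integral_cmult)
  also have "\<dots> = (\<integral>\<^sup>+t. ennreal \<bar>f t\<bar> * indicator \<Omega>\<^sub>1 t \<partial>M)"
  proof (rule nn_integral_cong_AE)
    show "AE t in M. ennreal a * ennreal (\<bar>f t / a\<bar> powr e t) = ennreal \<bar>f t\<bar> * indicator \<Omega>\<^sub>1 t"
      using supp AE_space
    proof eventually_elim
      case (elim t)
      show ?case
      proof (cases "e t = 1")
        case True
        then show ?thesis using elim a0 by (simp add: \<Omega>\<^sub>1_def flip: ennreal_mult')
      next
        case False
        then have "1 < e t" using e_ge[of t] by simp
        then show ?thesis using elim by (simp add: \<Omega>\<^sub>1_def)
      qed
    qed
  qed
  also have "\<dots> = (\<integral>\<^sup>+t. ennreal \<bar>f t\<bar> \<partial>restrict_space M \<Omega>\<^sub>1)" by (simp add: nn_integral_restrict_space)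
  also have "\<dots> = ennreal (\<integral>t. \<bar>f t\<bar> \<partial>restrict_space M \<Omega>\<^sub>1)"
    using L_integrable(1)[OF f] by (intro nn_integral_eq_integral) auto
  also have "\<dots> \<le> ennreal a" using a by (intro ennreal_leI) simp
  finally have "ennreal (1 / a) * (ennreal a * \<rho> (\<lambda>t. f t / a)) \<le> ennreal (1 / a) * ennreal a"
    by (intro mult_left_mono) auto
  then have "\<rho> (\<lambda>t. f t / a) \<le> 1"
    using a0 by (simp add: mult.assoc[symmetric] flip: ennreal_mult')
  then show "N f \<le> a" by (rule N_le[OF a0])
qed

text \<open>Strict convexity of \<open>x \<mapsto> |x|\<^sup>p\<close> for \<open>p > 1\<close>: the convexity defects of the modular
  tend to \<open>0\<close>, so Fatou's lemma, applied to defects with large factors, makes them vanish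
  in the limit along a subsequence that depends on the point.\<close>

lemma asymptotically_flat_agree:
  assumes d: "0 < d" and L: "\<And>n. (\<lambda>t. z n t - w t) \<in> L" "\<And>n. (\<lambda>t. z n t - w' t) \<in> L"
      "\<And>n. (\<lambda>t. z n t - (w t + w' t) / 2) \<in> L"
    and le: "\<And>n. N (\<lambda>t. z n t - w t) \<le> d" "\<And>n. N (\<lambda>t. z n t - w' t) \<le> d"
    and mid: "\<And>\<epsilon>. 0 < \<epsilon> \<Longrightarrow> \<exists>n. d * (1 - \<epsilon>) < N (\<lambda>t. z n t - (w t + w' t) / 2)"
  shows "AE t in M. e t > 1 \<longrightarrow> w t = w' t"
proof -
  define a where "a = (\<lambda>n t. (z n t - w t) / d)"
  define s where "s = (\<lambda>t. (w' t - w t) / d)"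
  define \<Delta> where "\<Delta> = (\<lambda>n t. (\<bar>a n t\<bar> powr e t + \<bar>a n t - s t\<bar> powr e t) / 2 - \<bar>(a n t + (a n t - s t)) / 2\<bar> powr e t)"
  have as: "a n t - s t = (z n t - w' t) / d" for n t by (simp add: a_def s_def diff_divide_distrib)
  have am: "(a n t + (a n t - s t)) / 2 = (z n t - (w t + w' t) / 2) / d" for n t
    unfolding as using d by (simp add: a_def field_simps)
  have [measurable]: "a n \<in> borel_measurable M" "s \<in> borel_measurable M" for n
  proof -
    have "(\<lambda>t. (z n t - w t) - (z n t - w' t)) \<in> borel_measurable M"
      using L_measurable[OF L(1)] L_measurable[OF L(2)] by measurable
    then show "s \<in> borel_measurable M" unfolding s_def by (intro borel_measurable_divide) (auto simp: algebra_simps)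
    show "a n \<in> borel_measurable M" unfolding a_def using L_measurable[OF L(1)] by measurable
  qed
  have \<Delta>_nonneg: "0 \<le> \<Delta> n t" for n t
    using powr_abs_convex[of "1/2" "1/2" "e t" "a n t" "a n t - s t"] e_ge[of t] by (simp add: \<Delta>_def field_simps)
  have [measurable]: "\<Delta> n \<in> borel_measurable M" for n unfolding \<Delta>_def by measurable
  have \<rho>1: "\<rho> (a n) \<le> 1" "\<rho> (\<lambda>t. a n t - s t) \<le> 1" for n
    unfolding as using \<rho>_le_unit[OF L(1) d le(1)] \<rho>_le_unit[OF L(2) d le(2)] by (simp_all add: a_def)
  have defect: "\<exists>n. (\<integral>\<^sup>+t. ennreal (\<Delta> n t) \<partial>M) \<le> ennreal \<epsilon>" if \<epsilon>: "0 < \<epsilon>" for \<epsilon>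
  proof -
    have "\<exists>c. 0 < c \<and> c < 1 \<and> 1 - \<epsilon> \<le> c powr P"
    proof -
      have "(\<lambda>n. (1 - 1 / real (Suc (Suc n))) powr P) \<longlonglongrightarrow> (1 - 0) powr P"
        using LIMSEQ_Suc[OF LIMSEQ_Suc[OF lim_const_over_n[of 1]]] by (intro tendsto_powr tendsto_diff tendsto_const) auto
      then have "\<forall>\<^sub>F n in sequentially. 1 - \<epsilon> < (1 - 1 / real (Suc (Suc n))) powr P"
        using \<epsilon> by (intro order_tendstoD(1)) auto
      then obtain n where "1 - \<epsilon> < (1 - 1 / real (Suc (Suc n))) powr P"
        unfolding eventually_sequentially by blast
      then show ?thesis by (intro exI[of _ "1 - 1 / real (Suc (Suc n))"]) (auto simp: field_simps)
    qed
    then obtain c where c: "0 < c" "c < 1" "1 - \<epsilon> \<le> c powr P" by blast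
    obtain n where n: "d * c < N (\<lambda>t. z n t - (w t + w' t) / 2)" using mid[of "1 - c"] c by auto
    let ?m = "\<lambda>t. (a n t + (a n t - s t)) / 2"
    have "\<not> \<rho> (\<lambda>t. (z n t - (w t + w' t) / 2) / (d * c)) \<le> 1"
      using n d c N_le[of "d * c" "\<lambda>t. z n t - (w t + w' t) / 2"] by auto
    then have "1 \<le> \<rho> (\<lambda>t. ?m t / c)" unfolding am by simp
    then have "ennreal (c powr P) * 1 \<le> ennreal (c powr P) * \<rho> (\<lambda>t. ?m t / c)" by (rule mult_left_mono) simp
    also have "\<dots> \<le> \<rho> (\<lambda>t. c * (?m t / c))" using c by (intro \<rho>_contract_lower) auto
    finally have "ennreal (c powr P) \<le> \<rho> ?m" using c by simp
    then have low: "ennreal (1 - \<epsilon>) \<le> \<rho> ?m" using c(3) by (meson ennreal_leI order_trans)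
    have "(\<integral>\<^sup>+t. ennreal (\<Delta> n t) \<partial>M) + \<rho> ?m = (\<integral>\<^sup>+t. ennreal (\<Delta> n t) + ennreal (\<bar>?m t\<bar> powr e t) \<partial>M)"
      unfolding \<rho>_def by (subst nn_integral_add) auto
    also have "\<dots> = (\<integral>\<^sup>+t. ennreal (1/2) * ennreal (\<bar>a n t\<bar> powr e t) + ennreal (1/2) * ennreal (\<bar>a n t - s t\<bar> powr e t) \<partial>M)"
    proof (rule nn_integral_cong)
      fix t
      have "ennreal (\<Delta> n t) + ennreal (\<bar>?m t\<bar> powr e t) = ennreal (\<Delta> n t + \<bar>?m t\<bar> powr e t)"
        using \<Delta>_nonneg by (simp add: ennreal_plus)
      also have "\<Delta> n t + \<bar>?m t\<bar> powr e t = 1/2 * \<bar>a n t\<bar> powr e t + 1/2 * \<bar>a n t - s t\<bar> powr e t" by (simp add: \<Delta>_def)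
      finally show "ennreal (\<Delta> n t) + ennreal (\<bar>?m t\<bar> powr e t) =
          ennreal (1/2) * ennreal (\<bar>a n t\<bar> powr e t) + ennreal (1/2) * ennreal (\<bar>a n t - s t\<bar> powr e t)"
        by (simp only: ennreal_mult' [symmetric] ennreal_plus [symmetric] powr_ge_zero mult_nonneg_nonneg
            zero_le_divide_1_iff zero_le_numeral)
    qed
    also have "\<dots> = ennreal (1/2) * \<rho> (a n) + ennreal (1/2) * \<rho> (\<lambda>t. a n t - s t)"
      unfolding \<rho>_def by (simp add: nn_integral_add nn_integral_cmult)
    also have "\<dots> \<le> ennreal (1/2) * 1 + ennreal (1/2) * 1"
      using \<rho>1 by (intro add_mono mult_left_mono) auto
    also have "\<dots> = ennreal (1/2 + 1/2)" unfolding mult_1_right by (rule ennreal_plus[symmetric]) auto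
    also have "\<dots> = 1" by simp
    finally have sum: "(\<integral>\<^sup>+t. ennreal (\<Delta> n t) \<partial>M) + \<rho> ?m \<le> 1" .
    have "(\<integral>\<^sup>+t. ennreal (\<Delta> n t) \<partial>M) + ennreal (1 - \<epsilon>) \<le> 1"
      using order_trans[OF add_left_mono[OF low] sum] .
    also have "1 \<le> ennreal \<epsilon> + ennreal (1 - \<epsilon>)"
      using \<epsilon> by (cases "\<epsilon> \<le> 1") (auto simp flip: ennreal_plus simp: ennreal_neg)
    finally have "(\<integral>\<^sup>+t. ennreal (\<Delta> n t) \<partial>M) \<le> ennreal \<epsilon>"
      by (simp add: add.commute[of _ "ennreal (1 - \<epsilon>)"] ennreal_add_left_cancel_le)
    then show ?thesis by blast
  qed
  have "\<forall>k. \<exists>n. (\<integral>\<^sup>+t. ennreal (\<Delta> n t) \<partial>M) \<le> ennreal (1 / real (Suc k))" using defect by simp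
  then obtain r where r: "\<And>k. (\<integral>\<^sup>+t. ennreal (\<Delta> (r k) t) \<partial>M) \<le> ennreal (1 / real (Suc k))" by metis
  \<comment> \<open>The factor \<open>k + 1\<close> costs at most \<open>1\<close> in the integral and makes the defects tend to \<open>0\<close> wherever the lower
    limit is finite.\<close>
  define g where "g = (\<lambda>k t. \<bar>a (r k) t\<bar> powr e t + real (Suc k) * \<Delta> (r k) t)"
  have [measurable]: "g k \<in> borel_measurable M" for k unfolding g_def by measurable
  have g: "(\<integral>\<^sup>+t. ennreal (g k t) \<partial>M) \<le> 2" for k
  proof -
    have "(\<integral>\<^sup>+t. ennreal (g k t) \<partial>M) = (\<integral>\<^sup>+t. ennreal (\<bar>a (r k) t\<bar> powr e t) + ennreal (real (Suc k)) * ennreal (\<Delta> (r k) t) \<partial>M)"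
      using \<Delta>_nonneg by (intro nn_integral_cong) (simp add: g_def ennreal_plus ennreal_mult' del: of_nat_Suc)
    also have "\<dots> = \<rho> (a (r k)) + ennreal (real (Suc k)) * (\<integral>\<^sup>+t. ennreal (\<Delta> (r k) t) \<partial>M)"
      unfolding \<rho>_def by (simp add: nn_integral_add nn_integral_cmult del: of_nat_Suc)
    also have "\<dots> \<le> 1 + ennreal (real (Suc k)) * ennreal (1 / real (Suc k))"
      by (intro add_mono \<rho>1 mult_left_mono r) auto
    also have "\<dots> = 2" by (simp del: of_nat_Suc flip: ennreal_mult')
    finally show ?thesis .
  qed
  have "(\<integral>\<^sup>+t. liminf (\<lambda>k. ennreal (g k t)) \<partial>M) \<le> liminf (\<lambda>k. \<integral>\<^sup>+t. ennreal (g k t) \<partial>M)"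
    by (intro nn_integral_liminf) auto
  also have "\<dots> \<le> 2" using g by (intro Liminf_le) (auto intro!: always_eventually)
  finally have "(\<integral>\<^sup>+t. liminf (\<lambda>k. ennreal (g k t)) \<partial>M) \<noteq> \<infinity>" by (auto simp: top_unique)
  then have "AE t in M. liminf (\<lambda>k. ennreal (g k t)) \<noteq> \<infinity>"
    by (intro nn_integral_PInf_AE) auto
  then show ?thesis
  proof eventually_elim
    case (elim t)
    show ?case
    proof
      assume e: "1 < e t"
      obtain c where c: "0 \<le> c" "liminf (\<lambda>k. ennreal (g k t)) = ennreal c"
        using elim by (cases "liminf (\<lambda>k. ennreal (g k t))") auto
      define K where "K = c + 1"
      have K: "liminf (\<lambda>k. ennreal (g k t)) < ennreal K" "0 \<le> K"
        using c by (auto simp: K_def ennreal_less_iff)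
      have "\<exists>\<^sub>F k in sequentially. ennreal (g k t) \<le> ennreal K"
      proof (rule ccontr)
        assume "\<not> ?thesis"
        then have "\<forall>\<^sub>F k in sequentially. ennreal K \<le> ennreal (g k t)"
          unfolding not_frequently by (auto elim!: eventually_mono)
        then have "ennreal K \<le> liminf (\<lambda>k. ennreal (g k t))" by (rule Liminf_bounded)
        with K show False by simp
      qed
      then have "\<exists>\<^sub>F k in sequentially. g k t \<le> K" by (rule frequently_elim1) (simp add: K(2) ennreal_le_iff)
      then have "s t = 0" unfolding g_def \<Delta>_def by (rule convexity_defect_limit[OF e, rotated -1])
      then show "w t = w' t" using d by (simp add: s_def)
    qed
  qed
qed

end

section \<open>Fixed points in reflexive spaces of functions\<close>

locale nakano_subspace = nakano M e P + reflexive_seminormed q S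
  for M :: "'a measure" and e P and q and S :: "('a \<Rightarrow> real) set" +
  assumes sigma_finite: "sigma_finite_measure M"
    and S_L: "S \<subseteq> L" and q_eq_N: "f \<in> S \<Longrightarrow> q f = N f"
begin

text \<open>Differences of points of a minimal set vanish where the exponent exceeds \<open>1\<close>. On the remaining set,
  concentration of such differences contradicts uniform integrability.\<close>

lemma fixed_point_up_to_norm:
  assumes C: "C \<noteq> {}" "convex C" "q_closed C" "\<And>x. x \<in> C \<Longrightarrow> T x \<in> C" and bounded: "\<And>x. x \<in> C \<Longrightarrow> q x \<le> r"
    and nonexpansive: "\<And>x y. x \<in> C \<Longrightarrow> y \<in> C \<Longrightarrow> q (T x - T y) \<le> q (x - y)"
  shows "\<exists>x\<in>C. q (T x - x) = 0"
proof (rule ccontr)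
  assume no_fixed: "\<not> ?thesis"
  obtain D where D: "D \<noteq> {}" "D \<subseteq> C" "convex D" "q_closed D" "\<And>x. x \<in> D \<Longrightarrow> T x \<in> D"
    "\<And>E. E \<subseteq> D \<Longrightarrow> E \<noteq> {} \<Longrightarrow> convex E \<Longrightarrow> q_closed E \<Longrightarrow> (\<And>x. x \<in> E \<Longrightarrow> T x \<in> E) \<Longrightarrow> E = D"
    using minimal_invariant_set[where C = C and T = T, OF C bounded] by metis
  have DS: "D \<subseteq> S" using D(4) by (simp add: q_closed_def)
  let ?I = "(\<lambda>(x, y). q (x - y)) ` (D \<times> D)"
  define d where "d = Sup ?I"
  have "q (x - y) \<le> 2 * r" if "x \<in> D" "y \<in> D" for x y
  proof -
    have "x \<in> C" "y \<in> C" using that D(2) by auto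
    then show ?thesis using q_triangle[of x "- y"] bounded[of x] bounded[of y] by simp
  qed
  then have bdd: "bdd_above ?I" by (auto intro!: bdd_aboveI)
  have d_ge: "q (x - y) \<le> d" if "x \<in> D" "y \<in> D" for x y
    unfolding d_def using that by (intro cSup_upper bdd) auto
  interpret minimal_invariant q S T D d
  proof
    show "\<exists>x\<in>D. \<exists>y\<in>D. r < q (x - y)" if "r < d" for r
    proof -
      have "?I \<noteq> {}" using D(1) by auto
      then have "\<exists>a\<in>?I. r < a" using less_cSup_iff[OF _ bdd] that by (auto simp: d_def)
      then show ?thesis by auto
    qed
    obtain x where x: "x \<in> D" using D(1) by blast
    then have "0 < q (T x - x)" using no_fixed D(2) q_nonneg[of "T x - x"] by (metis less_eq_real_def subsetD)
    then show "0 < d" using d_ge[OF D(5)[OF x] x] by simp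
    show "E = D" if "E \<subseteq> D" "E \<noteq> {}" "convex E" "q_closed E" "\<And>x. x \<in> E \<Longrightarrow> T x \<in> E" for E
      by (rule D(6)[OF that])
    show "D \<noteq> {}" "convex D" "q_closed D" by fact+
    show "T x \<in> D" if "x \<in> D" for x using D(5)[OF that] .
    show "q (T x - T y) \<le> q (x - y)" if "x \<in> D" "y \<in> D" for x y
      using that D(2) by (intro nonexpansive) auto
    show "q (x - y) \<le> d" if "x \<in> D" "y \<in> D" for x y using d_ge[OF that] .
  qed
  have DL: "x \<in> D \<Longrightarrow> x \<in> L" for x using DS S_L by blast
  have diff_S: "x - y \<in> S" if "x \<in> D" "y \<in> D" for x y
    using subspace that DS by (intro subspace_diff) auto
  have agree: "AE t in M. e t > 1 \<longrightarrow> w t = w' t" if w: "w \<in> D" "w' \<in> D" for w w'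
  proof -
    define m where "m = (1/2) *\<^sub>R w + (1/2) *\<^sub>R w'"
    have mD: "m \<in> D" unfolding m_def using w by (intro D_combination) auto
    have "\<exists>z. z \<in> approx_fixed (1 / real (Suc n))" for n
      using approx_fixed_nonempty[of "1 / real (Suc n)"] by auto
    then obtain z where z: "\<And>n. z n \<in> approx_fixed (1 / real (Suc n))" by metis
    have zD: "z n \<in> D" for n using z by (rule approx_fixed_D)
    have diff: "(\<lambda>t. z n t - w t) = z n - w" "(\<lambda>t. z n t - w' t) = z n - w'"
      "(\<lambda>t. z n t - (w t + w' t) / 2) = z n - m" for n
      by (auto simp: m_def fun_diff_def add_divide_distrib)
    have N: "N (z n - x) = q (z n - x)" if "x \<in> D" for n x using q_eq_N[OF diff_S[OF zD that]] by simp
    show ?thesis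
    proof (rule asymptotically_flat_agree[OF diameter_pos, of z w w'], unfold diff)
      show "z n - w \<in> L" "z n - w' \<in> L" "z n - m \<in> L" for n
        using diff_S[OF zD] w mD S_L by blast+
      show "N (z n - w) \<le> d" "N (z n - w') \<le> d" for n
        using N w diameter_le zD by simp_all
      fix \<epsilon> :: real assume \<epsilon>: "0 < \<epsilon>"
      have "d * (1 - \<epsilon>) < d" using \<epsilon> diameter_pos by (simp add: algebra_simps)
      from approx_fixed_far[OF mD this] obtain \<delta> where \<delta>: "0 < \<delta>" "\<forall>z\<in>approx_fixed \<delta>. d * (1 - \<epsilon>) < q (z - m)" by blast
      obtain n where "1 / real (Suc n) < \<delta>" using nat_approx_posE[OF \<delta>(1)] by blast
      then have "z n \<in> approx_fixed \<delta>" using z[of n] approx_fixed_mono[of "1 / real (Suc n)" \<delta>] by auto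
      with \<delta>(2) N[OF mD, of n] show "\<exists>n. d * (1 - \<epsilon>) < N (z n - m)" by (intro exI[of _ n]) simp
    qed
  qed
  let ?M = "restrict_space M \<Omega>\<^sub>1"
  have q_L1: "q (x - y) = (\<integral>t. \<bar>x t - y t\<bar> \<partial>?M)" if xy: "x \<in> D" "y \<in> D" for x y
  proof -
    have "x - y \<in> L" using diff_S[OF xy] S_L by blast
    moreover have "AE t in M. e t > 1 \<longrightarrow> (x - y) t = 0"
      using agree[OF xy] by eventually_elim simp
    ultimately show ?thesis using N_eq_L1_norm[of "x - y"] q_eq_N[OF diff_S[OF xy]] by simp
  qed
  \<comment> \<open>A strictly positive integrable function, from \<open>\<sigma>\<close>-finiteness.\<close>
  obtain h0 where h0: "h0 \<in> borel_measurable M" "integral\<^sup>N M h0 \<noteq> \<infinity>" "\<And>t. t \<in> space M \<Longrightarrow> 0 < h0 t \<and> h0 t < \<infinity>"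
    using sigma_finite_measure.Ex_finite_integrable_function[OF sigma_finite] by blast
  define h where "h = (\<lambda>t. enn2real (h0 t))"
  have "integrable M h"
  proof (rule integrableI_bounded)
    show "h \<in> borel_measurable M" using h0(1) unfolding h_def by measurable
    have "(\<integral>\<^sup>+t. ennreal (norm (h t)) \<partial>M) = integral\<^sup>N M h0"
      using h0(3) by (intro nn_integral_cong) (auto simp: h_def less_top)
    then show "(\<integral>\<^sup>+t. ennreal (norm (h t)) \<partial>M) < \<infinity>" using h0(2) by (simp add: less_top)
  qed
  then have h_int: "integrable ?M h"
    using integrable_mult_indicator[OF \<Omega>\<^sub>1_sets, of h] by (subst integrable_restrict_space) auto
  have h_pos: "0 < h t" if "t \<in> space ?M" for t
    using h0(3)[of t] that by (auto simp: h_def \<Omega>\<^sub>1_def space_restrict_space enn2real_positive_iff less_top)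
  interpret L1: reflexive_L1_bounded q S ?M h
  proof
    show "integrable ?M f" "(\<integral>t. \<bar>f t\<bar> \<partial>?M) \<le> q f" if "f \<in> S" for f
      using L_integrable[of f] S_L that q_eq_N[OF that] by auto
  qed (fact h_int h_pos)+
  interpret L1': L1_approx_fixed ?M h D approx_fixed d
  proof
    show "integrable ?M x" if "x \<in> D" for x using L_integrable(1)[OF DL[OF that]] .
    show "(\<lambda>t. (x t + y t) / 2) \<in> D" if "x \<in> D" "y \<in> D" for x y
    proof -
      have "(\<lambda>t. (x t + y t) / 2) = (1/2) *\<^sub>R x + (1/2) *\<^sub>R y" by (auto simp: fun_eq_iff add_divide_distrib)
      then show ?thesis using D_combination[OF that, of "1/2" "1/2"] by simp
    qed
    show "(\<integral>t. \<bar>x t - y t\<bar> \<partial>?M) \<le> d" if "x \<in> D" "y \<in> D" for x y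
      using diameter_le[OF that] q_L1[OF that] by simp
    show "approx_fixed \<delta> \<subseteq> D" for \<delta> using approx_fixed_D by blast
    show "\<exists>\<delta>>0. \<forall>z\<in>approx_fixed \<delta>. r < (\<integral>t. \<bar>z t - w t\<bar> \<partial>?M)" if "w \<in> D" "r < d" for w r
      using approx_fixed_far[OF that] q_L1[OF approx_fixed_D that(1)] by metis
    fix n :: nat and \<delta> :: real assume "1 \<le> n" "0 < \<delta>"
    then obtain \<delta>' where \<delta>': "0 < \<delta>'" "\<forall>x\<in>approx_fixed \<delta>'. \<forall>y\<in>approx_fixed \<delta>'. joined n \<delta> x y"
      using approx_fixed_joined by blast
    show "\<exists>\<delta>'>0. \<forall>x\<in>approx_fixed \<delta>'. \<forall>y\<in>approx_fixed \<delta>'. \<exists>z::nat \<Rightarrow> 'a \<Rightarrow> real.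
      z 0 = x \<and> z n = y \<and> (\<forall>i\<le>n. z i \<in> approx_fixed \<delta>) \<and>
      (\<forall>i<n. (\<integral>t. \<bar>z i t - z (Suc i) t\<bar> \<partial>?M) \<le> (\<integral>t. \<bar>x t - y t\<bar> \<partial>?M) / n + \<delta>)"
    proof (intro exI[of _ \<delta>'] conjI ballI \<delta>'(1))
      fix x y assume xy: "x \<in> approx_fixed \<delta>'" "y \<in> approx_fixed \<delta>'"
      then obtain z where z: "z 0 = x" "z n = y" "\<forall>i\<le>n. z i \<in> approx_fixed \<delta>"
        "\<forall>i<n. q (z i - z (Suc i)) \<le> q (x - y) / n + \<delta>"
        using \<delta>'(2) unfolding joined_def by blast
      have "(\<integral>t. \<bar>z i t - z (Suc i) t\<bar> \<partial>?M) \<le> (\<integral>t. \<bar>x t - y t\<bar> \<partial>?M) / n + \<delta>" if "i < n" for i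
      proof -
        have "z i \<in> D" "z (Suc i) \<in> D" "x \<in> D" "y \<in> D"
          using z(3) that xy by (meson approx_fixed_D Suc_leI less_imp_le)+
        then show ?thesis using z(4)[rule_format, OF that] q_L1[of "z i" "z (Suc i)"] q_L1[of x y] by simp
      qed
      with z show "\<exists>z::nat \<Rightarrow> 'a \<Rightarrow> real. z 0 = x \<and> z n = y \<and> (\<forall>i\<le>n. z i \<in> approx_fixed \<delta>) \<and>
          (\<forall>i<n. (\<integral>t. \<bar>z i t - z (Suc i) t\<bar> \<partial>?M) \<le> (\<integral>t. \<bar>x t - y t\<bar> \<partial>?M) / n + \<delta>)"
        by blast
    qed
  qed (use diameter_pos approx_fixed_mono approx_fixed_nonempty in auto)
  obtain \<delta> where \<delta>: "0 < \<delta>" "\<And>f A. f \<in> S \<Longrightarrow> A \<in> sets ?M \<Longrightarrow> measure L1.\<nu> A \<le> \<delta> \<Longrightarrow>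
      (\<integral>t. indicator A t * \<bar>f t\<bar> \<partial>?M) \<le> 3 / 4 * q f"
    using L1.uniformly_integrable by blast
  obtain x y A where xy: "x \<in> D" "y \<in> D" "A \<in> sets ?M" "measure L1.\<nu> A \<le> \<delta>"
    "3 / 4 * (\<integral>t. \<bar>x t - y t\<bar> \<partial>?M) < (\<integral>t. indicator A t * \<bar>x t - y t\<bar> \<partial>?M)"
    using L1'.concentrated_difference[OF \<delta>(1)] by blast
  have "(\<integral>t. indicator A t * \<bar>(x - y) t\<bar> \<partial>?M) \<le> 3 / 4 * q (x - y)"
    by (rule \<delta>(2)[OF diff_S[OF xy(1,2)] xy(3,4)])
  with xy(5) q_L1[OF xy(1,2)] show False by simp
qed

end

section \<open>Variable Lebesgue spaces\<close>

text \<open>The passage from classes to functions: the members of \<open>X\<close> are represented by the set \<open>S\<close> of all measurable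
  functions whose class is in \<open>X\<close>, with the seminorm given by the norm of the class.\<close>

locale reflexive_subspace =
  fixes M :: "'a measure" and p :: "'a \<Rightarrow> ennreal" and X :: "('a \<Rightarrow> real) set set"
  assumes sigma_finite: "sigma_finite_measure M"
    and p_measurable [measurable]: "p \<in> borel_measurable M" and p_ge: "\<And>t. t \<in> space M \<Longrightarrow> 1 \<le> p t"
    and p_bounded: "esssup M p < \<infinity>"
    and X_subspace: "linear_subspace X (variable_Lp M p)"
    and X_reflexive: "reflexive_sp (subspace_sp (variable_Lp M p) X)"
begin

definition P :: real where "P = max 1 (enn2real (esssup M p))"

text \<open>Truncation changes the exponent on a null set only and gives bounds that hold everywhere.\<close>

definition e :: "'a \<Rightarrow> real" where "e t = max 1 (min P (enn2real (p t)))"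

sublocale nakano M e P
proof
  show "e \<in> borel_measurable M" unfolding e_def[abs_def] by measurable
qed (auto simp: e_def P_def)

lemma e_eq_p: "AE t in M. p t < \<infinity> \<and> e t = enn2real (p t)"
  using esssup_AE[where M = M and f = p] AE_space
proof eventually_elim
  case (elim t)
  have "p t < \<infinity>" using elim(1) p_bounded by (rule le_less_trans)
  moreover have "enn2real (p t) \<le> enn2real (esssup M p)"
    using elim(1) p_bounded by (intro enn2real_mono) auto
  moreover have "enn2real 1 \<le> enn2real (p t)"
    using p_ge[OF elim(2)] calculation(1) by (intro enn2real_mono) auto
  ultimately show ?case by (auto simp: e_def P_def)
qed

lemma modular_eq_\<rho>:
  assumes [measurable]: "g \<in> borel_measurable M"
  shows "modular M p g = \<rho> g"
proof -
  let ?N = "restrict_space M {t \<in> space M. p t = \<infinity>}"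
  have "AE t in M. \<not> p t = \<infinity>" using e_eq_p by eventually_elim auto
  then have "emeasure M {t \<in> space M. p t = \<infinity>} = 0"
    by (subst (asm) AE_iff_measurable[OF _ refl]) (auto simp: Collect_conj_eq[symmetric])
  then have "emeasure ?N (space ?N) = 0" by (simp add: space_restrict_space emeasure_restrict_space)
  then have "ae_filter ?N = bot" unfolding ae_filter_eq_bot_iff .
  moreover have "(\<lambda>t. ennreal \<bar>g t\<bar>) \<in> borel_measurable ?N" by (intro measurable_restrict_space1) measurable
  ultimately have "esssup ?N (\<lambda>t. ennreal \<bar>g t\<bar>) = bot"
    by (simp add: esssup_def)
  moreover have "(\<integral>\<^sup>+t\<in>{t\<in>space M. p t < \<infinity>}. ennreal (\<bar>g t\<bar> powr enn2real (p t)) \<partial>M) = \<rho> g"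
    unfolding \<rho>_def
  proof (rule nn_integral_cong_AE)
    show "AE t in M. ennreal (\<bar>g t\<bar> powr enn2real (p t)) * indicator {t \<in> space M. p t < \<infinity>} t = ennreal (\<bar>g t\<bar> powr e t)"
      using e_eq_p AE_space by eventually_elim auto
  qed
  ultimately show ?thesis by (simp add: modular_def bot_ennreal)
qed

lemma luxemburg_norm_eq_N:
  assumes [measurable]: "g \<in> borel_measurable M" shows "luxemburg_norm M p g = N g"
proof -
  have "modular M p (\<lambda>t. g t / a) = \<rho> (\<lambda>t. g t / a)" for a by (rule modular_eq_\<rho>) measurable
  then show ?thesis by (simp add: luxemburg_norm_def N_def)
qed

abbreviation cls :: "('a \<Rightarrow> real) \<Rightarrow> ('a \<Rightarrow> real) set" where "cls \<equiv> ae_class M"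
abbreviation E :: "('a \<Rightarrow> real) set normed_sp" where "E \<equiv> subspace_sp (variable_Lp M p) X"

lemma cls_self: "f \<in> borel_measurable M \<Longrightarrow> f \<in> cls f"
  by (simp add: ae_class_def)

lemma cls_measurable: "g \<in> cls f \<Longrightarrow> g \<in> borel_measurable M"
  and cls_AE: "g \<in> cls f \<Longrightarrow> AE t in M. g t = f t"
  by (simp_all add: ae_class_def)

lemma cls_eq: "AE t in M. f t = g t \<Longrightarrow> cls f = cls g"
  unfolding ae_class_def by (auto elim: eventually_elim2)

lemma vadd_cls:
  assumes f: "f \<in> borel_measurable M" and g: "g \<in> borel_measurable M"
  shows "vadd E (cls f) (cls g) = cls (f + g)"
proof -
  have "(\<exists>f'\<in>cls f. \<exists>g'\<in>cls g. AE t in M. h t = f' t + g' t) \<longleftrightarrow> (AE t in M. h t = (f + g) t)" for h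
  proof
    assume "\<exists>f'\<in>cls f. \<exists>g'\<in>cls g. AE t in M. h t = f' t + g' t"
    then obtain f' g' where *: "f' \<in> cls f" "g' \<in> cls g" "AE t in M. h t = f' t + g' t" by blast
    from *(3) cls_AE[OF *(1)] cls_AE[OF *(2)] show "AE t in M. h t = (f + g) t"
      by eventually_elim simp
  next
    assume "AE t in M. h t = (f + g) t"
    then show "\<exists>f'\<in>cls f. \<exists>g'\<in>cls g. AE t in M. h t = f' t + g' t"
      using cls_self[OF f] cls_self[OF g] by (intro bexI[of _ f] bexI[of _ g]) auto
  qed
  then show ?thesis by (simp add: subspace_sp_def variable_Lp_def ae_class_def[of M "f + g"])
qed

lemma vscale_cls:
  assumes f: "f \<in> borel_measurable M"
  shows "vscale E c (cls f) = cls (c *\<^sub>R f)"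
proof -
  have "(\<exists>f'\<in>cls f. AE t in M. h t = c * f' t) \<longleftrightarrow> (AE t in M. h t = (c *\<^sub>R f) t)" for h
  proof
    assume "\<exists>f'\<in>cls f. AE t in M. h t = c * f' t"
    then obtain f' where *: "f' \<in> cls f" "AE t in M. h t = c * f' t" by blast
    from *(2) cls_AE[OF *(1)] show "AE t in M. h t = (c *\<^sub>R f) t" by eventually_elim simp
  next
    assume "AE t in M. h t = (c *\<^sub>R f) t"
    then show "\<exists>f'\<in>cls f. AE t in M. h t = c * f' t"
      using cls_self[OF f] by (intro bexI[of _ f]) auto
  qed
  then show ?thesis by (simp add: subspace_sp_def variable_Lp_def ae_class_def[of M "c *\<^sub>R f"])
qed

lemma vnorm_cls:
  assumes f: "f \<in> borel_measurable M" shows "vnorm E (cls f) = N f"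
proof -
  have "(SOME g. g \<in> cls f) \<in> cls f" using someI[of "\<lambda>g. g \<in> cls f", OF cls_self[OF f]] .
  then show ?thesis
    using luxemburg_norm_eq_N[OF cls_measurable] N_cong_AE[OF cls_AE]
    by (simp add: subspace_sp_def variable_Lp_def)
qed

definition S :: "('a \<Rightarrow> real) set" where "S = {f \<in> borel_measurable M. cls f \<in> X}"

lemma S_measurable: "f \<in> S \<Longrightarrow> f \<in> borel_measurable M"
  and S_cls: "f \<in> S \<Longrightarrow> cls f \<in> X"
  by (simp_all add: S_def)

lemma vecs_E [simp]: "vecs E = X"
  by (simp add: subspace_sp_def)

lemma representative:
  assumes "F \<in> X" shows "\<exists>f\<in>S. F = cls f"
proof -
  have "F \<in> vecs (variable_Lp M p)" using X_subspace assms by (auto simp: linear_subspace_def)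
  then obtain f where "F = cls f" "f \<in> borel_measurable M" by (auto simp: variable_Lp_def)
  with assms show ?thesis by (auto simp: S_def)
qed

lemma S_L: "S \<subseteq> L"
proof
  fix f assume f: "f \<in> S"
  then have "cls f \<in> vecs (variable_Lp M p)" using X_subspace by (auto simp: linear_subspace_def S_def)
  then obtain g l where g: "cls f = cls g" "g \<in> borel_measurable M" "0 < l" "modular M p (\<lambda>t. g t / l) < \<infinity>"
    by (auto simp: variable_Lp_def)
  have "f \<in> cls g" using cls_self[OF S_measurable[OF f]] g(1) by simp
  then have "AE t in M. f t / l = g t / l" using cls_AE by auto
  then have "\<rho> (\<lambda>t. f t / l) = \<rho> (\<lambda>t. g t / l)" by (rule \<rho>_cong_AE)
  also have "\<dots> = modular M p (\<lambda>t. g t / l)" using g(2) by (intro modular_eq_\<rho>[symmetric]) simp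
  finally have "\<rho> (\<lambda>t. f t / l) < \<infinity>" using g(4) by simp
  then show "f \<in> L" using S_measurable[OF f] g(3) by (auto simp: L_def)
qed

lemma S_add: "f \<in> S \<Longrightarrow> g \<in> S \<Longrightarrow> f + g \<in> S"
proof -
  assume fg: "f \<in> S" "g \<in> S"
  then have "vadd (variable_Lp M p) (cls f) (cls g) \<in> X"
    using X_subspace by (simp add: linear_subspace_def S_def)
  then have "cls (f + g) \<in> X"
    using vadd_cls[of f g] fg by (simp add: S_def subspace_sp_def)
  moreover have "f + g \<in> borel_measurable M"
    using fg[THEN S_measurable] by (simp add: plus_fun_def)
  ultimately show ?thesis by (simp add: S_def)
qed

lemma S_scale: "f \<in> S \<Longrightarrow> c *\<^sub>R f \<in> S"
proof -
  assume f: "f \<in> S"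
  then have "vscale (variable_Lp M p) c (cls f) \<in> X"
    using X_subspace by (simp add: linear_subspace_def S_def)
  then have "cls (c *\<^sub>R f) \<in> X"
    using vscale_cls[of f c] f by (simp add: S_def subspace_sp_def)
  moreover have "c *\<^sub>R f \<in> borel_measurable M"
    using S_measurable[OF f] by (simp add: scaleR_fun_def)
  ultimately show ?thesis by (simp add: S_def)
qed

lemma subspace_S: "real_vector.subspace S"
proof -
  obtain F where "F \<in> X" using X_subspace by (auto simp: linear_subspace_def)
  then obtain f where "f \<in> S" using representative by blast
  then have "0 \<in> S" using S_scale[of f 0] by simp
  then show ?thesis using S_add S_scale by (simp add: subspace_def)
qed

text \<open>A linear projection of all functions onto \<open>S\<close>.\<close>

definition Pr :: "('a \<Rightarrow> real) \<Rightarrow> ('a \<Rightarrow> real)" where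
  "Pr = (SOME Q. linear Q \<and> (\<forall>x. Q x \<in> S) \<and> (\<forall>x\<in>S. Q x = x))"

lemma Pr: "linear Pr" "Pr x \<in> S" "x \<in> S \<Longrightarrow> Pr x = x"
proof -
  have "\<exists>Q. linear Q \<and> (\<forall>x. Q x \<in> S) \<and> (\<forall>x\<in>S. Q x = x)"
    using subspace_projection[OF subspace_S] by metis
  from someI_ex[OF this] show "linear Pr" "Pr x \<in> S" "x \<in> S \<Longrightarrow> Pr x = x"
    unfolding Pr_def by blast+
qed

definition q :: "('a \<Rightarrow> real) \<Rightarrow> real" where "q f = N (Pr f)"

lemma q_eq_N: "f \<in> S \<Longrightarrow> q f = N f"
  by (simp add: q_def Pr(3))

lemma Pr_L: "Pr f \<in> L"
  using Pr(2) S_L by blast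

sublocale seminormed q S
proof
  show "real_vector.subspace S" by (rule subspace_S)
  show "q (x + y) \<le> q x + q y" for x y
    unfolding q_def linear_add[OF Pr(1)] using N_triangle[OF Pr_L Pr_L, of x y] by (simp add: plus_fun_def)
  show "q (c *\<^sub>R x) = \<bar>c\<bar> * q x" for c x
    unfolding q_def linear_scale[OF Pr(1)] using N_scale[OF Pr_L, of c x] by (simp add: scaleR_fun_def)
qed

lemma q_Pr: "q (v - Pr v) = 0"
  by (simp add: q_def linear_diff[OF Pr(1)] Pr(3)[OF Pr(2)] N_zero[unfolded zero_fun_def[symmetric]])

lemma cls_eq_iff: "f \<in> S \<Longrightarrow> g \<in> S \<Longrightarrow> q (f - g) = 0 \<Longrightarrow> cls f = cls g"
proof -
  assume fg: "f \<in> S" "g \<in> S" "q (f - g) = 0"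
  have "f - g \<in> S" using fg subspace by (intro subspace_diff)
  then have "f - g \<in> L" "N (f - g) = 0" using fg(3) q_eq_N S_L by auto
  then have "AE t in M. (f - g) t = 0" by (rule N_eq_0)
  then show ?thesis by (intro cls_eq) (auto elim: eventually_mono)
qed

text \<open>A bounded functional on the space of classes, read as a functional on all functions.\<close>

definition pull :: "(('a \<Rightarrow> real) set \<Rightarrow> real) \<Rightarrow> ('a \<Rightarrow> real) \<Rightarrow> real" where
  "pull \<phi> v = \<phi> (cls (Pr v))"

lemma cls_Pr: "cls (Pr v) \<in> X" "vnorm E (cls (Pr v)) = q v"
  "cls (Pr (v + w)) = vadd E (cls (Pr v)) (cls (Pr w))" "cls (Pr (c *\<^sub>R v)) = vscale E c (cls (Pr v))"
  using S_measurable[OF Pr(2)] S_cls[OF Pr(2)]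
  by (simp_all add: vnorm_cls q_def vadd_cls vscale_cls linear_add[OF Pr(1)] linear_scale[OF Pr(1)])

lemma vecs_dual: "\<phi> \<in> vecs (dual_sp E) \<longleftrightarrow> \<phi> \<in> extensional X \<and> bounded_functional E \<phi>"
  by (simp add: dual_sp_def)

lemma bounded_functionalD:
  assumes "bounded_functional E \<phi>"
  shows "F \<in> X \<Longrightarrow> G \<in> X \<Longrightarrow> \<phi> (vadd E F G) = \<phi> F + \<phi> G" "F \<in> X \<Longrightarrow> \<phi> (vscale E c F) = c * \<phi> F"
    "\<exists>K\<ge>0. \<forall>v. \<bar>pull \<phi> v\<bar> \<le> K * q v"
proof -
  obtain K where K: "\<And>F. F \<in> X \<Longrightarrow> \<bar>\<phi> F\<bar> \<le> K * vnorm E F"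
    using assms unfolding bounded_functional_def vecs_E by blast
  have "\<bar>pull \<phi> v\<bar> \<le> max K 0 * q v" for v
    using K[OF cls_Pr(1)[of v]] mult_right_mono[of K "max K 0" "q v"] cls_Pr(2)[of v] by (simp add: pull_def)
  then show "\<exists>K\<ge>0. \<forall>v. \<bar>pull \<phi> v\<bar> \<le> K * q v" by (intro exI[of _ "max K 0"]) simp
qed (use assms in \<open>auto simp: bounded_functional_def\<close>)

lemma pull_dual:
  assumes "bounded_functional E \<phi>" shows "pull \<phi> \<in> dual"
proof -
  have "linear (pull \<phi>)"
    using bounded_functionalD(1,2)[OF assms] cls_Pr(1)
    by (intro linearI) (simp_all add: pull_def cls_Pr(3,4))
  with bounded_functionalD(3)[OF assms] show ?thesis by (auto simp: dual_def)
qed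

text \<open>The norm of the dual is an admissible constant in the sense of the reflexivity assumption on seminormed
  spaces.\<close>

lemma dual_norm_bound:
  assumes "bounded_functional E \<phi>"
  shows "0 \<le> vnorm (dual_sp E) \<phi>" "\<bar>pull \<phi> v\<bar> \<le> vnorm (dual_sp E) \<phi> * q v"
proof -
  let ?B = "{F \<in> X. vnorm E F \<le> 1}"
  have norm: "vnorm (dual_sp E) \<phi> = (SUP F\<in>?B. \<bar>\<phi> F\<bar>)" by (simp add: dual_sp_def)
  obtain K where K: "0 \<le> K" "\<And>v. \<bar>pull \<phi> v\<bar> \<le> K * q v" using bounded_functionalD(3)[OF assms] by blast
  have "\<bar>\<phi> F\<bar> \<le> K" if "F \<in> ?B" for F
  proof -
    obtain f where f: "f \<in> S" "F = cls f" using \<open>F \<in> ?B\<close> representative by blast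
    have "\<bar>\<phi> F\<bar> \<le> K * q f" using K(2)[of f] f by (simp add: pull_def Pr(3))
    also have "\<dots> \<le> K * 1" using that f K(1) q_eq_N vnorm_cls[OF S_measurable] by (intro mult_left_mono) auto
    finally show ?thesis by simp
  qed
  then have bdd: "bdd_above ((\<lambda>F. \<bar>\<phi> F\<bar>) ` ?B)" by (rule bdd_aboveI2)
  have upper: "\<bar>pull \<phi> v\<bar> \<le> vnorm (dual_sp E) \<phi>" if "q v \<le> 1" for v
    unfolding norm pull_def using that cls_Pr(1,2) by (intro cSUP_upper bdd) auto
  show nonneg: "0 \<le> vnorm (dual_sp E) \<phi>"
  proof -
    have "\<bar>pull \<phi> 0\<bar> \<le> vnorm (dual_sp E) \<phi>" by (rule upper) simp
    then show ?thesis by (rule order_trans[OF abs_ge_zero])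
  qed
  show "\<bar>pull \<phi> v\<bar> \<le> vnorm (dual_sp E) \<phi> * q v"
  proof (cases "q v = 0")
    case True
    then show ?thesis using K(2)[of v] by simp
  next
    case False
    then have q: "0 < q v" using q_nonneg[of v] by linarith
    have lin: "linear (pull \<phi>)" using pull_dual[OF assms] by (simp add: dual_def)
    have "\<bar>pull \<phi> ((1 / q v) *\<^sub>R v)\<bar> \<le> vnorm (dual_sp E) \<phi>" using q by (intro upper) (simp add: q_scale)
    then show ?thesis using q by (simp add: linear_scale[OF lin] abs_mult field_simps)
  qed
qed

sublocale reflexive_seminormed q S
proof
  fix \<Phi> r
  assume add: "\<And>\<phi> \<psi>. \<phi> \<in> dual \<Longrightarrow> \<psi> \<in> dual \<Longrightarrow> \<Phi> (\<phi> + \<psi>) = \<Phi> \<phi> + \<Phi> \<psi>"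
    and scale: "\<And>c \<phi>. \<phi> \<in> dual \<Longrightarrow> \<Phi> (c *\<^sub>R \<phi>) = c * \<Phi> \<phi>"
    and bound: "\<And>\<phi> c. \<phi> \<in> dual \<Longrightarrow> 0 \<le> c \<Longrightarrow> (\<And>x. \<bar>\<phi> x\<bar> \<le> c * q x) \<Longrightarrow> \<bar>\<Phi> \<phi>\<bar> \<le> r * c"
  \<comment> \<open>\<open>\<Phi>\<close> acts on functionals on functions; composition with \<open>pull\<close> makes it a member of the bidual of \<open>X\<close>.\<close>
  define \<Psi> where "\<Psi> = (\<lambda>\<phi>\<in>vecs (dual_sp E). \<Phi> (pull \<phi>))"
  have bf: "bounded_functional E \<phi>" if "\<phi> \<in> vecs (dual_sp E)" for \<phi> using that by (simp add: vecs_dual)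
  have X_add: "vadd E F G \<in> X" if "F \<in> X" "G \<in> X" for F G
    using X_subspace that by (simp add: linear_subspace_def subspace_sp_def)
  have X_scale: "vscale E c F \<in> X" if "F \<in> X" for c F
    using X_subspace that by (simp add: linear_subspace_def subspace_sp_def)
  have bf_pull: "\<bar>\<phi> F\<bar> \<le> K * vnorm E F" if "F \<in> X" "\<And>v. \<bar>pull \<phi> v\<bar> \<le> K * q v" for \<phi> F K
  proof -
    obtain f where "f \<in> S" "F = cls f" using representative[OF \<open>F \<in> X\<close>] by blast
    then show ?thesis using that(2)[of f] vnorm_cls[OF S_measurable] q_eq_N by (simp add: pull_def Pr(3))
  qed
  have dual_add: "vadd (dual_sp E) \<phi> \<psi> \<in> vecs (dual_sp E)" "pull (vadd (dual_sp E) \<phi> \<psi>) = pull \<phi> + pull \<psi>"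
    if \<phi>: "\<phi> \<in> vecs (dual_sp E)" and \<psi>: "\<psi> \<in> vecs (dual_sp E)" for \<phi> \<psi>
  proof -
    let ?\<chi> = "vadd (dual_sp E) \<phi> \<psi>"
    have \<chi>: "?\<chi> = (\<lambda>F\<in>X. \<phi> F + \<psi> F)" by (simp add: dual_sp_def)
    show pull: "pull ?\<chi> = pull \<phi> + pull \<psi>" using cls_Pr(1) by (auto simp: \<chi> pull_def)
    obtain K where K: "\<And>v. \<bar>(pull \<phi> + pull \<psi>) v\<bar> \<le> K * q v"
      using subspace_add[OF subspace_dual pull_dual[OF bf[OF \<phi>]] pull_dual[OF bf[OF \<psi>]]]
      unfolding dual_def by blast
    then have "\<forall>F\<in>X. \<bar>?\<chi> F\<bar> \<le> K * vnorm E F" using bf_pull[of _ ?\<chi> K] pull by simp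
    moreover have "?\<chi> \<in> extensional X" by (simp add: \<chi>)
    ultimately show "?\<chi> \<in> vecs (dual_sp E)"
      using bounded_functionalD(1,2)[OF bf[OF \<phi>]] bounded_functionalD(1,2)[OF bf[OF \<psi>]] X_add X_scale
      unfolding vecs_dual bounded_functional_def by (auto simp: \<chi> algebra_simps)
  qed
  have dual_scale: "vscale (dual_sp E) c \<phi> \<in> vecs (dual_sp E)" "pull (vscale (dual_sp E) c \<phi>) = c *\<^sub>R pull \<phi>"
    if \<phi>: "\<phi> \<in> vecs (dual_sp E)" for \<phi> c
  proof -
    let ?\<chi> = "vscale (dual_sp E) c \<phi>"
    have \<chi>: "?\<chi> = (\<lambda>F\<in>X. c * \<phi> F)" by (simp add: dual_sp_def)
    show pull: "pull ?\<chi> = c *\<^sub>R pull \<phi>" using cls_Pr(1) by (auto simp: \<chi> pull_def)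
    obtain K where K: "\<And>v. \<bar>(c *\<^sub>R pull \<phi>) v\<bar> \<le> K * q v"
      using subspace_scale[OF subspace_dual pull_dual[OF bf[OF \<phi>]], of c]
      unfolding dual_def by blast
    then have "\<forall>F\<in>X. \<bar>?\<chi> F\<bar> \<le> K * vnorm E F" using bf_pull[of _ ?\<chi> K] pull by simp
    moreover have "?\<chi> \<in> extensional X" by (simp add: \<chi>)
    ultimately show "?\<chi> \<in> vecs (dual_sp E)"
      using bounded_functionalD(1,2)[OF bf[OF \<phi>]] X_add X_scale
      unfolding vecs_dual bounded_functional_def by (auto simp: \<chi> algebra_simps)
  qed
  have "bounded_functional (dual_sp E) \<Psi>"
    unfolding bounded_functional_def
  proof (intro conjI ballI allI)
    show "\<Psi> (vadd (dual_sp E) \<phi> \<psi>) = \<Psi> \<phi> + \<Psi> \<psi>" if "\<phi> \<in> vecs (dual_sp E)" "\<psi> \<in> vecs (dual_sp E)" for \<phi> \<psi>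
      using dual_add[OF that] add[OF pull_dual[OF bf[OF that(1)]] pull_dual[OF bf[OF that(2)]]] that by (simp add: \<Psi>_def)
    show "\<Psi> (vscale (dual_sp E) c \<phi>) = c * \<Psi> \<phi>" if "\<phi> \<in> vecs (dual_sp E)" for c \<phi>
      using dual_scale[OF that] scale[OF pull_dual[OF bf[OF that]]] that by (simp add: \<Psi>_def)
    have "\<bar>\<Psi> \<phi>\<bar> \<le> r * vnorm (dual_sp E) \<phi>" if "\<phi> \<in> vecs (dual_sp E)" for \<phi>
      using bound[OF pull_dual[OF bf[OF that]] dual_norm_bound[OF bf[OF that]]] that by (simp add: \<Psi>_def)
    then show "\<exists>K. \<forall>\<phi>\<in>vecs (dual_sp E). \<bar>\<Psi> \<phi>\<bar> \<le> K * vnorm (dual_sp E) \<phi>" by blast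
  qed
  then have "\<Psi> \<in> vecs (dual_sp (dual_sp E))" by (simp add: dual_sp_def[of "dual_sp E"] \<Psi>_def)
  then have "\<Psi> \<in> canonical_embedding E ` X" using X_reflexive by (simp add: reflexive_sp_def)
  then obtain F where F: "F \<in> X" "\<Psi> = canonical_embedding E F" by blast
  obtain f where f: "f \<in> S" "F = cls f" using representative[OF F(1)] by blast
  have "\<Phi> \<psi> = \<psi> f" if \<psi>: "\<psi> \<in> dual" for \<psi>
  proof -
    have lin: "linear \<psi>" using \<psi> by (simp add: dual_def)
    obtain K where K: "\<And>v. \<bar>\<psi> v\<bar> \<le> K * q v" using \<psi> unfolding dual_def by blast
    have \<psi>_cong: "\<psi> x = \<psi> y" if "q (x - y) = 0" for x y
    proof -
      have "\<bar>\<psi> (x - y)\<bar> \<le> K * 0" using K[of "x - y"] unfolding that .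
      then show ?thesis unfolding linear_diff[OF lin] by simp
    qed
    \<comment> \<open>Conversely, a bounded functional \<open>\<psi>\<close> on functions descends to the classes in \<open>X\<close>.\<close>
    define \<phi> where "\<phi> = (\<lambda>G\<in>X. \<psi> (SOME g. g \<in> S \<and> G = cls g))"
    have \<phi>: "\<phi> (cls g) = \<psi> g" if g: "g \<in> S" for g
    proof -
      let ?k = "SOME k. k \<in> S \<and> cls g = cls k"
      have "\<exists>k. k \<in> S \<and> cls g = cls k" using g by blast
      from someI_ex[OF this] have k: "?k \<in> S" "cls g = cls ?k" by blast+
      have "AE t in M. ?k t = g t" using cls_AE[of ?k g] cls_self[OF S_measurable[OF k(1)]] k(2) by simp
      moreover have "?k - g \<in> S" using k g subspace by (intro subspace_diff) auto
      ultimately have "q (?k - g) = 0"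
        using N_cong_AE[of "?k - g" "\<lambda>t. 0"] by (simp add: q_eq_N N_zero)
      then show ?thesis using g by (simp add: \<phi>_def S_cls \<psi>_cong)
    qed
    have pull: "pull \<phi> = \<psi>"
    proof
      fix v
      show "pull \<phi> v = \<psi> v" using \<phi>[OF Pr(2)] \<psi>_cong[OF q_Pr, of v] by (simp add: pull_def)
    qed
    have "bounded_functional E \<phi>"
      unfolding bounded_functional_def vecs_E
    proof (intro conjI ballI allI)
      fix G H c assume "G \<in> X"
      then obtain g where g: "g \<in> S" "G = cls g" using representative by blast
      show "\<phi> (vscale E c G) = c * \<phi> G"
        using g S_scale[of g c] \<phi> by (simp add: vscale_cls[OF S_measurable] linear_scale[OF lin])
      assume "H \<in> X"
      then obtain h where h: "h \<in> S" "H = cls h" using representative by blast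
      show "\<phi> (vadd E G H) = \<phi> G + \<phi> H"
        using g h S_add[of g h] \<phi> by (simp add: vadd_cls[OF S_measurable S_measurable] linear_add[OF lin])
    next
      show "\<exists>K. \<forall>G\<in>X. \<bar>\<phi> G\<bar> \<le> K * vnorm E G" using bf_pull[of _ \<phi> K] pull K by auto
    qed
    then have \<phi>_dual: "\<phi> \<in> vecs (dual_sp E)" by (simp add: vecs_dual \<phi>_def)
    then have "\<Phi> \<psi> = \<Psi> \<phi>" by (simp add: \<Psi>_def pull)
    also have "\<dots> = \<phi> F" using F(2) \<phi>_dual by (simp add: canonical_embedding_def)
    also have "\<dots> = \<psi> f" using f \<phi> by simp
    finally show ?thesis .
  qed
  with f(1) show "\<exists>x\<in>S. \<forall>\<phi>\<in>dual. \<Phi> \<phi> = \<phi> x" by blast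
qed

sublocale nakano_subspace M e P q S
  by (intro nakano_subspace.intro nakano_axioms reflexive_seminormed_axioms nakano_subspace_axioms.intro
      sigma_finite S_L q_eq_N)

lemma vdist_cls:
  assumes "f \<in> S" "g \<in> S" shows "vdist E (cls f) (cls g) = q (f - g)"
proof -
  have "(-1) *\<^sub>R g \<in> S" "f - g \<in> S" using assms subspace by (auto intro: subspace_diff subspace_neg)
  moreover have "f + (-1) *\<^sub>R g = f - g" by simp
  ultimately show ?thesis
    using assms by (simp add: vdist_def vscale_cls vadd_cls vnorm_cls S_measurable q_eq_N)
qed

lemma fixed_point_property: "has_FPP E"
  unfolding has_FPP_def vecs_E
proof (intro allI impI, elim conjE)
  fix C T
  assume CX: "C \<subseteq> X" and C: "C \<noteq> {}" "closed_in E C" "convex_in E C" "bounded_in E C"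
    and T: "T \<in> C \<rightarrow> C" and nonexp: "nonexpansive_on E C T"
  define C' where "C' = {f \<in> S. cls f \<in> C}"
  define T' where "T' = (\<lambda>f. SOME g. g \<in> S \<and> T (cls f) = cls g)"
  have T': "T' f \<in> S" "cls (T' f) = T (cls f)" if "f \<in> C'" for f
  proof -
    have "T (cls f) \<in> X" using that T CX by (auto simp: C'_def)
    then have "\<exists>g. g \<in> S \<and> T (cls f) = cls g" using representative by blast
    from someI_ex[OF this] show "T' f \<in> S" "cls (T' f) = T (cls f)" by (simp_all add: T'_def)
  qed
  have "\<exists>x\<in>C'. q (T' x - x) = 0"
  proof -
    obtain B where B: "\<And>F. F \<in> C \<Longrightarrow> vnorm E F \<le> B" using C(4) by (auto simp: bounded_in_def)
    show ?thesis
    proof (rule fixed_point_up_to_norm)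
      obtain F where "F \<in> C" using C(1) by blast
      then show "C' \<noteq> {}" using CX representative[of F] by (auto simp: C'_def)
      show "convex C'"
      proof (rule convexI)
        fix f g and u v :: real assume *: "f \<in> C'" "g \<in> C'" "0 \<le> u" "0 \<le> v" "u + v = 1"
        have fg: "f \<in> S" "g \<in> S" "cls f \<in> C" "cls g \<in> C" using * by (auto simp: C'_def)
        have "vadd E (vscale E (1 - v) (cls f)) (vscale E v (cls g)) \<in> C"
          using C(3) fg * by (auto simp: convex_in_def)
        moreover have "1 - v = u" using *(5) by simp
        ultimately show "u *\<^sub>R f + v *\<^sub>R g \<in> C'"
          using fg S_scale S_add by (simp add: C'_def vscale_cls vadd_cls S_measurable)
      qed
      show "q_closed C'"
        unfolding q_closed_def
      proof (intro conjI ballI impI)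
        show "C' \<subseteq> S" by (auto simp: C'_def)
        fix x assume x: "x \<in> S" "\<forall>e>0. \<exists>k\<in>C'. q (x - k) < e"
        have "\<exists>k. k \<in> C' \<and> q (x - k) < 1 / real (Suc n)" for n
          using x(2) by (metis of_nat_0_less_iff zero_less_Suc zero_less_divide_1_iff)
        then obtain k where k: "\<And>n. k n \<in> C'" "\<And>n. q (x - k n) < 1 / real (Suc n)" by metis
        have dist: "vdist E (cls (k n)) (cls x) = q (x - k n)" for n
          using k(1)[of n] x(1) q_commute[of x "k n"] by (simp add: vdist_cls C'_def)
        have "(\<lambda>n. vdist E (cls (k n)) (cls x)) \<longlonglongrightarrow> 0"
          unfolding dist
        proof (rule tendsto_sandwich[OF _ _ tendsto_const])
          show "(\<lambda>n. 1 / real (Suc n)) \<longlonglongrightarrow> 0" using LIMSEQ_Suc[OF lim_const_over_n[of 1]] by simp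
        qed (use k(2) in \<open>auto intro!: always_eventually less_imp_le\<close>)
        moreover have "\<forall>n. cls (k n) \<in> C" using k(1) by (simp add: C'_def)
        ultimately have "cls x \<in> C" using C(2) S_cls[OF x(1)]
          unfolding closed_in_def vecs_E by (elim allE[of _ "\<lambda>n. cls (k n)"] ballE[of _ _ "cls x"]) auto
        then show "x \<in> C'" using x(1) by (simp add: C'_def)
      qed
      show "T' f \<in> C'" if "f \<in> C'" for f using T'[OF that] that T by (auto simp: C'_def)
      show "q f \<le> B" if "f \<in> C'" for f
        using that B[of "cls f"] vnorm_cls[OF S_measurable, of f] by (simp add: C'_def q_eq_N)
      show "q (T' f - T' g) \<le> q (f - g)" if "f \<in> C'" "g \<in> C'" for f g
      proof -
        have "vdist E (T (cls f)) (T (cls g)) \<le> vdist E (cls f) (cls g)"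
          using nonexp that by (simp add: nonexpansive_on_def C'_def)
        then show ?thesis
          using T'[OF that(1)] T'[OF that(2)] that vdist_cls[of f g] vdist_cls[of "T' f" "T' g"] by (simp add: C'_def)
      qed
    qed
  qed
  then obtain x where x: "x \<in> C'" "q (T' x - x) = 0" by blast
  then have "cls (T' x) = cls x" using T'[OF x(1)] by (intro cls_eq_iff) (auto simp: C'_def)
  then show "\<exists>x\<in>C. T x = x" using x(1) T'[OF x(1)] by (intro bexI[of _ "cls x"]) (auto simp: C'_def)
qed

end

theorem theorem4p2:
  fixes M :: "'a measure" and p :: "'a \<Rightarrow> ennreal" and X :: "('a \<Rightarrow> real) set set"
  assumes "sigma_finite_measure M" and "complete_measure M"
    and "p \<in> borel_measurable M" and "\<And>t. t \<in> space M \<Longrightarrow> 1 \<le> p t"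
    and "esssup M p < \<infinity>"
    and "linear_subspace X (variable_Lp M p)"
    and "reflexive_sp (subspace_sp (variable_Lp M p) X)"
  shows "has_FPP (subspace_sp (variable_Lp M p) X)"
proof -
  interpret reflexive_subspace M p X using assms by (intro reflexive_subspace.intro)
  show ?thesis by (rule fixed_point_property)
qed

end
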